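(* Let $\Omega\subset\mathbb{R}^N$ be a domain, let $1<p,q<N$ and $\delta,\mu>0$ with $D:=\delta\mu-(p-1)(q-1)>0$. Assume that $\mathcal{A}_p$ is strongly $p$-coercive (S-$p$-C) and $\mathcal{A}_q$ is strongly $q$-coercive (S-$q$-C) on $\Omega$, with constants $K_{1,p},K_{2,p}$ and $K_{1,q},K_{2,q}$ respectively. Let $u\in W^{1,p}_{loc}(\Omega)\cap C(\Omega)$ and $v\in W^{1,q}_{loc}(\Omega)\cap C(\Omega)$ be nonnegative solutions of $$-\mathcal{A}_p u+v^{\delta}\le 0,\qquad -\mathcal{A}_q v+u^{\mu}\le 0\qquad\text{in }\Omega .$$ Then for any $x\in\Omega$ $$u(x)\le C\,d(x,\partial\Omega)^{-\gamma},\qquad v(x)\le C\,d(x,\partial\Omega)^{-\xi},$$ where $$\gamma=\frac{p(q-1)+q\delta}{D},\qquad \xi=\frac{q(p-1)+p\mu}{D},$$ and $C=C(N,p,q,\delta,\mu,K_{1,p},K_{2,p},K_{1,q},K_{2,q})$.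
   Context: $\mathcal{A}_p u:=\operatorname{div}[\mathrm{A}_p(x,u,\nabla u)]$ and $\mathcal{A}_q v:=\operatorname{div}[\mathrm{A}_q(x,v,\nabla v)]$, where $\mathrm{A}_p,\mathrm{A}_q:\Omega\times\mathbb{R}^+\times\mathbb{R}^N\to\mathbb{R}^N$ are Carathéodory functions ($\mathbb{R}^+=[0,\infty)$). $\mathcal{A}_p$ is S-$p$-C (strongly $p$-coercive) if there are constants $K_{1,p},K_{2,p}>0$ with $$\mathrm{A}_p(x,u,\eta)\cdot\eta\ge K_{1,p}|\eta|^p\ge K_{2,p}|\mathrm{A}_p(x,u,\eta)|^{p'}\qquad\forall (x,u,\eta)\in\Omega\times\mathbb{R}^+\times\mathbb{R}^N,$$ $p'=p/(p-1)$; similarly for $\mathcal{A}_q$ being S-$q$-C with $K_{1,q},K_{2,q}$. For $g\in L^1_{loc}(\Omega)$, a nonnegative $w\in W^{1,p}_{loc}(\Omega)$ satisfies $-\mathcal{A}_p w\ge g$ (resp. $\le$, $=$) in $\Omega$ if $\mathrm{A}_p(x,w,\nabla w)\in L^{p'}_{loc}(\Omega)$ and $\int_\Omega \mathrm{A}_p(x,w,\nabla w)\cdot\nabla\phi\ge\int_\Omega g\phi$ (resp. $\le$, $=$) for all nonnegative $\phi\in W^{1,\infty}(\Omega)$ with compact support in $\Omega$; similarly for $\mathcal{A}_q$. $d(x,\partial\Omega)$ is the distance from $x$ to the boundary. *)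

theory Defs
  imports "HOL-Analysis.Analysis"
begin

definition Lp_loc :: "real \<Rightarrow> 'a::euclidean_space set \<Rightarrow> ('a \<Rightarrow> 'b::euclidean_space) \<Rightarrow> bool" where
  "Lp_loc p \<Omega> f \<longleftrightarrow>
     f \<in> borel_measurable (lebesgue_on \<Omega>) \<and>
     (\<forall>K. compact K \<and> K \<subseteq> \<Omega> \<longrightarrow> integrable (lebesgue_on K) (\<lambda>x. norm (f x) powr p))"

definition Linf :: "'a::euclidean_space set \<Rightarrow> ('a \<Rightarrow> 'b::euclidean_space) \<Rightarrow> bool" where
  "Linf \<Omega> f \<longleftrightarrow>
     f \<in> borel_measurable (lebesgue_on \<Omega>) \<and>
     (\<exists>B. AE x in lebesgue_on \<Omega>. norm (f x) \<le> B)"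

definition compactly_supported_in :: "'a::euclidean_space set \<Rightarrow> ('a \<Rightarrow> real) \<Rightarrow> bool" where
  "compactly_supported_in \<Omega> \<phi> \<longleftrightarrow>
     (\<exists>K. compact K \<and> K \<subseteq> \<Omega> \<and> (\<forall>x. x \<notin> K \<longrightarrow> \<phi> x = 0))"

text \<open>The function \<open>G\<close> is the weak (distributional) gradient of \<open>w\<close> in \<open>\<Omega>\<close>, unique up to null sets.
  As in Gilbarg--Trudinger, Section 7.3, first-order weak derivatives are tested against
  continuously differentiable functions with compact support in \<open>\<Omega>\<close>.\<close>

definition has_weak_gradient ::
    "'a::euclidean_space set \<Rightarrow> ('a \<Rightarrow> real) \<Rightarrow> ('a \<Rightarrow> 'a) \<Rightarrow> bool" where
  "has_weak_gradient \<Omega> w G \<longleftrightarrow>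
     Lp_loc 1 \<Omega> w \<and> Lp_loc 1 \<Omega> G \<and>
     (\<forall>\<phi> \<phi>'. compactly_supported_in \<Omega> \<phi> \<and> (\<forall>x. GDERIV \<phi> x :> \<phi>' x) \<and> continuous_on UNIV \<phi>' \<longrightarrow>
        (LINT x|lebesgue_on \<Omega>. w x *\<^sub>R \<phi>' x) = - (LINT x|lebesgue_on \<Omega>. \<phi> x *\<^sub>R G x))"

text \<open>In the next two definitions the Sobolev function is given together with its weak gradient.\<close>

definition W1p_loc ::
    "real \<Rightarrow> 'a::euclidean_space set \<Rightarrow> ('a \<Rightarrow> real) \<Rightarrow> ('a \<Rightarrow> 'a) \<Rightarrow> bool" where
  "W1p_loc p \<Omega> w G \<longleftrightarrow> has_weak_gradient \<Omega> w G \<and> Lp_loc p \<Omega> w \<and> Lp_loc p \<Omega> G"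

definition W1inf ::
    "'a::euclidean_space set \<Rightarrow> ('a \<Rightarrow> real) \<Rightarrow> ('a \<Rightarrow> 'a) \<Rightarrow> bool" where
  "W1inf \<Omega> \<phi> H \<longleftrightarrow> has_weak_gradient \<Omega> \<phi> H \<and> Linf \<Omega> \<phi> \<and> Linf \<Omega> H"

text \<open>Vector fields \<open>A x s \<eta>\<close> are only relevant for \<open>x \<in> \<Omega>\<close> and \<open>s \<ge> 0\<close>.\<close>

definition caratheodory ::
    "'a::euclidean_space set \<Rightarrow> ('a \<Rightarrow> real \<Rightarrow> 'a \<Rightarrow> 'a) \<Rightarrow> bool" where
  "caratheodory \<Omega> A \<longleftrightarrow>
     (\<forall>s\<ge>0. \<forall>\<eta>. (\<lambda>x. A x s \<eta>) \<in> borel_measurable (lebesgue_on \<Omega>)) \<and>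
     (AE x in lebesgue_on \<Omega>. continuous_on ({0..} \<times> UNIV) (\<lambda>(s, \<eta>). A x s \<eta>))"

definition strongly_coercive ::
    "real \<Rightarrow> real \<Rightarrow> real \<Rightarrow> 'a::euclidean_space set \<Rightarrow> ('a \<Rightarrow> real \<Rightarrow> 'a \<Rightarrow> 'a) \<Rightarrow> bool" where
  "strongly_coercive p K1 K2 \<Omega> A \<longleftrightarrow>
     K1 > 0 \<and> K2 > 0 \<and>
     (\<forall>x\<in>\<Omega>. \<forall>s\<ge>0. \<forall>\<eta>.
        A x s \<eta> \<bullet> \<eta> \<ge> K1 * norm \<eta> powr p \<and>
        K1 * norm \<eta> powr p \<ge> K2 * norm (A x s \<eta>) powr (p / (p - 1)))"

text \<open>The weak inequality \<open>- div (A(x, w, \<nabla>w)) \<le> g\<close> in \<open>\<Omega>\<close>, for a nonnegative \<open>w\<close> that is locally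
  in the Sobolev space of exponent \<open>p\<close>.  As weak gradients are unique up to null sets, it does not
  matter which weak gradients \<open>G\<close> of \<open>w\<close> and \<open>H\<close> of \<open>\<phi>\<close> are used.\<close>

definition weak_le ::
    "real \<Rightarrow> 'a::euclidean_space set \<Rightarrow> ('a \<Rightarrow> real \<Rightarrow> 'a \<Rightarrow> 'a) \<Rightarrow> ('a \<Rightarrow> real) \<Rightarrow> ('a \<Rightarrow> real) \<Rightarrow> bool" where
  "weak_le p \<Omega> A w g \<longleftrightarrow>
     Lp_loc 1 \<Omega> g \<and> (\<forall>x\<in>\<Omega>. 0 \<le> w x) \<and>
     (\<exists>G. W1p_loc p \<Omega> w G \<and>
          Lp_loc (p / (p - 1)) \<Omega> (\<lambda>x. A x (w x) (G x)) \<and>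
          (\<forall>\<phi> H. W1inf \<Omega> \<phi> H \<and> compactly_supported_in \<Omega> \<phi> \<and> (\<forall>x\<in>\<Omega>. 0 \<le> \<phi> x) \<longrightarrow>
             (LINT x|lebesgue_on \<Omega>. A x (w x) (G x) \<bullet> H x) \<le> (LINT x|lebesgue_on \<Omega>. g x * \<phi> x)))"

text \<open>The quantity \<open>d(x, \<partial>\<Omega>)\<close> raised to the power \<open>-a\<close>, for \<open>a > 0\<close>.  If \<open>\<Omega>\<close> is the whole space,
  then \<open>\<partial>\<Omega>\<close> is empty, the distance is infinite (while \<open>infdist x {} = 0\<close>), and the power is \<open>0\<close>.\<close>

definition bdist_npow :: "'a::euclidean_space set \<Rightarrow> 'a \<Rightarrow> real \<Rightarrow> real" where
  "bdist_npow \<Omega> x a = (if frontier \<Omega> = {} then 0 else infdist x (frontier \<Omega>) powr (- a))"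

end

theory Submission imports Defs begin

text \<open>The weak inequalities are tested with \<open>\<zeta> g(w)\<close> for a \<open>C\<^sup>1\<close> cutoff \<open>\<zeta>\<close> and a \<open>C\<^sup>1\<close> function \<open>g\<close>;
  such test functions are reached as limits of \<open>\<zeta> g(w\<^sub>\<epsilon>)\<close> with mollifications \<open>w\<^sub>\<epsilon>\<close>, so that no chain
  rule for Sobolev functions is needed.  The choice \<open>g(s) = s + S\<close> with \<open>S \<ge> sup u\<close> bounds the average
  of \<open>v powr \<delta>\<close> over a ball of radius \<open>R\<close> by \<open>C S powr (p - 1) R powr (- p)\<close>.  The choice
  \<open>g(s) = ((s - k)\<^sup>+)\<^sup>2\<close> gives a Caccioppoli inequality, and De Giorgi iteration then shows that a
  subsolution that is at most \<open>\<Lambda> M\<close> on a ball and at least \<open>M\<close> at its centre exceeds \<open>M/4\<close> on a fixed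
  fraction of the ball.  Both facts are applied at the points where \<open>u d powr \<gamma>\<close> and \<open>v d powr \<xi>\<close> attain
  their maxima over a ball in \<open>\<Omega>\<close>, \<open>d\<close> being the distance to the boundary of that ball: there the
  functions are comparable with their values at the point.  This couples the two maxima by powers whose
  exponents close up because \<open>D > 0\<close>.\<close>

section \<open>Powers and their means\<close>

text \<open>The vector fields are only coercive: neither monotone nor homogeneous, and dependent on
  the solution itself. Comparison with explicit large solutions is therefore out of reach, and
  everything has to come from energy tests. The solutions may blow up at the boundary of
  \<open>\<Omega>\<close>, which is why the maxima carry a weight vanishing on a sphere. The
  exponents are those for which the resulting estimates are scale invariant,
  \<open>\<xi> * \<delta> = \<gamma> * (p - 1) + p\<close> and
  \<open>\<gamma> * \<mu> = \<xi> * (q - 1) + q\<close>, so all powers of the distance cancel and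
  plain numbers remain to be compared. The De Giorgi step rests on a Faber-Krahn inequality instead
  of a Sobolev embedding: with the exponent p on both sides, it suffices that a function supported
  in a small set is small compared with its gradient.\<close>

lemma young_scaled:
  fixes p \<tau> :: real
  assumes "1 < p" "0 < \<tau>"
  shows "\<exists>C>0. \<forall>a\<ge>0. \<forall>b\<ge>0. a * b \<le> \<tau> * a powr (p / (p - 1)) + C * b powr p"
proof -
  define q where "q = p / (p - 1)"
  \<comment> \<open>Young's inequality will be applied to \<open>t * a\<close> and
    \<open>b / t\<close>; this \<open>t\<close> has \<open>t powr q = \<tau>\<close>, with q the
    exponent conjugate to p. The factors 1/q and 1/p are then bounded by 1.\<close>
  define t where "t = \<tau> powr (1 / q)"
  have q: "q > 1" "1 / q + 1 / p = 1" using assms by (auto simp: q_def field_simps)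
  have t: "t > 0" "t powr q = \<tau>" using assms q by (auto simp: t_def powr_powr)
  have "a * b \<le> \<tau> * a powr q + t powr (- p) * b powr p" if "a \<ge> 0" "b \<ge> 0" for a b
  proof -
    have "a * b = (t * a) * (b / t)" using t by simp
    also have "\<dots> \<le> (t * a) powr q / q + (b / t) powr p / p"
      by (rule Youngs_inequality) (use assms q t that in auto)
    also have "\<dots> \<le> (t * a) powr q / 1 + (b / t) powr p / 1"
      using assms q by (intro add_mono divide_left_mono) auto
    also have "\<dots> = \<tau> * a powr q + t powr (- p) * b powr p"
      using t that by (simp add: powr_mult powr_divide powr_minus field_simps)
    finally show ?thesis .
  qed
  then show ?thesis using t by (intro exI[of _ "t powr (- p)"]) (auto simp: q_def)
qed

text \<open>Convexity in tangent form: the p-th power lies above its tangent at \<open>b\<close>. It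
  is Young's inequality for \<open>a\<close> and \<open>b powr (p - 1)\<close>, whose conjugate
  power is \<open>b powr p\<close>.\<close>

lemma powr_tangent:
  fixes a b p :: real
  assumes "1 < p" "0 \<le> a" "0 \<le> b"
  shows "p * b powr (p - 1) * a \<le> a powr p + (p - 1) * b powr p"
proof -
  have "a * b powr (p - 1) \<le> a powr p / p + (b powr (p - 1)) powr (p / (p - 1)) / (p / (p - 1))"
    by (rule Youngs_inequality) (use assms in \<open>auto simp: field_simps\<close>)
  also have "(b powr (p - 1)) powr (p / (p - 1)) = b powr p"
    using assms by (simp add: powr_powr)
  finally show ?thesis using assms by (simp add: field_simps)
qed

lemma norm_add_powr_le:
  fixes x y :: "'b::real_normed_vector"
  assumes "0 < p"
  shows "norm (x + y) powr p \<le> 2 powr p * (norm x powr p + norm y powr p)"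
proof -
  have "norm (x + y) \<le> 2 * max (norm x) (norm y)"
    using norm_triangle_ineq[of x y] by linarith
  then have "norm (x + y) powr p \<le> (2 * max (norm x) (norm y)) powr p"
    using assms by (intro powr_mono2) auto
  also have "\<dots> = 2 powr p * max (norm x) (norm y) powr p"
    by (simp add: powr_mult)
  also have "\<dots> \<le> 2 powr p * (norm x powr p + norm y powr p)"
    by (intro mult_left_mono) (auto simp: max_def)
  finally show ?thesis .
qed

text \<open>Jensen's inequality for the probability density \<open>k\<close>, by integrating the
  tangent inequality at the mean value. It serves for mollifiers and for the uniform density on a
  segment.\<close>

lemma weighted_mean_powr_le:
  fixes k a :: "'x \<Rightarrow> real"
  assumes p: "1 < p" and k: "\<And>x. 0 \<le> k x" "integrable M k" "integral\<^sup>L M k = 1"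
    and a: "\<And>x. 0 \<le> a x" and ka: "integrable M (\<lambda>x. k x * a x)"
    and kap: "integrable M (\<lambda>x. k x * a x powr p)"
  shows "(\<integral>x. k x * a x \<partial>M) powr p \<le> (\<integral>x. k x * a x powr p \<partial>M)"
proof -
  define b where "b = (\<integral>x. k x * a x \<partial>M)"
  have b: "b \<ge> 0" unfolding b_def using k a by (intro integral_nonneg_AE) auto
  have "(\<integral>x. p * b powr (p - 1) * (k x * a x) - (p - 1) * b powr p * k x \<partial>M) \<le> (\<integral>x. k x * a x powr p \<partial>M)"
  proof (rule integral_mono)
    fix x
    have "k x * (p * b powr (p - 1) * a x) \<le> k x * (a x powr p + (p - 1) * b powr p)"
      by (rule mult_left_mono[OF powr_tangent]) (use p a b k in auto)
    then show "p * b powr (p - 1) * (k x * a x) - (p - 1) * b powr p * k x \<le> k x * a x powr p"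
      by (simp add: algebra_simps)
  qed (use ka kap k in auto)
  also have "(\<integral>x. p * b powr (p - 1) * (k x * a x) - (p - 1) * b powr p * k x \<partial>M)
      = p * b powr (p - 1) * b - (p - 1) * b powr p"
    using ka k by (simp add: b_def)
  also have "\<dots> = b powr p"
  proof (cases "b = 0")
    case False
    then have "b powr (p - 1) * b = b powr p"
      using b by (simp add: powr_mult_base mult.commute)
    then show ?thesis by (simp add: algebra_simps)
  qed (use p in auto)
  finally show ?thesis by (simp add: b_def)
qed

section \<open>Smooth compactly supported functions\<close>

text \<open>At the kink the difference quotient is at most |h|^(m-1), so a power of at least 2
  smooths it out; truncated polynomials thereby become C1 functions.\<close>

lemma DERIV_pos_part_power:
  fixes s :: real
  assumes "2 \<le> m"
  shows "DERIV (\<lambda>s. max 0 s ^ m) s :> of_nat m * max 0 s ^ (m - 1)"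
proof -
  consider "s < 0" | "s > 0" | "s = 0" by linarith
  then show ?thesis
  proof cases
    case 1
    have "DERIV (\<lambda>s. 0::real) s :> of_nat m * max 0 s ^ (m - 1)"
      using 1 assms by (auto simp: max_def zero_power)
    then show ?thesis
      by (rule has_field_derivative_transform_within_open[where S="{..<0}"])
         (use 1 assms in \<open>auto simp: max_def\<close>)
  next
    case 2
    have "DERIV (\<lambda>s. s ^ m) s :> of_nat m * max 0 s ^ (m - 1)"
      using 2 by (auto intro!: derivative_eq_intros simp: max_def)
    then show ?thesis
      by (rule has_field_derivative_transform_within_open[where S="{0<..}"])
         (use 2 in \<open>auto simp: max_def\<close>)
  next
    case 3
    have "((\<lambda>h::real. max 0 h ^ m / h) \<longlongrightarrow> 0) (at 0)"
    proof (rule Lim_null_comparison)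
      show "\<forall>\<^sub>F h in at (0::real). norm (max 0 h ^ m / h) \<le> \<bar>h\<bar> ^ (m - 1)"
      proof (rule always_eventually, rule allI)
        fix h :: real
        have "\<bar>h\<bar> ^ m = \<bar>h\<bar> * \<bar>h\<bar> ^ (m - 1)" using assms by (metis One_nat_def Suc_1 Suc_le_eq Suc_pred less_le_trans power_Suc zero_less_Suc)
        then show "norm (max 0 h ^ m / h) \<le> \<bar>h\<bar> ^ (m - 1)"
          using assms by (auto simp: max_def abs_mult power_abs zero_power)
      qed
      have "((\<lambda>h. \<bar>h\<bar> ^ (m - 1)) \<longlongrightarrow> \<bar>0::real\<bar> ^ (m - 1)) (at 0)"
        by (intro tendsto_intros)
      then show "((\<lambda>h. \<bar>h\<bar> ^ (m - 1)) \<longlongrightarrow> 0) (at (0::real))" using assms by (simp add: zero_power)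
    qed
    then show ?thesis using 3 assms by (simp add: DERIV_def zero_power)
  qed
qed

text \<open>A truncated polynomial replaces the usual smooth bump: C1 regularity suffices for the
  test functions, and the gradient and its size relative to the bump are explicit. The power 2 gives
  the mollifier, a large power the cutoff.\<close>

definition quad_bump :: "nat \<Rightarrow> 'a::euclidean_space \<Rightarrow> real \<Rightarrow> 'a \<Rightarrow> real" where
  "quad_bump m c r x = max 0 (r\<^sup>2 - (norm (x - c))\<^sup>2) ^ m"

definition quad_bump_grad :: "nat \<Rightarrow> 'a::euclidean_space \<Rightarrow> real \<Rightarrow> 'a \<Rightarrow> 'a" where
  "quad_bump_grad m c r x = - (2 * of_nat m * max 0 (r\<^sup>2 - (norm (x - c))\<^sup>2) ^ (m - 1)) *\<^sub>R (x - c)"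

lemma GDERIV_quad_bump:
  assumes "2 \<le> m"
  shows "GDERIV (quad_bump m c r) x :> quad_bump_grad m c r x"
proof -
  have "GDERIV (\<lambda>x. r\<^sup>2 - (norm (x - c))\<^sup>2) x :> - 2 *\<^sub>R (x - c)"
    unfolding gderiv_def power2_norm_eq_inner
    by (auto intro!: derivative_eq_intros simp: inner_commute algebra_simps)
  from GDERIV_DERIV_compose[OF this DERIV_pos_part_power[OF assms]]
  show ?thesis by (simp add: quad_bump_def[abs_def] quad_bump_grad_def algebra_simps)
qed

lemma continuous_quad_bump [continuous_intros]: "continuous_on A (quad_bump m c r)"
  and continuous_quad_bump_grad [continuous_intros]: "continuous_on A (quad_bump_grad m c r)"
  unfolding quad_bump_def quad_bump_grad_def by (intro continuous_intros)+

lemma quad_bump_nonneg: "0 \<le> quad_bump m c r x"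
  by (simp add: quad_bump_def)

lemma quad_bump_pos_iff:
  assumes "0 < r" "0 < m"
  shows "0 < quad_bump m c r x \<longleftrightarrow> x \<in> ball c r"
proof -
  have "(norm (x - c))\<^sup>2 < r\<^sup>2 \<longleftrightarrow> norm (x - c) < r"
    using assms power_strict_mono[of "norm (x - c)" r 2] power_less_imp_less_base[of "norm (x - c)" 2 r] by auto
  then show ?thesis using assms by (auto simp: quad_bump_def zero_less_power_eq dist_norm norm_minus_commute max_def zero_power)
qed

lemma quad_bump_eq_0:
  assumes "0 < r" "0 < m" "x \<notin> ball c r" shows "quad_bump m c r x = 0"
  using quad_bump_pos_iff[OF assms(1,2), of c x] quad_bump_nonneg[of m c r x] assms by auto

lemma quad_bump_grad_eq_0:
  assumes "0 < r" "2 \<le> m" "x \<notin> ball c r" shows "quad_bump_grad m c r x = 0"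
proof -
  have "r\<^sup>2 \<le> (norm (x - c))\<^sup>2" using assms by (auto simp: dist_norm norm_minus_commute intro!: power_mono)
  then show ?thesis using assms by (simp add: quad_bump_grad_def zero_power)
qed

lemma integrable_lebesgue_vanishing_outside:
  fixes f :: "'a::euclidean_space \<Rightarrow> 'b::euclidean_space"
  assumes "f \<in> borel_measurable lebesgue" "compact K" "\<And>x. x \<notin> K \<Longrightarrow> f x = 0" "\<And>x. norm (f x) \<le> B"
  shows "integrable lebesgue f"
proof (rule Bochner_Integration.integrable_bound)
  show "integrable lebesgue (\<lambda>x. indicator K x * B)"
    using assms lmeasurable_compact[of K] by (auto simp: fmeasurable_def intro!: integrable_real_indicator)
qed (use assms in \<open>auto simp: indicator_def intro: order_trans[OF _ abs_ge_self] split: if_splits\<close>)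

lemma continuous_compact_support_bounded:
  fixes f :: "'a::euclidean_space \<Rightarrow> 'b::euclidean_space"
  assumes "continuous_on UNIV f" "compact K" "\<And>x. x \<notin> K \<Longrightarrow> f x = 0"
  obtains B where "B > 0" "\<And>x. norm (f x) \<le> B"
proof -
  have "bounded (f ` K)"
    using assms by (intro compact_imp_bounded compact_continuous_image) (auto intro: continuous_on_subset)
  then obtain B where "B > 0" "\<And>x. x \<in> K \<Longrightarrow> norm (f x) \<le> B" by (auto simp: bounded_pos)
  then show ?thesis using that[of B] assms(3) by (metis less_imp_le norm_zero)
qed

lemma borel_measurable_lebesgue_continuous:
  fixes f :: "'a::euclidean_space \<Rightarrow> 'b::euclidean_space"
  shows "continuous_on UNIV f \<Longrightarrow> f \<in> borel_measurable lebesgue"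
  by (simp add: borel_measurable_continuous_onI measurable_completion)

lemma integrable_continuous_compact_support:
  fixes f :: "'a::euclidean_space \<Rightarrow> 'b::euclidean_space"
  assumes "continuous_on UNIV f" "compact K" "\<And>x. x \<notin> K \<Longrightarrow> f x = 0"
  shows "integrable lebesgue f"
proof -
  obtain B where "\<And>x. norm (f x) \<le> B" using continuous_compact_support_bounded[OF assms] by blast
  with assms show ?thesis
    by (intro integrable_lebesgue_vanishing_outside[of f K B] borel_measurable_lebesgue_continuous) auto
qed

section \<open>Integration by parts for C1 functions with compact support\<close>

lemma integral_lebesgue_translation:
  fixes f :: "'a::euclidean_space \<Rightarrow> 'b::euclidean_space"
  assumes [measurable]: "f \<in> borel_measurable borel"
  shows "integral\<^sup>L lebesgue (\<lambda>x. f (z + x)) = integral\<^sup>L lebesgue f"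
proof -
  have "integral\<^sup>L lborel f = integral\<^sup>L (distr lborel borel ((+) z)) f"
    by (simp add: lborel_distr_plus)
  also have "\<dots> = integral\<^sup>L lborel (\<lambda>x. f (z + x))"
    by (subst integral_distr) auto
  finally show ?thesis by (simp add: integral_completion)
qed

lemma nn_integral_lborel_translation:
  fixes f :: "'a::euclidean_space \<Rightarrow> ennreal"
  assumes [measurable]: "f \<in> borel_measurable borel"
  shows "(\<integral>\<^sup>+x. f (z + x) \<partial>lborel) = (\<integral>\<^sup>+x. f x \<partial>lborel)"
proof -
  have "(\<integral>\<^sup>+x. f x \<partial>lborel) = (\<integral>\<^sup>+x. f x \<partial>distr lborel borel ((+) z))"
    by (simp add: lborel_distr_plus)
  also have "\<dots> = (\<integral>\<^sup>+x. f (z + x) \<partial>lborel)"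
    by (subst nn_integral_distr) auto
  finally show ?thesis by simp
qed

lemma GDERIV_lipschitz:
  fixes f :: "'a::euclidean_space \<Rightarrow> real"
  assumes "\<And>x. GDERIV f x :> f' x" "\<And>x. norm (f' x) \<le> B"
  shows "\<bar>f x - f y\<bar> \<le> B * norm (x - y)"
proof -
  have "norm (f x - f y) \<le> B * norm (x - y)"
  proof (rule differentiable_bound[of UNIV f "\<lambda>x h. inner h (f' x)"])
    fix x show "onorm (\<lambda>h. inner h (f' x)) \<le> B"
      using assms(2)[of x]
      by (intro onorm_le) (metis Cauchy_Schwarz_ineq2 mult.commute mult_right_mono norm_ge_zero order_trans real_norm_def)
  qed (use assms(1) in \<open>auto simp: gderiv_def\<close>)
  then show ?thesis by simp
qed

lemma GDERIV_vanishing_outside_eq_0: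
  assumes "GDERIV f x :> D" "compact K" "\<And>x. x \<notin> K \<Longrightarrow> f x = (0::real)" "x \<notin> K"
  shows "D = 0"
proof -
  have "open (- K)" using assms(2) by (simp add: compact_imp_closed open_Compl)
  have "((\<lambda>x. 0) has_derivative (\<lambda>h. inner h D)) (at x)"
    by (rule has_derivative_transform_within_open[OF assms(1)[unfolded gderiv_def] \<open>open (-K)\<close>]) (use assms in auto)
  then have "(\<lambda>h. inner h D) = (\<lambda>h. 0)"
    by (rule has_derivative_unique) simp
  then show ?thesis by (metis inner_eq_zero_iff)
qed

text \<open>The divergence theorem in the form needed for weak gradients. Difference quotients have
  integral zero because Lebesgue measure is translation invariant, and dominated convergence carries
  this over to partial derivatives.\<close>

lemma integral_GDERIV_eq_0:
  fixes f :: "'a::euclidean_space \<Rightarrow> real"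
  assumes f: "\<And>x. GDERIV f x :> f' x" and cont: "continuous_on UNIV f'"
    and K: "compact K" "\<And>x. x \<notin> K \<Longrightarrow> f x = 0"
  shows "integral\<^sup>L lebesgue f' = 0"
proof -
  have f'0: "f' x = 0" if "x \<notin> K" for x
    by (rule GDERIV_vanishing_outside_eq_0[OF f K]) (use that in auto)
  obtain B where B: "B > 0" "\<And>x. norm (f' x) \<le> B"
    using continuous_compact_support_bounded[OF cont K(1) f'0] by blast
  have cf: "continuous_on UNIV f"
    using f by (auto simp: gderiv_def intro!: has_derivative_continuous_on intro: has_derivative_at_withinI)
  have fm: "f \<in> borel_measurable borel" using cf by (intro borel_measurable_continuous_onI)
  have int_f': "integrable lebesgue f'" by (rule integrable_continuous_compact_support[OF cont K(1) f'0])
  have int_f: "integrable lebesgue f" by (rule integrable_continuous_compact_support[OF cf K])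
  obtain R where R: "\<And>x. x \<in> K \<Longrightarrow> norm x \<le> R" using compact_imp_bounded[OF K(1)] by (auto simp: bounded_iff)
  have "integral\<^sup>L lebesgue f' \<bullet> e = 0" if e: "e \<in> Basis" for e
  proof -
    let ?h = "\<lambda>n::nat. 1 / real (Suc n)"
    let ?s = "\<lambda>n x. (f (?h n *\<^sub>R e + x) - f x) / ?h n"
    \<comment> \<open>The steps \<open>?h n\<close> are at most 1, so every quotient vanishes
      outside the ball of radius R + 1; inside, the Lipschitz bound \<open>B\<close>
      dominates.\<close>
    have lim: "(\<lambda>n. integral\<^sup>L lebesgue (?s n)) \<longlonglongrightarrow> integral\<^sup>L lebesgue (\<lambda>x. f' x \<bullet> e)"
    proof (rule integral_dominated_convergence[where w="\<lambda>x. indicator (cball 0 (R + 1)) x * B"])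
      show "(\<lambda>x. f' x \<bullet> e) \<in> borel_measurable lebesgue" using int_f' by auto
      show "?s n \<in> borel_measurable lebesgue" for n
        by (intro borel_measurable_lebesgue_continuous continuous_intros continuous_on_compose2[OF cf]) auto
      show "integrable lebesgue (\<lambda>x. indicator (cball (0::'a) (R + 1)) x * B)"
        by (rule integrable_mult_left) (use lmeasurable_cball[of 0 "R+1"] in \<open>auto simp: fmeasurable_def intro!: integrable_real_indicator\<close>)
      show "AE x in lebesgue. (\<lambda>n. ?s n x) \<longlonglongrightarrow> f' x \<bullet> e"
      proof (rule AE_I2)
        fix x :: 'a
        have "((\<lambda>t. x + t *\<^sub>R e) has_derivative (\<lambda>t. t *\<^sub>R e)) (at 0)"
          by (auto intro!: derivative_eq_intros)
        then have "((\<lambda>t. f (x + t *\<^sub>R e)) has_derivative (\<lambda>t. (t *\<^sub>R e) \<bullet> f' x)) (at 0)"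
          using has_derivative_compose[of "\<lambda>t. x + t *\<^sub>R e" "\<lambda>t. t *\<^sub>R e" 0 UNIV f "\<lambda>h. h \<bullet> f' x"] f[of x]
          by (simp add: gderiv_def)
        then have "DERIV (\<lambda>t. f (x + t *\<^sub>R e)) 0 :> f' x \<bullet> e"
          by (simp add: has_field_derivative_def inner_commute mult_commute_abs)
        then have "((\<lambda>t. (f (x + t *\<^sub>R e) - f x) / t) \<longlongrightarrow> f' x \<bullet> e) (at 0)"
          by (simp add: DERIV_def)
        moreover have "filterlim ?h (at 0) sequentially"
          unfolding filterlim_at using LIMSEQ_Suc[OF lim_1_over_n[where 'a=real]] by (auto intro!: always_eventually)
        ultimately have "(\<lambda>n. (f (x + ?h n *\<^sub>R e) - f x) / ?h n) \<longlonglongrightarrow> f' x \<bullet> e"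
          by (rule filterlim_compose)
        then show "(\<lambda>n. ?s n x) \<longlonglongrightarrow> f' x \<bullet> e" by (simp add: add.commute)
      qed
      show "AE x in lebesgue. norm (?s n x) \<le> indicator (cball 0 (R + 1)) x * B" for n
      proof (rule AE_I2)
        fix x :: 'a
        have h: "0 < ?h n" "?h n \<le> 1" by auto
        show "norm (?s n x) \<le> indicator (cball 0 (R + 1)) x * B"
        proof (cases "x \<in> cball 0 (R + 1)")
          case True
          have "\<bar>f (?h n *\<^sub>R e + x) - f x\<bar> \<le> B * norm (?h n *\<^sub>R e + x - x)"
            by (rule GDERIV_lipschitz[OF f B(2)])
          also have "\<dots> = B * ?h n" using e by simp
          finally show ?thesis using True h by (simp add: abs_mult pos_le_divide_eq del: of_nat_Suc)
        next
          case False
          have "norm x \<le> norm (?h n *\<^sub>R e + x) + norm (?h n *\<^sub>R e)"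
            by (metis add_diff_cancel_left' norm_triangle_sub add.commute norm_triangle_ineq4)
          moreover have "norm (?h n *\<^sub>R e) \<le> 1" "norm x > R + 1" using False e by auto
          ultimately have "norm (?h n *\<^sub>R e + x) > R" by linarith
          then have "f (?h n *\<^sub>R e + x) = 0" using K R by fastforce
          moreover have "f x = 0" using False R K by force
          ultimately show ?thesis using False by simp
        qed
      qed
    qed
    have "integral\<^sup>L lebesgue (?s n) = 0" for n
    proof -
      have i: "integrable lebesgue (\<lambda>x. f (?h n *\<^sub>R e + x))"
      proof (rule integrable_continuous_compact_support[where K="(\<lambda>x. - (?h n *\<^sub>R e) + x) ` K"])
        show "f (?h n *\<^sub>R e + x) = 0" if "x \<notin> (\<lambda>x. - (?h n *\<^sub>R e) + x) ` K" for x
          using that K(2)[of "?h n *\<^sub>R e + x"] by force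
      qed (intro continuous_on_compose2[OF cf] continuous_intros compact_translation K(1) | simp)+
      show ?thesis
        using integral_lebesgue_translation[OF fm, of "?h n *\<^sub>R e"] i int_f by simp
    qed
    then have "integral\<^sup>L lebesgue (\<lambda>x. f' x \<bullet> e) = 0"
      using lim LIMSEQ_unique[OF _ tendsto_const] by simp
    then show ?thesis using int_f' by simp
  qed
  then show ?thesis by (metis euclidean_all_zero_iff)
qed

lemma
  fixes f :: "'a::euclidean_space \<Rightarrow> 'b::euclidean_space"
  assumes "S \<in> sets lebesgue" "\<And>x. x \<notin> S \<Longrightarrow> f x = 0"
  shows integral_lebesgue_on_vanishing: "integral\<^sup>L (lebesgue_on S) f = integral\<^sup>L lebesgue f"
    and integrable_lebesgue_on_vanishing: "integrable (lebesgue_on S) f \<longleftrightarrow> integrable lebesgue f"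
proof -
  have "(\<lambda>x. indicator S x *\<^sub>R f x) = f" using assms(2) by (auto simp: indicator_def)
  then show "integral\<^sup>L (lebesgue_on S) f = integral\<^sup>L lebesgue f"
    "integrable (lebesgue_on S) f \<longleftrightarrow> integrable lebesgue f"
    using assms(1) by (simp_all add: integral_restrict_space integrable_restrict_space)
qed

lemma GDERIV_imp_continuous_on: "(\<And>x. GDERIV f x :> f' x) \<Longrightarrow> continuous_on A f"
  by (auto simp: gderiv_def intro!: has_derivative_continuous_on intro: has_derivative_at_withinI)

lemma integrable_continuous_compact:
  fixes f :: "'a::euclidean_space \<Rightarrow> 'b::euclidean_space"
  assumes "compact K" "continuous_on K f"
  shows "integrable (lebesgue_on K) f"
proof -
  have "bounded (f ` K)" using assms by (intro compact_imp_bounded compact_continuous_image)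
  then obtain B where B: "\<And>x. x \<in> K \<Longrightarrow> norm (f x) \<le> B" "0 < B" by (auto simp: bounded_pos)
  have "(\<lambda>x. indicator K x *\<^sub>R f x) \<in> borel_measurable lebesgue"
    using assms by (intro measurable_completion)
      (simp add: borel_measurable_continuous_on_indicator compact_imp_closed borel_closed)
  then have "integrable lebesgue (\<lambda>x. indicator K x *\<^sub>R f x)"
    by (rule integrable_lebesgue_vanishing_outside[where K=K and B=B]) (use assms B in \<open>auto simp: indicator_def\<close>)
  then show ?thesis using assms by (simp add: integrable_restrict_space lmeasurable_compact fmeasurableD)
qed

lemma Lp_loc_1_continuous:
  fixes f :: "'a::euclidean_space \<Rightarrow> 'b::euclidean_space"
  assumes "open \<Omega>" "continuous_on \<Omega> f"
  shows "Lp_loc 1 \<Omega> f"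
  unfolding Lp_loc_def
proof (intro conjI allI impI)
  show "f \<in> borel_measurable (lebesgue_on \<Omega>)"
    using assms by (intro continuous_imp_measurable_on_sets_lebesgue) auto
  fix K assume K: "compact K \<and> K \<subseteq> \<Omega>"
  then have "continuous_on K (\<lambda>x. norm (f x))"
    using assms by (intro continuous_intros) (auto intro: continuous_on_subset)
  then have "continuous_on K (\<lambda>x. norm (f x) powr 1)" by simp
  then show "integrable (lebesgue_on K) (\<lambda>x. norm (f x) powr 1)"
    using K by (intro integrable_continuous_compact) auto
qed

text \<open>The classical gradient is a weak one because a product of two C1 functions, one of them
  compactly supported, has a gradient of integral zero. Only such test functions are ever inserted
  into the weak inequalities.\<close>

lemma W1inf_C1_compact_support:
  fixes \<phi> :: "'a::euclidean_space \<Rightarrow> real"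
  assumes \<Omega>: "open \<Omega>" and \<phi>: "\<And>x. GDERIV \<phi> x :> \<phi>' x" and cont: "continuous_on UNIV \<phi>'"
    and K: "compact K" "K \<subseteq> \<Omega>" "\<And>x. x \<notin> K \<Longrightarrow> \<phi> x = 0"
  shows "W1inf \<Omega> \<phi> \<phi>'"
proof -
  have c\<phi>: "continuous_on A \<phi>" for A by (rule GDERIV_imp_continuous_on[OF \<phi>])
  have c\<phi>': "continuous_on A \<phi>'" for A using cont by (rule continuous_on_subset) auto
  have \<phi>'0: "\<phi>' x = 0" if "x \<notin> K" for x
    by (rule GDERIV_vanishing_outside_eq_0[OF \<phi> K(1,3)]) (use that in auto)
  have Linf: "Linf \<Omega> f" if "continuous_on UNIV f" "\<And>x. x \<notin> K \<Longrightarrow> f x = 0" for f :: "'a \<Rightarrow> 'b::euclidean_space"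
    unfolding Linf_def
  proof
    show "f \<in> borel_measurable (lebesgue_on \<Omega>)"
      using borel_measurable_lebesgue_continuous[OF that(1)] by (rule measurable_restrict_space1)
    show "\<exists>B. AE x in lebesgue_on \<Omega>. norm (f x) \<le> B"
      using continuous_compact_support_bounded[OF that(1) K(1) that(2)] by (metis AE_I2)
  qed
  have \<Omega>m: "\<Omega> \<in> sets lebesgue" using \<Omega> by auto
  have "(LINT x|lebesgue_on \<Omega>. \<phi> x *\<^sub>R \<psi>' x) = - (LINT x|lebesgue_on \<Omega>. \<psi> x *\<^sub>R \<phi>' x)"
    if \<psi>: "\<forall>x. GDERIV \<psi> x :> \<psi>' x" and c\<psi>': "continuous_on UNIV \<psi>'" for \<psi> \<psi>'
  proof -
    have c\<psi>: "continuous_on UNIV \<psi>" by (rule GDERIV_imp_continuous_on) (use \<psi> in auto)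
    have i: "integrable lebesgue (\<lambda>x. \<phi> x *\<^sub>R \<psi>' x)" "integrable lebesgue (\<lambda>x. \<psi> x *\<^sub>R \<phi>' x)"
      by (rule integrable_continuous_compact_support[OF _ K(1)];
          use K(3) \<phi>'0 in \<open>auto intro!: continuous_intros c\<phi> c\<phi>' c\<psi> c\<psi>'\<close>)+
    have "integral\<^sup>L lebesgue (\<lambda>x. \<phi> x *\<^sub>R \<psi>' x + \<psi> x *\<^sub>R \<phi>' x) = 0"
      by (rule integral_GDERIV_eq_0[OF GDERIV_mult[OF \<phi> \<psi>[rule_format]] _ K(1)])
         (use K(3) in \<open>auto intro!: continuous_intros c\<phi> c\<phi>' c\<psi> c\<psi>'\<close>)
    then have "integral\<^sup>L lebesgue (\<lambda>x. \<phi> x *\<^sub>R \<psi>' x) = - integral\<^sup>L lebesgue (\<lambda>x. \<psi> x *\<^sub>R \<phi>' x)"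
      using i by (simp add: eq_neg_iff_add_eq_0)
    moreover have "(LINT x|lebesgue_on \<Omega>. \<phi> x *\<^sub>R \<psi>' x) = integral\<^sup>L lebesgue (\<lambda>x. \<phi> x *\<^sub>R \<psi>' x)"
      by (rule integral_lebesgue_on_vanishing[OF \<Omega>m]) (use K in auto)
    moreover have "(LINT x|lebesgue_on \<Omega>. \<psi> x *\<^sub>R \<phi>' x) = integral\<^sup>L lebesgue (\<lambda>x. \<psi> x *\<^sub>R \<phi>' x)"
      by (rule integral_lebesgue_on_vanishing[OF \<Omega>m]) (use K \<phi>'0 in auto)
    ultimately show ?thesis by simp
  qed
  then show ?thesis
    unfolding W1inf_def has_weak_gradient_def
    using Lp_loc_1_continuous[OF \<Omega> c\<phi>] Lp_loc_1_continuous[OF \<Omega> c\<phi>'] Linf[of \<phi>] Linf[of \<phi>'] c\<phi> c\<phi>' K(3) \<phi>'0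
    by blast
qed

lemma quad_bump_commute: "quad_bump m c r x = quad_bump m x r c"
  by (simp add: quad_bump_def norm_minus_commute)

lemma quad_bump_grad_commute: "quad_bump_grad m c r x = - quad_bump_grad m x r c"
  by (simp add: quad_bump_grad_def norm_minus_commute flip: scaleR_minus_right)

lemma quad_bump_shift: "quad_bump m c r (c + x) = quad_bump m 0 r x"
  and quad_bump_grad_shift: "quad_bump_grad m c r (c + x) = quad_bump_grad m 0 r x"
  by (simp_all add: quad_bump_def quad_bump_grad_def)

lemma integrable_quad_bump:
  assumes "0 < r" "0 < m"
  shows "integrable lebesgue (quad_bump m c r :: 'a::euclidean_space \<Rightarrow> real)"
  using quad_bump_eq_0[OF assms, of _ c]
  by (intro integrable_continuous_compact_support[where K="cball c r"] continuous_intros) auto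

lemma borel_quad_bump [measurable]: "quad_bump m c r \<in> borel_measurable borel"
  by (intro borel_measurable_continuous_onI continuous_intros)

section \<open>Mollification\<close>

text \<open>The normalising constant depends on the radius and the dimension; the type argument
  supplies the dimension.\<close>

definition bump_mass :: "'a::euclidean_space itself \<Rightarrow> real \<Rightarrow> real" where
  "bump_mass _ r = integral\<^sup>L lebesgue (quad_bump 2 (0::'a) r)"

definition mollifier :: "real \<Rightarrow> 'a::euclidean_space \<Rightarrow> 'a \<Rightarrow> real" where
  "mollifier r c x = quad_bump 2 c r x / bump_mass TYPE('a) r"

definition mollifier_grad :: "real \<Rightarrow> 'a::euclidean_space \<Rightarrow> 'a \<Rightarrow> 'a" where
  "mollifier_grad r c x = quad_bump_grad 2 c r x /\<^sub>R bump_mass TYPE('a) r"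

lemma bump_mass_pos:
  assumes "0 < r" shows "0 < bump_mass TYPE('a::euclidean_space) r"
proof -
  let ?q = "quad_bump 2 (0::'a) r"
  have i: "integrable lebesgue ?q" by (rule integrable_quad_bump) (use assms in auto)
  have "integral\<^sup>L lebesgue ?q \<noteq> 0"
  proof
    assume "integral\<^sup>L lebesgue ?q = 0"
    then have "AE x in lebesgue. ?q x = 0"
      using integral_nonneg_eq_0_iff_AE[OF i] by (auto simp: quad_bump_nonneg)
    then have "AE x in lebesgue. x \<notin> ball (0::'a) r"
    proof eventually_elim
      case (elim x)
      then show ?case using quad_bump_pos_iff[OF assms, of 2 "0::'a" x] by auto
    qed
    then have "ball (0::'a) r \<in> null_sets lebesgue"
      by (subst (asm) AE_iff_null_sets[symmetric]) auto
    then have "measure lborel (ball (0::'a) r) = 0" by (simp add: null_sets_def measure_def)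
    then show False using content_ball_pos[OF assms, of "0::'a"] by simp
  qed
  moreover have "integral\<^sup>L lebesgue ?q \<ge> 0" by (intro integral_nonneg_AE AE_I2 quad_bump_nonneg)
  ultimately show ?thesis by (simp add: bump_mass_def)
qed

lemma mollifier_nonneg: "0 < r \<Longrightarrow> 0 \<le> mollifier r (c::'a::euclidean_space) x"
  using bump_mass_pos[of r, where 'a='a] by (simp add: mollifier_def quad_bump_nonneg)

lemma mollifier_eq_0: "0 < r \<Longrightarrow> x \<notin> ball c r \<Longrightarrow> mollifier r c x = 0"
  by (simp add: mollifier_def quad_bump_eq_0)

lemma continuous_mollifier [continuous_intros]: "continuous_on A (mollifier r c)"
  and continuous_mollifier_grad [continuous_intros]: "continuous_on A (mollifier_grad r c)"
  and continuous_mollifier_center [continuous_intros]: "continuous_on A (\<lambda>c. mollifier r c x)"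
  and continuous_mollifier_pair [continuous_intros]: "continuous_on B (\<lambda>z. mollifier r (fst z) (snd z))"
  unfolding mollifier_def mollifier_grad_def quad_bump_def quad_bump_grad_def divide_inverse
  by (intro continuous_intros)+

lemma GDERIV_mollifier: "GDERIV (mollifier r c) x :> mollifier_grad r c x"
proof -
  have "GDERIV (\<lambda>x. quad_bump 2 c r x * inverse (bump_mass TYPE('a) r)) x :>
        quad_bump 2 c r x *\<^sub>R 0 + inverse (bump_mass TYPE('a) r) *\<^sub>R quad_bump_grad 2 c r x"
    by (intro GDERIV_mult GDERIV_quad_bump GDERIV_const) simp
  then show ?thesis by (simp add: mollifier_def[abs_def] mollifier_grad_def divide_inverse)
qed

text \<open>Centre and argument are interchangeable, so a derivative in the centre is, up to sign, a
  derivative in the integration variable. Convolutions can thus be differentiated with the formula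
  for the bump itself.\<close>

lemma mollifier_commute: "mollifier r c x = mollifier r x c"
  by (simp add: mollifier_def quad_bump_commute[of _ c])

lemma mollifier_grad_commute: "mollifier_grad r c x = - mollifier_grad r x c"
  by (simp add: mollifier_grad_def quad_bump_grad_commute[of _ c])

lemma mollifier_shift: "mollifier r c (c + x) = mollifier r 0 x"
  and mollifier_grad_shift: "mollifier_grad r c (c + x) = mollifier_grad r 0 x"
  by (simp_all add: mollifier_def mollifier_grad_def quad_bump_shift quad_bump_grad_shift)

lemma integral_mollifier:
  assumes "0 < r"
  shows "integral\<^sup>L lebesgue (mollifier r (c::'a::euclidean_space)) = 1" "integrable lebesgue (mollifier r c)"
proof -
  have "integral\<^sup>L lebesgue (\<lambda>x. quad_bump 2 c r (c + x)) = integral\<^sup>L lebesgue (quad_bump 2 c r)"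
    by (rule integral_lebesgue_translation) simp
  then have "integral\<^sup>L lebesgue (quad_bump 2 c r) = bump_mass TYPE('a) r"
    by (simp add: bump_mass_def quad_bump_shift)
  then show "integral\<^sup>L lebesgue (mollifier r c) = 1"
    using bump_mass_pos[OF assms, where 'a='a] by (simp add: mollifier_def[abs_def])
  show "integrable lebesgue (mollifier r c)"
    using integrable_quad_bump[OF assms, of 2 c] by (simp add: mollifier_def[abs_def])
qed

lemma mollifier_grad_eq_0: "0 < r \<Longrightarrow> x \<notin> ball c r \<Longrightarrow> mollifier_grad r c x = 0"
  by (simp add: mollifier_grad_def quad_bump_grad_eq_0)

lemma mollifier_bounded:
  assumes "0 < r"
  obtains B where "\<And>c x::'a::euclidean_space. mollifier r c x \<le> B" "\<And>c x::'a. norm (mollifier_grad r c x) \<le> B"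
proof -
  have "\<exists>B. \<forall>x. norm (mollifier r (0::'a) x) \<le> B"
    by (rule continuous_compact_support_bounded[of "mollifier r (0::'a)" "cball 0 r"])
       (auto intro!: continuous_mollifier mollifier_eq_0[OF assms])
  moreover have "\<exists>B. \<forall>x. norm (mollifier_grad r (0::'a) x) \<le> B"
    by (rule continuous_compact_support_bounded[of "mollifier_grad r (0::'a)" "cball 0 r"])
       (auto intro!: continuous_mollifier_grad mollifier_grad_eq_0[OF assms])
  ultimately obtain B1 B2 where B1: "\<And>x. norm (mollifier r (0::'a) x) \<le> B1"
    and B2: "\<And>x. norm (mollifier_grad r (0::'a) x) \<le> B2" by auto
  show ?thesis
  proof (rule that[of "max B1 B2"])
    fix c x :: 'a
    show "mollifier r c x \<le> max B1 B2" "norm (mollifier_grad r c x) \<le> max B1 B2"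
      using mollifier_shift[of r c "x - c"] mollifier_grad_shift[of r c "x - c"] B1[of "x - c"] B2[of "x - c"]
      by (auto simp: max_def)
  qed
qed

text \<open>By translation one \<open>d\<close> works for all centres. This uniformity allows the
  remainder in the derivative of a convolution to be estimated under the integral.\<close>

lemma mollifier_grad_uniformly_continuous:
  assumes "0 < r" "0 < e"
  obtains d where "0 < d" "\<And>c x y::'a::euclidean_space. dist x y < d \<Longrightarrow> norm (mollifier_grad r c x - mollifier_grad r c y) < e"
proof -
  have "uniformly_continuous_on (cball 0 (r + 1)) (mollifier_grad r (0::'a))"
    by (intro compact_uniformly_continuous continuous_intros) auto
  then obtain d where d: "0 < d" "\<And>x y::'a. x \<in> cball 0 (r+1) \<Longrightarrow> y \<in> cball 0 (r+1) \<Longrightarrow> dist y x < d \<Longrightarrow>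
      dist (mollifier_grad r 0 y) (mollifier_grad r 0 x) < e"
    unfolding uniformly_continuous_on_def using assms(2) by metis
  show ?thesis
  proof (rule that[of "min d 1"])
    show "0 < min d 1" using d by simp
    fix c x y :: 'a assume xy: "dist x y < min d 1"
    define a b where "a = x - c" and "b = y - c"
    have ab: "dist a b < d" "dist a b < 1" using xy by (auto simp: a_def b_def dist_norm)
    have "norm (mollifier_grad r 0 a - mollifier_grad r 0 b) < e"
    proof (cases "a \<in> cball 0 (r+1) \<and> b \<in> cball 0 (r+1)")
      case True then show ?thesis using d(2)[of b a] ab by (auto simp: dist_norm)
    next
      case False
      then have "norm a > r" "norm b > r" using ab norm_triangle_ineq3[of a b] assms by (auto simp: dist_norm)
      then show ?thesis using mollifier_grad_eq_0[OF assms(1), of _ "0::'a"] assms by simp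
    qed
    then show "norm (mollifier_grad r c x - mollifier_grad r c y) < e"
      using mollifier_grad_shift[of r c a] mollifier_grad_shift[of r c b] by (simp add: a_def b_def)
  qed
qed

section \<open>Convolution with the mollifier and its gradient\<close>

definition mollify :: "real \<Rightarrow> ('a::euclidean_space \<Rightarrow> 'b::euclidean_space) \<Rightarrow> 'a \<Rightarrow> 'b" where
  "mollify r f x = integral\<^sup>L lebesgue (\<lambda>y. mollifier r x y *\<^sub>R f y)"

text \<open>The derivative falls on the kernel, so any integrable \<open>f\<close> is allowed; the
  minus sign comes from exchanging centre and integration variable in the kernel's gradient.\<close>

definition mollify_grad :: "real \<Rightarrow> ('a::euclidean_space \<Rightarrow> real) \<Rightarrow> 'a \<Rightarrow> 'a" where
  "mollify_grad r f x = - integral\<^sup>L lebesgue (\<lambda>y. f y *\<^sub>R mollifier_grad r x y)"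

lemma integrable_mollify:
  fixes f :: "'a::euclidean_space \<Rightarrow> 'b::euclidean_space"
  assumes "0 < r" "integrable lebesgue f"
  shows "integrable lebesgue (\<lambda>y. mollifier r x y *\<^sub>R f y)"
proof -
  obtain B where B: "\<And>c x::'a. mollifier r c x \<le> B" using mollifier_bounded[OF assms(1)] by metis
  show ?thesis
  proof (rule Bochner_Integration.integrable_bound)
    show "integrable lebesgue (\<lambda>y. B *\<^sub>R f y)" using assms by auto
    show "(\<lambda>y. mollifier r x y *\<^sub>R f y) \<in> borel_measurable lebesgue"
      using assms(2) borel_measurable_lebesgue_continuous[OF continuous_mollifier]
      by (intro borel_measurable_scaleR) auto
    show "AE y in lebesgue. norm (mollifier r x y *\<^sub>R f y) \<le> norm (B *\<^sub>R f y)"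
      using B by (intro AE_I2) (auto simp: mollifier_nonneg[OF assms(1)] abs_of_nonneg intro!: mult_right_mono intro: order_trans[OF _ abs_ge_self])
  qed
qed

lemma integrable_mollify_grad:
  fixes f :: "'a::euclidean_space \<Rightarrow> real"
  assumes "0 < r" "integrable lebesgue f"
  shows "integrable lebesgue (\<lambda>y. f y *\<^sub>R mollifier_grad r x y)"
proof -
  obtain B where B: "\<And>c x::'a. norm (mollifier_grad r c x) \<le> B" using mollifier_bounded[OF assms(1)] by metis
  show ?thesis
  proof (rule Bochner_Integration.integrable_bound)
    show "integrable lebesgue (\<lambda>y. f y * B)" using assms by auto
    show "(\<lambda>y. f y *\<^sub>R mollifier_grad r x y) \<in> borel_measurable lebesgue"
      using assms(2) borel_measurable_lebesgue_continuous[OF continuous_mollifier_grad]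
      by (intro borel_measurable_scaleR) auto
    show "AE y in lebesgue. norm (f y *\<^sub>R mollifier_grad r x y) \<le> norm (f y * B)"
      using B by (intro AE_I2) (auto simp: abs_mult intro!: mult_left_mono intro: order_trans[OF _ abs_ge_self])
  qed
qed

lemma onorm_inner_le:
  fixes v :: "'a::euclidean_space"
  assumes "norm v \<le> B" shows "onorm (\<lambda>h. h \<bullet> v) \<le> B"
proof (rule onorm_le)
  fix h :: 'a
  have "norm (h \<bullet> v) \<le> norm h * norm v" using Cauchy_Schwarz_ineq2[of h v] by simp
  also have "\<dots> \<le> norm h * B" using assms by (intro mult_left_mono) auto
  finally show "norm (h \<bullet> v) \<le> B * norm h" by (simp add: mult.commute)
qed

lemma GDERIV_mollify:
  fixes f :: "'a::euclidean_space \<Rightarrow> real"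
  assumes r: "0 < r" and f: "integrable lebesgue f"
  shows "GDERIV (mollify r f) x :> mollify_grad r f x"
  unfolding gderiv_def has_derivative_at_alt
proof (intro conjI allI impI)
  show "bounded_linear (\<lambda>h. h \<bullet> mollify_grad r f x)" by (rule bounded_linear_inner_left)
  fix e :: real assume e: "0 < e"
  define I where "I = integral\<^sup>L lebesgue (\<lambda>y. \<bar>f y\<bar>)"
  have I: "I \<ge> 0" unfolding I_def by (intro integral_nonneg_AE) auto
  define e' where "e' = e / (I + 1)"
  have e': "0 < e'" "I * e' \<le> e" using e I by (auto simp: e'_def field_simps)
  obtain d where d: "0 < d" "\<And>c x y::'a. dist x y < d \<Longrightarrow> norm (mollifier_grad r c x - mollifier_grad r c y) < e'"
    using mollifier_grad_uniformly_continuous[OF r e'(1)] by metis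
  \<comment> \<open>Mean value inequality for the kernel minus its linearisation at
    \<open>x\<close>, as a function of the centre; the bound is uniform in the integration variable
    \<open>s\<close>.\<close>
  have est: "\<bar>mollifier r y s - mollifier r x s + (y - x) \<bullet> mollifier_grad r x s\<bar> \<le> e' * norm (y - x)"
    if y: "norm (y - x) < d" for y s
  proof -
    let ?g = "\<lambda>z. mollifier r s z - z \<bullet> mollifier_grad r s x"
    have "norm (?g y - ?g x) \<le> e' * norm (y - x)"
    proof (rule differentiable_bound[of "ball x d" ?g "\<lambda>z h. h \<bullet> (mollifier_grad r s z - mollifier_grad r s x)"])
      fix z assume z: "z \<in> ball x d"
      have "GDERIV (\<lambda>z. z \<bullet> mollifier_grad r s x) z :> mollifier_grad r s x"
        unfolding gderiv_def by (rule bounded_linear_imp_has_derivative[OF bounded_linear_inner_left])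
      from GDERIV_diff[OF GDERIV_mollifier this]
      show "(?g has_derivative (\<lambda>h. h \<bullet> (mollifier_grad r s z - mollifier_grad r s x))) (at z within ball x d)"
        unfolding gderiv_def by (rule has_derivative_at_withinI)
      have "norm (mollifier_grad r s z - mollifier_grad r s x) \<le> e'"
        using d(2)[of z x s] z by (auto simp: dist_commute)
      then show "onorm (\<lambda>h. h \<bullet> (mollifier_grad r s z - mollifier_grad r s x)) \<le> e'"
        by (rule onorm_inner_le)
    qed (use y d in \<open>auto simp: dist_norm norm_minus_commute\<close>)
    then show ?thesis
      by (simp add: mollifier_commute[of r s] mollifier_grad_commute[of r s] algebra_simps)
  qed
  show "\<exists>d>0. \<forall>y. norm (y - x) < d \<longrightarrow>
       norm (mollify r f y - mollify r f x - (y - x) \<bullet> mollify_grad r f x) \<le> e * norm (y - x)"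
  proof (intro exI[of _ d] conjI allI impI d(1))
    fix y assume y: "norm (y - x) < d"
  let ?d = "\<lambda>s. mollifier r y s *\<^sub>R f s - mollifier r x s *\<^sub>R f s + (y - x) \<bullet> (f s *\<^sub>R mollifier_grad r x s)"
    note i = integrable_mollify[OF r f] integrable_mollify_grad[OF r f]
    have "mollify r f y - mollify r f x - (y - x) \<bullet> mollify_grad r f x =
        (\<integral>s. ?d s \<partial>lebesgue)"
      unfolding mollify_def mollify_grad_def using i[of x] i(1)[of y]
      by (simp del: inner_scaleR_right real_scaleR_def)
    also have "norm \<dots> \<le> (\<integral>s. (e' * norm (y - x)) * \<bar>f s\<bar> \<partial>lebesgue)"
    proof (rule Bochner_Integration.integral_norm_bound_integral)
      show "integrable lebesgue ?d"
        using i by (intro Bochner_Integration.integrable_add Bochner_Integration.integrable_diff integrable_inner_right) auto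
      show "integrable lebesgue (\<lambda>s. (e' * norm (y - x)) * \<bar>f s\<bar>)" using f by auto
      fix s
      have "?d s
         = (mollifier r y s - mollifier r x s + (y - x) \<bullet> mollifier_grad r x s) * f s"
        by (simp add: algebra_simps)
      then show "norm (?d s)
          \<le> (e' * norm (y - x)) * \<bar>f s\<bar>"
        using mult_right_mono[OF est[OF y, of s], of "\<bar>f s\<bar>"] by (simp add: abs_mult)
    qed
    also have "\<dots> = (I * e') * norm (y - x)" using f by (simp add: I_def)
    also have "\<dots> \<le> e * norm (y - x)" using e' by (intro mult_right_mono) auto
    finally show "norm (mollify r f y - mollify r f x - (y - x) \<bullet> mollify_grad r f x) \<le> e * norm (y - x)" .
  qed
qed

lemma continuous_on_integral_dominated:
  fixes F :: "'a::euclidean_space \<Rightarrow> 'a \<Rightarrow> 'b::euclidean_space"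
  assumes "\<And>y. continuous_on UNIV (\<lambda>x. F x y)" "\<And>x. F x \<in> borel_measurable lebesgue"
    "\<And>x y. norm (F x y) \<le> w y" "integrable lebesgue w"
  shows "continuous_on UNIV (\<lambda>x. integral\<^sup>L lebesgue (F x))"
  unfolding continuous_on_sequentially
proof (intro allI ballI impI, elim conjE)
  fix u :: "nat \<Rightarrow> 'a" and a assume u: "u \<longlonglongrightarrow> a"
  show "((\<lambda>x. integral\<^sup>L lebesgue (F x)) \<circ> u) \<longlonglongrightarrow> integral\<^sup>L lebesgue (F a)"
    unfolding o_def
  proof (rule integral_dominated_convergence[where w=w])
    show "AE y in lebesgue. (\<lambda>i. F (u i) y) \<longlonglongrightarrow> F a y"
      using continuous_on_tendsto_compose[OF assms(1) u] by (intro AE_I2) auto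
  qed (use assms in auto)
qed

lemma continuous_mollify:
  fixes f :: "'a::euclidean_space \<Rightarrow> 'b::euclidean_space"
  assumes "0 < r" "integrable lebesgue f"
  shows "continuous_on UNIV (mollify r f)"
proof -
  obtain B where B: "\<And>c x::'a. mollifier r c x \<le> B" using mollifier_bounded[OF assms(1)] by metis
  show ?thesis
    unfolding mollify_def
  proof (rule continuous_on_integral_dominated[where w="\<lambda>y. B * norm (f y)"])
    show "(\<lambda>y. mollifier r x y *\<^sub>R f y) \<in> borel_measurable lebesgue" for x
      using integrable_mollify[OF assms] by auto
  qed (use assms B in \<open>auto simp: mollifier_nonneg[OF assms(1)] abs_of_nonneg intro!: continuous_intros mult_right_mono\<close>)
qed

lemma continuous_mollify_grad:
  fixes f :: "'a::euclidean_space \<Rightarrow> real"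
  assumes "0 < r" "integrable lebesgue f"
  shows "continuous_on UNIV (mollify_grad r f)"
proof -
  obtain B where B: "\<And>c x::'a. norm (mollifier_grad r c x) \<le> B" using mollifier_bounded[OF assms(1)] by metis
  have *: "continuous_on UNIV (\<lambda>x. integral\<^sup>L lebesgue (\<lambda>y. f y *\<^sub>R mollifier_grad r x y))"
  proof (rule continuous_on_integral_dominated[where w="\<lambda>y. \<bar>f y\<bar> * B"])
    show "(\<lambda>y. f y *\<^sub>R mollifier_grad r x y) \<in> borel_measurable lebesgue" for x
      using integrable_mollify_grad[OF assms] by auto
    show "continuous_on UNIV (\<lambda>x. f y *\<^sub>R mollifier_grad r x y)" for y
      by (subst mollifier_grad_commute) (intro continuous_intros)
  qed (use assms B in \<open>auto intro!: mult_left_mono\<close>)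
  show ?thesis
    unfolding mollify_grad_def by (intro continuous_on_minus *)
qed

lemma mollify_nonneg:
  fixes f :: "'a::euclidean_space \<Rightarrow> real"
  assumes "0 < r" "\<And>x. 0 \<le> f x" shows "0 \<le> mollify r f x"
  unfolding mollify_def using assms by (intro integral_nonneg_AE AE_I2) (auto simp: mollifier_nonneg[OF assms(1)])

text \<open>The difference is a weighted mean of the values \<open>f y - a\<close> over the ball.
  With \<open>a = f x\<close> this gives convergence; with other choices it gives bounds on the
  range.\<close>

lemma norm_mollify_diff_le:
  fixes f :: "'a::euclidean_space \<Rightarrow> 'b::euclidean_space"
  assumes r: "0 < r" and f: "integrable lebesgue f" and e: "\<And>y. y \<in> ball x r \<Longrightarrow> norm (f y - a) \<le> e"
  shows "norm (mollify r f x - a) \<le> e"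
proof -
  note im = integral_mollifier[OF r, of x]
  have "mollify r f x - a = (\<integral>y. mollifier r x y *\<^sub>R f y - mollifier r x y *\<^sub>R a \<partial>lebesgue)"
    unfolding mollify_def using im integrable_mollify[OF r f] by (subst Bochner_Integration.integral_diff) auto
  also have "norm \<dots> \<le> (\<integral>y. mollifier r x y * e \<partial>lebesgue)"
  proof (rule Bochner_Integration.integral_norm_bound_integral)
    fix y
    show "norm (mollifier r x y *\<^sub>R f y - mollifier r x y *\<^sub>R a) \<le> mollifier r x y * e"
    proof (cases "y \<in> ball x r")
      case True
      then show ?thesis using e[OF True] mollifier_nonneg[OF r, of x y]
        by (auto simp: scaleR_diff_right[symmetric] intro: mult_left_mono)
    qed (use mollifier_eq_0[OF r, of y x] in auto)
  qed (use im integrable_mollify[OF r f] in auto)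
  also have "\<dots> = e" using im by simp
  finally show ?thesis .
qed

lemma mollify_tendsto:
  fixes f :: "'a::euclidean_space \<Rightarrow> 'b::euclidean_space"
  assumes r: "\<And>n. 0 < r n" "r \<longlonglongrightarrow> 0" and f: "integrable lebesgue f" "isCont f x"
  shows "(\<lambda>n. mollify (r n) f x) \<longlonglongrightarrow> f x"
proof (rule LIMSEQ_I)
  fix e :: real assume e: "0 < e"
  then obtain d where d: "d > 0" "\<And>y. dist y x < d \<Longrightarrow> dist (f y) (f x) < e / 2"
    using f(2) unfolding continuous_at_eps_delta by (metis half_gt_zero)
  obtain N where N: "\<And>n. n \<ge> N \<Longrightarrow> r n < d"
    using LIMSEQ_D[OF r(2) d(1)] r(1) by (auto simp: abs_of_pos)
  show "\<exists>no. \<forall>n\<ge>no. norm (mollify (r n) f x - f x) < e"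
  proof (intro exI allI impI)
    fix n assume "N \<le> n"
    then have "norm (mollify (r n) f x - f x) \<le> e / 2"
      using d(2) N[of n] by (intro norm_mollify_diff_le r f less_imp_le) (auto simp: dist_norm norm_minus_commute)
    then show "norm (mollify (r n) f x - f x) < e" using e by linarith
  qed
qed

text \<open>Tonelli's theorem: by symmetry the kernel has mass one in the centre variable as
  well.\<close>

lemma integral_mollify_nonneg:
  fixes a :: "'a::euclidean_space \<Rightarrow> real"
  assumes r: "0 < r" and a: "integrable lebesgue a" "\<And>x. 0 \<le> a x"
  shows "integrable lebesgue (mollify r a)" "integral\<^sup>L lebesgue (mollify r a) = integral\<^sup>L lebesgue a"
proof -
  have "a \<in> borel_measurable lebesgue" using a by auto
  \<comment> \<open>Tonelli's theorem is applied on the Borel product space, so \<open>a\<close> is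
    exchanged for a Borel function that agrees with it almost everywhere.\<close>
  from completion_ex_borel_measurable_real[OF this] obtain b where [measurable]: "b \<in> borel_measurable lborel"
    and b: "AE x in lborel. a x = b x" by blast
  have [measurable]: "(\<lambda>z::'a\<times>'a. mollifier r (fst z) (snd z)) \<in> borel_measurable (lborel \<Otimes>\<^sub>M lborel)"
    by (simp add: lborel_prod borel_measurable_continuous_onI continuous_mollifier_pair)
  have M[measurable]: "(\<lambda>(x, y::'a). ennreal (mollifier r x y * b y)) \<in> borel_measurable (lborel \<Otimes>\<^sub>M lborel)"
    unfolding split_beta' by measurable
  have mol: "mollify r a x \<ge> 0" for x by (rule mollify_nonneg[OF r a(2)])
  have eq: "ennreal (mollify r a x) = (\<integral>\<^sup>+y. ennreal (mollifier r x y * b y) \<partial>lborel)" for x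
  proof -
    have "ennreal (mollify r a x) = (\<integral>\<^sup>+y. ennreal (mollifier r x y * a y) \<partial>lebesgue)"
      unfolding mollify_def using integrable_mollify[OF r a(1), of x] a(2)
      by (subst nn_integral_eq_integral) (auto simp: mollifier_nonneg[OF r])
    also have "\<dots> = (\<integral>\<^sup>+y. ennreal (mollifier r x y * a y) \<partial>lborel)"
      by (rule nn_integral_completion)
    also have "\<dots> = (\<integral>\<^sup>+y. ennreal (mollifier r x y * b y) \<partial>lborel)"
      by (rule nn_integral_cong_AE) (use b in eventually_elim, simp)
    finally show ?thesis .
  qed
  have one: "(\<integral>\<^sup>+x. ennreal (mollifier r x y) \<partial>lborel) = 1" for y :: 'a
  proof -
    have "(\<integral>\<^sup>+x. ennreal (mollifier r x y) \<partial>lborel) = (\<integral>\<^sup>+x. ennreal (mollifier r y x) \<partial>lebesgue)"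
      by (simp add: mollifier_commute[of r y] nn_integral_completion)
    also have "\<dots> = 1"
      using integral_mollifier[OF r, of y] by (subst nn_integral_eq_integral) (auto simp: mollifier_nonneg[OF r])
    finally show ?thesis .
  qed
  have "(\<integral>\<^sup>+x. ennreal (mollify r a x) \<partial>lebesgue) = (\<integral>\<^sup>+x. \<integral>\<^sup>+y. ennreal (mollifier r x y * b y) \<partial>lborel \<partial>lborel)"
    unfolding nn_integral_completion eq ..
  also have "\<dots> = (\<integral>\<^sup>+y. \<integral>\<^sup>+x. ennreal (mollifier r x y * b y) \<partial>lborel \<partial>lborel)"
    using lborel_pair.Fubini[OF M] by simp
  also have "\<dots> = (\<integral>\<^sup>+y. ennreal (a y) \<partial>lborel)"
  proof (rule nn_integral_cong_AE, use b in eventually_elim)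
    fix y assume y: "a y = b y"
    have [measurable]: "(\<lambda>x. ennreal (mollifier r x y)) \<in> borel_measurable lborel"
      by (intro measurable_compose[OF _ measurable_ennreal]) (simp add: borel_measurable_continuous_onI continuous_mollifier_center)
    have "(\<integral>\<^sup>+x. ennreal (mollifier r x y * b y) \<partial>lborel) = (\<integral>\<^sup>+x. ennreal (mollifier r x y) * ennreal (b y) \<partial>lborel)"
      using a(2)[of y] y by (simp add: ennreal_mult mollifier_nonneg[OF r])
    also have "\<dots> = ennreal (a y)" using y by (simp add: nn_integral_multc one)
    finally show "(\<integral>\<^sup>+x. ennreal (mollifier r x y * b y) \<partial>lborel) = ennreal (a y)" .
  qed
  also have "\<dots> = ennreal (integral\<^sup>L lebesgue a)"
    using nn_integral_eq_integral[OF a(1)] a(2) by (simp add: nn_integral_completion)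
  finally have *: "(\<integral>\<^sup>+x. ennreal (mollify r a x) \<partial>lebesgue) = ennreal (integral\<^sup>L lebesgue a)" .
  have m: "mollify r a \<in> borel_measurable lebesgue"
    by (rule borel_measurable_lebesgue_continuous[OF continuous_mollify[OF r a(1)]])
  show i: "integrable lebesgue (mollify r a)"
    by (rule integrableI_nonneg[OF m]) (use mol * in auto)
  have "0 \<le> integral\<^sup>L lebesgue a" "0 \<le> integral\<^sup>L lebesgue (mollify r a)"
    using a(2) mol by (auto intro!: integral_nonneg_AE)
  then show "integral\<^sup>L lebesgue (mollify r a) = integral\<^sup>L lebesgue a"
    using * nn_integral_eq_integral[OF i] mol by (simp add: ennreal_inj)
qed

text \<open>Mollification contracts L^p: Jensen's inequality bounds the p-th power of the mollified
  norm pointwise by the mollification of the p-th power, and mollification preserves integrals of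
  nonnegative functions.\<close>

lemma
  fixes f :: "'a::euclidean_space \<Rightarrow> 'b::euclidean_space"
  assumes p: "1 < p" and r: "0 < r" and f: "integrable lebesgue f" "integrable lebesgue (\<lambda>x. norm (f x) powr p)"
  shows integrable_mollify_powr: "integrable lebesgue (\<lambda>x. norm (mollify r f x) powr p)"
    and integral_mollify_powr_le: "(\<integral>x. norm (mollify r f x) powr p \<partial>lebesgue) \<le> (\<integral>x. norm (f x) powr p \<partial>lebesgue)"
proof -
  let ?a = "\<lambda>x. norm (f x) powr p"
  note m = integral_mollify_nonneg[OF r f(2)]
  have le: "norm (mollify r f x) powr p \<le> mollify r ?a x" for x
  proof -
    have "norm (mollify r f x) \<le> (\<integral>y. mollifier r x y * norm (f y) \<partial>lebesgue)"
      unfolding mollify_def using integrable_mollify[OF r f(1), of x] integrable_mollify[OF r integrable_norm[OF f(1)], of x]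
      by (intro Bochner_Integration.integral_norm_bound_integral) (auto simp: mollifier_nonneg[OF r] abs_of_nonneg)
    then have "norm (mollify r f x) powr p \<le> (\<integral>y. mollifier r x y * norm (f y) \<partial>lebesgue) powr p"
      using p by (intro powr_mono2) auto
    also have "\<dots> \<le> (\<integral>y. mollifier r x y * norm (f y) powr p \<partial>lebesgue)"
      using integral_mollifier[OF r, of x] integrable_mollify[OF r integrable_norm[OF f(1)], of x] integrable_mollify[OF r f(2), of x]
      by (intro weighted_mean_powr_le[OF p]) (auto simp: mollifier_nonneg[OF r])
    finally show ?thesis by (simp add: mollify_def)
  qed
  show i: "integrable lebesgue (\<lambda>x. norm (mollify r f x) powr p)"
  proof (rule Bochner_Integration.integrable_bound[OF m(1)])
    show "(\<lambda>x. norm (mollify r f x) powr p) \<in> borel_measurable lebesgue"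
      using borel_measurable_lebesgue_continuous[OF continuous_mollify[OF r f(1)]] by auto
    show "AE x in lebesgue. norm (norm (mollify r f x) powr p) \<le> norm (mollify r ?a x)"
      using le by (intro AE_I2) (auto intro: order_trans[OF _ abs_ge_self])
  qed auto
  have "(\<integral>x. norm (mollify r f x) powr p \<partial>lebesgue) \<le> integral\<^sup>L lebesgue (mollify r ?a)"
    by (rule integral_mono[OF i m(1)]) (use le in auto)
  then show "(\<integral>x. norm (mollify r f x) powr p \<partial>lebesgue) \<le> (\<integral>x. norm (f x) powr p \<partial>lebesgue)"
    using m(2) by simp
qed

section \<open>Density of bounded continuous functions in L^p of a compact set\<close>

lemma integrable_lebesgue_on_bounded:
  fixes f :: "'a::euclidean_space \<Rightarrow> 'b::euclidean_space"
  assumes "compact K" "f \<in> borel_measurable (lebesgue_on K)" "\<And>x. x \<in> K \<Longrightarrow> norm (f x) \<le> B"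
  shows "integrable (lebesgue_on K) f"
proof (rule Bochner_Integration.integrable_bound)
  show "integrable (lebesgue_on K) (\<lambda>x. B)"
    by (intro integrable_continuous_compact assms continuous_intros)
  show "AE x in lebesgue_on K. norm (f x) \<le> norm B"
    using assms(3) by (intro AE_I2) (auto simp: space_restrict_space intro: order_trans[OF _ abs_ge_self])
qed fact

text \<open>Radial retraction onto the ball of radius \<open>M\<close>; the maximum in the
  denominator makes its continuity evident.\<close>

definition norm_clip :: "real \<Rightarrow> 'b::euclidean_space \<Rightarrow> 'b" where
  "norm_clip M y = (M / max M (norm y)) *\<^sub>R y"

lemma norm_clip:
  assumes "0 < M"
  shows "norm (norm_clip M y) \<le> M" "norm (norm_clip M y - y) \<le> norm y" "norm y \<le> M \<Longrightarrow> norm_clip M y = y"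
    "continuous_on A (norm_clip M)"
proof -
  show "norm (norm_clip M y) \<le> M" "norm y \<le> M \<Longrightarrow> norm_clip M y = y"
    using assms by (auto simp: norm_clip_def max_def field_simps)
  have c: "0 \<le> 1 - M / max M (norm y)" "1 - M / max M (norm y) \<le> 1" using assms by (auto simp: max_def divide_simps)
  have "norm_clip M y - y = - (1 - M / max M (norm y)) *\<^sub>R y"
    by (simp add: norm_clip_def algebra_simps)
  then have "norm (norm_clip M y - y) = (1 - M / max M (norm y)) * norm y" using c by simp
  also have "\<dots> \<le> 1 * norm y" using c by (intro mult_right_mono) auto
  finally show "norm (norm_clip M y - y) \<le> norm y" by simp
  show "continuous_on A (norm_clip M)"
    unfolding norm_clip_def using assms by (intro continuous_intros) auto
qed

lemma powr_integrable_diff: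
  fixes f g :: "'x \<Rightarrow> 'b::euclidean_space"
  assumes p: "0 < p" and "f \<in> borel_measurable M" "g \<in> borel_measurable M"
    "integrable M (\<lambda>x. norm (f x) powr p)" "integrable M (\<lambda>x. norm (g x) powr p)"
  shows "integrable M (\<lambda>x. norm (f x - g x) powr p)"
proof (rule Bochner_Integration.integrable_bound)
  show "integrable M (\<lambda>x. 2 powr p * (norm (f x) powr p + norm (g x) powr p))" using assms by auto
  have "norm (f x - g x) powr p \<le> 2 powr p * (norm (f x) powr p + norm (g x) powr p)" for x
    using norm_add_powr_le[OF p, of "f x" "- g x"] by simp
  then show "AE x in M. norm (norm (f x - g x) powr p) \<le> norm (2 powr p * (norm (f x) powr p + norm (g x) powr p))"
    by (intro AE_I2) (auto intro: order_trans[OF _ abs_ge_self])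
qed (use assms in measurable)

text \<open>Measurable functions are almost everywhere limits of continuous ones; clipping the
  function and its approximations at a common level supplies the dominating constant that this
  convergence lacks.\<close>

lemma continuous_dense_Lp:
  fixes f :: "'a::euclidean_space \<Rightarrow> 'b::euclidean_space"
  assumes p: "0 < p" and K: "compact K" and f: "f \<in> borel_measurable (lebesgue_on K)"
    "integrable (lebesgue_on K) (\<lambda>x. norm (f x) powr p)" and \<tau>: "0 < \<tau>"
  obtains h M where "continuous_on UNIV h" "\<And>x. norm (h x) \<le> M"
    "(\<integral>x. norm (f x - h x) powr p \<partial>lebesgue_on K) < \<tau>"
proof -
  have Km: "K \<in> sets lebesgue" using K by (simp add: compact_imp_closed)
  have clipm: "(\<lambda>x. norm_clip M (g x)) \<in> borel_measurable N" if "0 < M" "g \<in> borel_measurable N" for M N and g :: "'a \<Rightarrow> 'b"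
    using that(2) borel_measurable_continuous_onI[OF norm_clip(4)[OF that(1)]] by (rule measurable_compose)
  define \<tau>' where "\<tau>' = \<tau> / (2 * 2 powr p)"
  have \<tau>': "0 < \<tau>'" "2 powr p * (\<tau>' + \<tau>') \<le> \<tau>" using \<tau> by (auto simp: \<tau>'_def)
  \<comment> \<open>First error: clipping changes \<open>f\<close> only where its norm exceeds the
    level, and by no more than that norm.\<close>
  have "(\<lambda>n. \<integral>x. norm (norm_clip (real (Suc n)) (f x) - f x) powr p \<partial>lebesgue_on K) \<longlonglongrightarrow> (\<integral>x. 0 \<partial>lebesgue_on K)"
  proof (rule integral_dominated_convergence[where w="\<lambda>x. norm (f x) powr p"])
    show "AE x in lebesgue_on K. (\<lambda>n. norm (norm_clip (real (Suc n)) (f x) - f x) powr p) \<longlonglongrightarrow> 0"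
    proof (rule AE_I2)
      fix x
      obtain N where N: "norm (f x) \<le> real N" using real_arch_simple by blast
      have "eventually (\<lambda>n. norm (norm_clip (real (Suc n)) (f x) - f x) powr p = 0) sequentially"
        using eventually_ge_at_top[of N] by eventually_elim (use N p norm_clip(3)[of "real (Suc _)" "f x"] in auto)
      then show "(\<lambda>n. norm (norm_clip (real (Suc n)) (f x) - f x) powr p) \<longlonglongrightarrow> 0"
        by (rule tendsto_eventually)
    qed
    show "AE x in lebesgue_on K. norm (norm (norm_clip (real (Suc n)) (f x) - f x) powr p) \<le> norm (f x) powr p" for n
      using p norm_clip(2)[of "real (Suc n)"] by (intro AE_I2) (auto intro!: powr_mono2)
    show "(\<lambda>x. norm (norm_clip (real (Suc n)) (f x) - f x) powr p) \<in> borel_measurable (lebesgue_on K)" for n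
      using clipm[OF _ f(1), of "real (Suc n)"] f(1) by measurable
  qed (use f in auto)
  then have "eventually (\<lambda>n. (\<integral>x. norm (norm_clip (real (Suc n)) (f x) - f x) powr p \<partial>lebesgue_on K) < \<tau>') sequentially"
    using \<tau>'(1) by (intro order_tendstoD(2)) auto
  then obtain n0 where n0: "(\<integral>x. norm (norm_clip (real (Suc n0)) (f x) - f x) powr p \<partial>lebesgue_on K) < \<tau>'"
    by (auto simp: eventually_sequentially)
  define M where "M = real (Suc n0)"
  have M: "0 < M" by (simp add: M_def)
  obtain N g where N: "negligible N" and g: "\<And>n. continuous_on UNIV (g n)"
    and lim: "\<And>x. x \<notin> N \<Longrightarrow> (\<lambda>n. g n x) \<longlonglongrightarrow> (if x \<in> K then f x else 0)"
    using f(1) measurable_on_iff_borel_measurable[OF Km, of f] unfolding measurable_on_def by blast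
  have gm: "g n \<in> borel_measurable (lebesgue_on K)" for n
    using borel_measurable_lebesgue_continuous[OF g] by (rule measurable_restrict_space1)
  \<comment> \<open>Second error: pointwise convergence survives the continuous retraction, and
    clipped values differ by at most \<open>2 * M\<close>.\<close>
  have "(\<lambda>n. \<integral>x. norm (norm_clip M (f x) - norm_clip M (g n x)) powr p \<partial>lebesgue_on K) \<longlonglongrightarrow> (\<integral>x. 0 \<partial>lebesgue_on K)"
  proof (rule integral_dominated_convergence[where w="\<lambda>x. (2 * M) powr p"])
    have "N \<in> null_sets lebesgue" using N negligible_iff_null_sets by auto
    then have "AE x in lebesgue. x \<notin> N" by (rule AE_not_in)
    then have "AE x in lebesgue_on K. x \<notin> N" using Km by (auto simp: AE_restrict_space_iff elim: eventually_mono)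
    then have "AE x in lebesgue_on K. x \<in> K \<and> x \<notin> N"
      using AE_space by eventually_elim (auto simp: space_restrict_space)
    then show "AE x in lebesgue_on K. (\<lambda>n. norm (norm_clip M (f x) - norm_clip M (g n x)) powr p) \<longlonglongrightarrow> 0"
    proof eventually_elim
      case (elim x)
      then have "(\<lambda>n. g n x) \<longlonglongrightarrow> f x" using lim[of x] by simp
      then have "(\<lambda>n. norm_clip M (g n x)) \<longlonglongrightarrow> norm_clip M (f x)"
        by (rule continuous_on_tendsto_compose[OF norm_clip(4)[OF M, of UNIV]]) auto
      then have "(\<lambda>n. norm (norm_clip M (f x) - norm_clip M (g n x)) powr p) \<longlonglongrightarrow> norm (norm_clip M (f x) - norm_clip M (f x)) powr p"
        using p by (intro tendsto_powr2 tendsto_intros) auto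
      then show ?case using p by simp
    qed
    show "AE x in lebesgue_on K. norm (norm (norm_clip M (f x) - norm_clip M (g n x)) powr p) \<le> (2 * M) powr p" for n
    proof (rule AE_I2)
      fix x
      have "norm (norm_clip M (f x) - norm_clip M (g n x)) \<le> 2 * M"
        using norm_clip(1)[OF M, of "f x"] norm_clip(1)[OF M, of "g n x"] norm_triangle_ineq4[of "norm_clip M (f x)" "norm_clip M (g n x)"] by linarith
      then show "norm (norm (norm_clip M (f x) - norm_clip M (g n x)) powr p) \<le> (2 * M) powr p"
        using p by (auto intro!: powr_mono2)
    qed
    show "(\<lambda>x. norm (norm_clip M (f x) - norm_clip M (g n x)) powr p) \<in> borel_measurable (lebesgue_on K)" for n
      using clipm[OF M f(1)] clipm[OF M gm] by measurable
    show "integrable (lebesgue_on K) (\<lambda>x. (2 * M) powr p)"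
      by (intro integrable_continuous_compact K continuous_intros)
  qed auto
  then have "eventually (\<lambda>n. (\<integral>x. norm (norm_clip M (f x) - norm_clip M (g n x)) powr p \<partial>lebesgue_on K) < \<tau>') sequentially"
    using \<tau>'(1) by (intro order_tendstoD(2)) auto
  then obtain n1 where n1: "(\<integral>x. norm (norm_clip M (f x) - norm_clip M (g n1 x)) powr p \<partial>lebesgue_on K) < \<tau>'"
    by (auto simp: eventually_sequentially)
  define h where "h x = norm_clip M (g n1 x)" for x
  have hm: "h \<in> borel_measurable (lebesgue_on K)" and cm: "(\<lambda>x. norm_clip M (f x)) \<in> borel_measurable (lebesgue_on K)"
    unfolding h_def using clipm[OF M gm] clipm[OF M f(1)] by auto
  have hb: "norm (h x) \<le> M" for x unfolding h_def by (rule norm_clip(1)[OF M])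
  have hi: "integrable (lebesgue_on K) (\<lambda>x. norm (h x) powr p)"
    by (rule integrable_lebesgue_on_bounded[OF K, where B="M powr p"]) (use hm hb p M in \<open>auto intro!: powr_mono2\<close>)
  have ci: "integrable (lebesgue_on K) (\<lambda>x. norm (norm_clip M (f x)) powr p)"
    by (rule integrable_lebesgue_on_bounded[OF K, where B="M powr p"])
       (use cm norm_clip(1)[OF M] p M in \<open>auto intro!: powr_mono2\<close>)
  have le: "norm (f x - h x) powr p \<le> 2 powr p * (norm (norm_clip M (f x) - f x) powr p + norm (norm_clip M (f x) - h x) powr p)" for x
    using norm_add_powr_le[OF p, of "f x - norm_clip M (f x)" "norm_clip M (f x) - h x"] by (simp add: norm_minus_commute)
  have i: "integrable (lebesgue_on K) (\<lambda>x. norm (norm_clip M (f x) - f x) powr p)"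
    "integrable (lebesgue_on K) (\<lambda>x. norm (norm_clip M (f x) - h x) powr p)"
    "integrable (lebesgue_on K) (\<lambda>x. norm (f x - h x) powr p)"
    by (rule powr_integrable_diff[OF p]; use f hm cm hi ci in auto)+
  have "(\<integral>x. norm (f x - h x) powr p \<partial>lebesgue_on K) \<le>
     (\<integral>x. 2 powr p * (norm (norm_clip M (f x) - f x) powr p + norm (norm_clip M (f x) - h x) powr p) \<partial>lebesgue_on K)"
    by (rule integral_mono[OF i(3)]) (use i le in auto)
  also have "\<dots> = 2 powr p * ((\<integral>x. norm (norm_clip M (f x) - f x) powr p \<partial>lebesgue_on K) + (\<integral>x. norm (norm_clip M (f x) - h x) powr p \<partial>lebesgue_on K))"
    using i by simp
  also have "\<dots> < 2 powr p * (\<tau>' + \<tau>')"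
    using n0 n1 by (intro mult_strict_left_mono add_strict_mono) (auto simp: M_def h_def)
  also have "\<dots> \<le> \<tau>" by (rule \<tau>')
  finally have "(\<integral>x. norm (f x - h x) powr p \<partial>lebesgue_on K) < \<tau>" .
  moreover have "continuous_on UNIV h"
    unfolding h_def by (rule continuous_on_compose2[OF norm_clip(4)[OF M] g]) auto
  ultimately show ?thesis using that hb by blast
qed

text \<open>Splitting \<open>f = e + k\<close> with \<open>e\<close> small in L^p and
  \<open>k\<close> bounded, and continuous inside the larger ball: the contraction property controls
  the mollified \<open>e\<close> uniformly in \<open>n\<close>, while \<open>k\<close> is handled by
  pointwise convergence and domination.\<close>

lemma mollify_Lp_tendsto:
  fixes f :: "'a::euclidean_space \<Rightarrow> 'b::euclidean_space"
  assumes p: "1 < p" and R: "0 < R" "R < R'" and r: "\<And>n. 0 < r n" "r \<longlonglongrightarrow> 0"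
    and f: "integrable lebesgue f" "integrable lebesgue (\<lambda>x. norm (f x) powr p)" "\<And>x. x \<notin> cball x0 R' \<Longrightarrow> f x = 0"
  shows "\<And>n. integrable (lebesgue_on (cball x0 R)) (\<lambda>x. norm (mollify (r n) f x - f x) powr p)"
    "(\<lambda>n. \<integral>x. norm (mollify (r n) f x - f x) powr p \<partial>lebesgue_on (cball x0 R)) \<longlonglongrightarrow> 0"
proof -
  let ?K = "cball x0 R'" and ?L = "lebesgue_on (cball x0 R)"
  have p0: "0 < p" using p by simp
  have fK: "f \<in> borel_measurable (lebesgue_on ?K)" "integrable (lebesgue_on ?K) (\<lambda>x. norm (f x) powr p)"
    using f p by (auto intro!: measurable_restrict_space1 iffD2[OF integrable_lebesgue_on_vanishing])
  have restr: "integrable lebesgue u \<Longrightarrow> integrable ?L u" for u :: "'a \<Rightarrow> real"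
    using integrable_mult_indicator[of "cball x0 R" lebesgue u] by (simp add: integrable_restrict_space)
  have restr_le: "integral\<^sup>L ?L u \<le> integral\<^sup>L lebesgue u" if "integrable lebesgue u" "\<And>x. 0 \<le> u x" for u :: "'a \<Rightarrow> real"
  proof -
    have "integral\<^sup>L ?L u = (\<integral>x. indicator (cball x0 R) x *\<^sub>R u x \<partial>lebesgue)"
      by (rule integral_restrict_space) simp
    also have "\<dots> \<le> integral\<^sup>L lebesgue u"
      using that integrable_mult_indicator[of "cball x0 R" lebesgue u]
      by (intro integral_mono) (auto split: split_indicator)
    finally show ?thesis .
  qed
  have all: "integrable lebesgue (\<lambda>x. norm (mollify (r n) f x - f x) powr p)" for n
    by (rule powr_integrable_diff[OF p0])
       (use f integrable_mollify_powr[OF p r(1) f(1,2)] borel_measurable_lebesgue_continuous[OF continuous_mollify[OF r(1) f(1)]] in auto)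
  then show int: "integrable ?L (\<lambda>x. norm (mollify (r n) f x - f x) powr p)" for n by (rule restr)
  show "(\<lambda>n. \<integral>x. norm (mollify (r n) f x - f x) powr p \<partial>?L) \<longlonglongrightarrow> 0"
  proof (rule LIMSEQ_I)
    fix \<epsilon> :: real assume \<epsilon>: "0 < \<epsilon>"
    \<comment> \<open>\<open>c\<close> collects the constants of two applications of
      \<open>norm_add_powr_le\<close>; each of the three error terms is then allotted one
      \<open>\<tau>\<close>.\<close>
    define c where "c = 2 powr p * (1 + 2 powr p)"
    define \<tau> where "\<tau> = \<epsilon> / (3 * c)"
    have c: "0 < c" "2 powr p \<le> c" "2 powr p * 2 powr p \<le> c" by (auto simp: c_def algebra_simps intro: add_pos_pos)
    have \<tau>: "0 < \<tau>" "c * (\<tau> + \<tau> + \<tau>) = \<epsilon>" using \<epsilon> c by (auto simp: \<tau>_def)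
    obtain h M where h: "continuous_on UNIV h" "\<And>x. norm (h x) \<le> M" "(\<integral>x. norm (f x - h x) powr p \<partial>lebesgue_on ?K) < \<tau>"
      using continuous_dense_Lp[OF p0 compact_cball fK \<tau>(1)] by metis
    \<comment> \<open>Truncation makes \<open>k\<close> integrable over the whole space. Its jump
      lies on the sphere of radius \<open>R'\<close>, away from the ball of radius \<open>R\<close>
      on which convergence is claimed.\<close>
    define k where "k x = indicator ?K x *\<^sub>R h x" for x
    have km: "k \<in> borel_measurable lebesgue"
      unfolding k_def
      by (intro borel_measurable_scaleR borel_measurable_indicator borel_measurable_lebesgue_continuous h(1)) auto
    have kb: "norm (k x) \<le> M" for x using h(2)[of x] order_trans[OF norm_ge_zero h(2)[of x]] by (auto simp: k_def indicator_def)
    have M0: "0 \<le> M" using kb norm_ge_zero order_trans by blast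
    have ki: "integrable lebesgue k"
      by (rule integrable_lebesgue_vanishing_outside[OF km compact_cball[of x0 R'] _ kb]) (simp add: k_def)
    have k0: "k x = 0" if "x \<notin> ?K" for x using that by (simp add: k_def)
    have kpi: "integrable lebesgue (\<lambda>x. norm (k x) powr p)"
      by (rule integrable_lebesgue_vanishing_outside[where K="?K" and B="M powr p"])
         (use km kb k0 p in \<open>auto intro!: powr_mono2\<close>)
    define e where "e x = f x - k x" for x
    have ei: "integrable lebesgue e" unfolding e_def using f ki by auto
    have epi: "integrable lebesgue (\<lambda>x. norm (e x) powr p)"
      unfolding e_def by (rule powr_integrable_diff[OF p0]) (use f km kpi in auto)
    have "(\<integral>x. norm (e x) powr p \<partial>lebesgue) = (\<integral>x. norm (e x) powr p \<partial>lebesgue_on ?K)"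
      by (rule integral_lebesgue_on_vanishing[symmetric]) (use p f(3) in \<open>auto simp: e_def k_def\<close>)
    also have "\<dots> = (\<integral>x. norm (f x - h x) powr p \<partial>lebesgue_on ?K)"
      by (rule Bochner_Integration.integral_cong) (auto simp: e_def k_def)
    finally have e\<tau>: "(\<integral>x. norm (e x) powr p \<partial>lebesgue) < \<tau>" using h(3) by simp
    have lin: "mollify (r n) f x = mollify (r n) e x + mollify (r n) k x" for n x
    proof -
      have "mollify (r n) e x = mollify (r n) f x - mollify (r n) k x"
        unfolding mollify_def e_def scaleR_diff_right
        by (rule Bochner_Integration.integral_diff[OF integrable_mollify[OF r(1) f(1)] integrable_mollify[OF r(1) ki]])
      then show ?thesis by simp
    qed
    have "(\<lambda>n. \<integral>x. norm (mollify (r n) k x - k x) powr p \<partial>?L) \<longlonglongrightarrow> (\<integral>x. 0 \<partial>?L)"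
    proof (rule integral_dominated_convergence[where w="\<lambda>x. (2 * M) powr p"])
      show "AE x in ?L. (\<lambda>n. norm (mollify (r n) k x - k x) powr p) \<longlonglongrightarrow> 0"
      proof (rule AE_I2)
        fix x assume "x \<in> space ?L"
        then have x: "x \<in> ball x0 R'" using R by (auto simp: space_restrict_space)
        have "isCont h x" using h(1) by (simp add: continuous_on_eq_continuous_at)
        then have "isCont k x"
          using eventually_nhds_in_open[OF open_ball x]
          by (subst isCont_cong[where g=h]) (auto elim!: eventually_mono simp: k_def indicator_def)
        then have "(\<lambda>n. mollify (r n) k x) \<longlonglongrightarrow> k x" by (rule mollify_tendsto[OF r ki])
        then have "(\<lambda>n. norm (mollify (r n) k x - k x) powr p) \<longlonglongrightarrow> norm (k x - k x) powr p"
          using p by (intro tendsto_powr2 tendsto_intros) auto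
        then show "(\<lambda>n. norm (mollify (r n) k x - k x) powr p) \<longlonglongrightarrow> 0" using p by simp
      qed
      show "AE x in ?L. norm (norm (mollify (r n) k x - k x) powr p) \<le> (2 * M) powr p" for n
      proof (rule AE_I2)
        fix x
        have "norm (mollify (r n) k x - k x) \<le> 2 * M"
        proof (rule norm_mollify_diff_le[OF r(1) ki])
          fix y show "norm (k y - k x) \<le> 2 * M" using kb[of x] kb[of y] norm_triangle_ineq4[of "k y" "k x"] by linarith
        qed
        then show "norm (norm (mollify (r n) k x - k x) powr p) \<le> (2 * M) powr p" using p by (auto intro!: powr_mono2)
      qed
      show "(\<lambda>x. norm (mollify (r n) k x - k x) powr p) \<in> borel_measurable ?L" for n
        using km borel_measurable_lebesgue_continuous[OF continuous_mollify[OF r(1) ki]]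
        by (intro measurable_restrict_space1) measurable
      show "integrable ?L (\<lambda>x. (2 * M) powr p)" by (intro integrable_continuous_compact compact_cball continuous_intros)
    qed auto
    then have "eventually (\<lambda>n. (\<integral>x. norm (mollify (r n) k x - k x) powr p \<partial>?L) < \<tau>) sequentially"
      using \<tau>(1) by (intro order_tendstoD(2)) auto
    then obtain N where N: "\<And>n. n \<ge> N \<Longrightarrow> (\<integral>x. norm (mollify (r n) k x - k x) powr p \<partial>?L) < \<tau>"
      by (auto simp: eventually_sequentially)
    show "\<exists>no. \<forall>n\<ge>no. norm ((\<integral>x. norm (mollify (r n) f x - f x) powr p \<partial>?L) - 0) < \<epsilon>"
    proof (intro exI allI impI)
      fix n assume n: "N \<le> n"
      let ?A = "\<lambda>x. norm (mollify (r n) e x) powr p" and ?B = "\<lambda>x. norm (mollify (r n) k x - k x) powr p" and ?C = "\<lambda>x. norm (e x) powr p"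
      have le: "norm (mollify (r n) f x - f x) powr p \<le> c * (?A x + ?B x + ?C x)" for x
      proof -
        have "norm (mollify (r n) f x - f x) powr p \<le> 2 powr p * (?A x + norm (mollify (r n) k x - k x - e x) powr p)"
          using norm_add_powr_le[OF p0, of "mollify (r n) e x" "mollify (r n) k x - k x - e x"] by (simp add: lin e_def algebra_simps)
        also have "\<dots> \<le> 2 powr p * (?A x + 2 powr p * (?B x + ?C x))"
          using norm_add_powr_le[OF p0, of "mollify (r n) k x - k x" "- e x"] by (intro mult_left_mono add_left_mono) auto
        also have "\<dots> = 2 powr p * ?A x + (2 powr p * 2 powr p) * ?B x + (2 powr p * 2 powr p) * ?C x"
          by (simp add: algebra_simps)
        also have "\<dots> \<le> c * ?A x + c * ?B x + c * ?C x"
          using c by (intro add_mono mult_right_mono) auto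
        finally show ?thesis by (simp add: algebra_simps)
      qed
      have iA: "integrable lebesgue ?A" by (rule integrable_mollify_powr[OF p r(1) ei epi])
      have iB: "integrable lebesgue ?B"
        by (rule powr_integrable_diff[OF p0])
           (use km kpi integrable_mollify_powr[OF p r(1) ki kpi] borel_measurable_lebesgue_continuous[OF continuous_mollify[OF r(1) ki]] in auto)
      note i = restr[OF iA] restr[OF iB] restr[OF epi]
      have "(\<integral>x. norm (mollify (r n) f x - f x) powr p \<partial>?L) \<le> (\<integral>x. c * (?A x + ?B x + ?C x) \<partial>?L)"
        by (rule integral_mono[OF int]) (use i le in auto)
      also have "\<dots> = c * (integral\<^sup>L ?L ?A + integral\<^sup>L ?L ?B + integral\<^sup>L ?L ?C)" using i by simp
      also have "\<dots> < c * (\<tau> + \<tau> + \<tau>)"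
      proof (intro mult_strict_left_mono add_strict_mono)
        have "integral\<^sup>L ?L ?A \<le> integral\<^sup>L lebesgue ?A" by (rule restr_le[OF iA]) auto
        also have "\<dots> \<le> integral\<^sup>L lebesgue ?C" by (rule integral_mollify_powr_le[OF p r(1) ei epi])
        finally show "integral\<^sup>L ?L ?A < \<tau>" using e\<tau> by simp
        show "integral\<^sup>L ?L ?B < \<tau>" by (rule N[OF n])
        have "integral\<^sup>L ?L ?C \<le> integral\<^sup>L lebesgue ?C" by (rule restr_le[OF epi]) auto
        then show "integral\<^sup>L ?L ?C < \<tau>" using e\<tau> by simp
      qed (use c in auto)
      finally have "(\<integral>x. norm (mollify (r n) f x - f x) powr p \<partial>?L) < \<epsilon>" using \<tau>(2) by simp
      moreover have "0 \<le> (\<integral>x. norm (mollify (r n) f x - f x) powr p \<partial>?L)" by (intro integral_nonneg_AE) auto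
      ultimately show "norm ((\<integral>x. norm (mollify (r n) f x - f x) powr p \<partial>?L) - 0) < \<epsilon>" by simp
    qed
  qed
qed

section \<open>Translations and the Faber--Krahn inequality\<close>

text \<open>The difference is the integral of a directional derivative along the segment from
  \<open>x\<close> to \<open>x + z\<close>. Jensen's inequality in the segment parameter, followed
  by Tonelli and translation invariance in \<open>x\<close>, gives the bound with constant
  one.\<close>

lemma translation_diff_powr_le:
  fixes \<phi> :: "'a::euclidean_space \<Rightarrow> real"
  assumes p: "1 < p" and \<phi>: "\<And>x. GDERIV \<phi> x :> \<phi>' x" and cont: "continuous_on UNIV \<phi>'"
    and K: "compact K" "\<And>x. x \<notin> K \<Longrightarrow> \<phi> x = 0"
  shows "(\<integral>\<^sup>+x. ennreal (\<bar>\<phi> (x + z) - \<phi> x\<bar> powr p) \<partial>lborel)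
     \<le> ennreal (norm z powr p * (\<integral>x. norm (\<phi>' x) powr p \<partial>lebesgue))"
proof -
  have \<phi>'0: "\<phi>' x = 0" if "x \<notin> K" for x
    by (rule GDERIV_vanishing_outside_eq_0[OF \<phi> K]) (use that in auto)
  have [measurable]: "\<phi>' \<in> borel_measurable borel" using cont by (rule borel_measurable_continuous_onI)
  let ?I = "indicat_real {0..1::real}"
  let ?g = "\<lambda>t x. norm z * norm (\<phi>' (x + t *\<^sub>R z))"
  have ct: "continuous_on A (\<lambda>t. \<phi>' (x + t *\<^sub>R z))" for A x
    by (rule continuous_on_compose2[OF cont]) (intro continuous_intros, auto)
  have kint: "integrable lborel (\<lambda>t. ?I t * u t)" if "continuous_on {0..1} u" for u :: "real \<Rightarrow> real"
    using borel_integrable_compact[OF compact_Icc that] by (simp add: indicator_def if_distrib mult.commute cong: if_cong)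
  have cg: "continuous_on {0..1} (\<lambda>t. ?g t x)" "continuous_on {0..1} (\<lambda>t. ?g t x powr p)" for x
    using p by (auto intro!: continuous_on_powr' continuous_on_mult continuous_on_norm continuous_on_const ct)
  have pt: "\<bar>\<phi> (x + z) - \<phi> x\<bar> powr p \<le> (\<integral>t. ?I t * ?g t x powr p \<partial>lborel)" for x
  proof -
    have "(\<integral>t. ?I t *\<^sub>R (z \<bullet> \<phi>' (x + t *\<^sub>R z)) \<partial>lborel) = \<phi> (x + 1 *\<^sub>R z) - \<phi> (x + 0 *\<^sub>R z)"
    proof (rule integral_FTC_Icc)
      fix t :: real
      have "((\<lambda>t. x + t *\<^sub>R z) has_derivative (\<lambda>t. t *\<^sub>R z)) (at t)" by (auto intro!: derivative_eq_intros)
      from has_derivative_compose[OF this \<phi>[of "x + t *\<^sub>R z", unfolded gderiv_def]]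
      show "((\<lambda>t. \<phi> (x + t *\<^sub>R z)) has_vector_derivative z \<bullet> \<phi>' (x + t *\<^sub>R z)) (at t within {0..1})"
        unfolding has_vector_derivative_def by (auto intro!: has_derivative_at_withinI)
    qed (auto intro!: continuous_intros ct)
    then have "\<bar>\<phi> (x + z) - \<phi> x\<bar> = norm (\<integral>t. ?I t *\<^sub>R (z \<bullet> \<phi>' (x + t *\<^sub>R z)) \<partial>lborel)" by simp
    also have "\<dots> \<le> (\<integral>t. ?I t * ?g t x \<partial>lborel)"
    proof (rule Bochner_Integration.integral_norm_bound_integral)
      show "integrable lborel (\<lambda>t. ?I t *\<^sub>R (z \<bullet> \<phi>' (x + t *\<^sub>R z)))"
        unfolding real_scaleR_def by (rule kint) (intro continuous_intros ct)
      show "norm (?I t *\<^sub>R (z \<bullet> \<phi>' (x + t *\<^sub>R z))) \<le> ?I t * ?g t x" for t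
        using Cauchy_Schwarz_ineq2[of z "\<phi>' (x + t *\<^sub>R z)"] by (auto simp: indicator_def)
    qed (rule kint[OF cg(1)])
    finally have "\<bar>\<phi> (x + z) - \<phi> x\<bar> powr p \<le> (\<integral>t. ?I t * ?g t x \<partial>lborel) powr p"
      using p by (intro powr_mono2) auto
    also have "\<dots> \<le> (\<integral>t. ?I t * ?g t x powr p \<partial>lborel)"
      by (rule weighted_mean_powr_le[OF p]) (use kint[OF cg(1)] kint[OF cg(2)] in auto)
    finally show ?thesis .
  qed
  have M: "(\<lambda>(x, t). ennreal (?I t * ?g t x powr p)) \<in> borel_measurable (lborel \<Otimes>\<^sub>M lborel)"
    by measurable
  have ipow: "integrable lborel (\<lambda>x. norm (\<phi>' x) powr p)"
  proof -
    have "integrable lebesgue (\<lambda>x. norm (\<phi>' x) powr p)"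
      by (rule integrable_continuous_compact_support[OF _ K(1)]) (use p \<phi>'0 cont in \<open>auto intro!: continuous_on_powr' continuous_on_norm\<close>)
    then show ?thesis by (subst (asm) integrable_completion) measurable
  qed
  let ?P = "\<integral>x. norm (\<phi>' x) powr p \<partial>lborel"
  have "(\<integral>\<^sup>+x. ennreal (\<bar>\<phi> (x + z) - \<phi> x\<bar> powr p) \<partial>lborel) \<le> (\<integral>\<^sup>+x. \<integral>\<^sup>+t. ennreal (?I t * ?g t x powr p) \<partial>lborel \<partial>lborel)"
  proof (rule nn_integral_mono)
    fix x
    have "ennreal (\<bar>\<phi> (x + z) - \<phi> x\<bar> powr p) \<le> ennreal (\<integral>t. ?I t * ?g t x powr p \<partial>lborel)"
      using pt by (intro ennreal_leI)
    also have "\<dots> = (\<integral>\<^sup>+t. ennreal (?I t * ?g t x powr p) \<partial>lborel)"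
      by (rule nn_integral_eq_integral[symmetric, OF kint[OF cg(2)]]) auto
    finally show "ennreal (\<bar>\<phi> (x + z) - \<phi> x\<bar> powr p) \<le> (\<integral>\<^sup>+t. ennreal (?I t * ?g t x powr p) \<partial>lborel)" .
  qed
  also have "\<dots> = (\<integral>\<^sup>+t. \<integral>\<^sup>+x. ennreal (?I t * ?g t x powr p) \<partial>lborel \<partial>lborel)"
    using lborel_pair.Fubini[OF M] by simp
  also have "\<dots> = (\<integral>\<^sup>+t. ennreal (?I t) * ennreal (norm z powr p * ?P) \<partial>lborel)"
  proof (rule nn_integral_cong)
    fix t :: real
    have "(\<integral>\<^sup>+x. ennreal (?I t * ?g t x powr p) \<partial>lborel) = (\<integral>\<^sup>+x. ennreal (?I t * norm z powr p) * ennreal (norm (\<phi>' (t *\<^sub>R z + x)) powr p) \<partial>lborel)"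
      by (auto simp: ennreal_mult[symmetric] powr_mult add.commute mult.assoc intro!: nn_integral_cong)
    also have "\<dots> = ennreal (?I t * norm z powr p) * (\<integral>\<^sup>+x. ennreal (norm (\<phi>' (t *\<^sub>R z + x)) powr p) \<partial>lborel)"
      by (rule nn_integral_cmult) measurable
    also have "(\<integral>\<^sup>+x. ennreal (norm (\<phi>' (t *\<^sub>R z + x)) powr p) \<partial>lborel) = (\<integral>\<^sup>+x. ennreal (norm (\<phi>' x) powr p) \<partial>lborel)"
      by (rule nn_integral_lborel_translation) measurable
    also have "\<dots> = ennreal ?P"
      by (rule nn_integral_eq_integral[OF ipow]) auto
    finally show "(\<integral>\<^sup>+x. ennreal (?I t * ?g t x powr p) \<partial>lborel) = ennreal (?I t) * ennreal (norm z powr p * ?P)"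
      by (simp add: ennreal_mult mult.assoc)
  qed
  also have "\<dots> = ennreal (norm z powr p * ?P)"
    by (subst nn_integral_multc) (auto simp: ennreal_indicator)
  also have "?P = (\<integral>x. norm (\<phi>' x) powr p \<partial>lebesgue)"
    by (rule integral_completion[symmetric]) measurable
  finally show ?thesis .
qed

section \<open>Restricted integrals and the pairing of conjugate exponents\<close>

lemma integral_lebesgue_on_subset:
  fixes f :: "'a::euclidean_space \<Rightarrow> 'b::euclidean_space"
  assumes "B \<in> sets lebesgue" "S \<in> sets lebesgue" "B \<subseteq> S" "\<And>x. x \<in> S \<Longrightarrow> x \<notin> B \<Longrightarrow> f x = 0"
  shows "integral\<^sup>L (lebesgue_on S) f = integral\<^sup>L (lebesgue_on B) f"
proof -
  have "(\<lambda>x. indicator S x *\<^sub>R f x) = (\<lambda>x. indicator B x *\<^sub>R f x)"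
    using assms(3,4) by (intro ext) (auto split: split_indicator)
  then show ?thesis using assms by (simp add: integral_restrict_space)
qed

lemma integrable_lebesgue_on_bounded_mult:
  fixes f :: "'x \<Rightarrow> 'b::euclidean_space"
  assumes "integrable M f" "a \<in> borel_measurable M" "\<And>x. x \<in> space M \<Longrightarrow> \<bar>a x\<bar> \<le> C"
  shows "integrable M (\<lambda>x. a x *\<^sub>R f x)"
proof (rule Bochner_Integration.integrable_bound)
  show "integrable M (\<lambda>x. C *\<^sub>R f x)" using assms by auto
  show "AE x in M. norm (a x *\<^sub>R f x) \<le> norm (C *\<^sub>R f x)"
    using assms(3) by (intro AE_I2) (auto intro!: mult_right_mono intro: order_trans[OF _ abs_ge_self])
qed (use assms in auto)

lemma integrable_norm_mult:
  fixes F :: "'x \<Rightarrow> 'b::euclidean_space" and G :: "'x \<Rightarrow> 'c::euclidean_space"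
  assumes p: "1 < p" and m: "F \<in> borel_measurable M" "G \<in> borel_measurable M"
    and i: "integrable M (\<lambda>x. norm (F x) powr (p / (p - 1)))" "integrable M (\<lambda>x. norm (G x) powr p)"
  shows "integrable M (\<lambda>x. norm (F x) * norm (G x))"
proof -
  obtain C where C: "0 < C" "\<And>a b. 0 \<le> a \<Longrightarrow> 0 \<le> b \<Longrightarrow> a * b \<le> 1 * a powr (p / (p - 1)) + C * b powr p"
    using young_scaled[OF p, of 1] by auto
  show ?thesis
  proof (rule Bochner_Integration.integrable_bound)
    show "integrable M (\<lambda>x. norm (F x) powr (p / (p - 1)) + C * norm (G x) powr p)" using i by auto
    show "AE x in M. norm (norm (F x) * norm (G x)) \<le> norm (norm (F x) powr (p / (p - 1)) + C * norm (G x) powr p)"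
      using C(2)[of "norm (F _)" "norm (G _)"] by (intro AE_I2) (auto intro: order_trans[OF _ abs_ge_self])
  qed (use m in measurable)
qed

text \<open>Young's inequality with a small weight on the fixed factor \<open>F\<close> leaves an
  error of at most half the tolerance; with that weight fixed, the contribution of
  \<open>E n\<close> tends to zero.\<close>

lemma integral_norm_mult_tendsto_0:
  fixes F :: "'x \<Rightarrow> 'b::euclidean_space" and E :: "nat \<Rightarrow> 'x \<Rightarrow> 'c::euclidean_space"
  assumes p: "1 < p" and m: "F \<in> borel_measurable M" "\<And>n. E n \<in> borel_measurable M"
    and i: "integrable M (\<lambda>x. norm (F x) powr (p / (p - 1)))" "\<And>n. integrable M (\<lambda>x. norm (E n x) powr p)"
    and lim: "(\<lambda>n. \<integral>x. norm (E n x) powr p \<partial>M) \<longlonglongrightarrow> 0"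
  shows "(\<lambda>n. \<integral>x. norm (F x) * norm (E n x) \<partial>M) \<longlonglongrightarrow> 0"
proof (rule LIMSEQ_I)
  fix e :: real assume e: "0 < e"
  define I where "I = (\<integral>x. norm (F x) powr (p / (p - 1)) \<partial>M)"
  have I: "0 \<le> I" unfolding I_def by (intro integral_nonneg_AE) auto
  define \<tau> where "\<tau> = e / (2 * (I + 1))"
  have \<tau>: "0 < \<tau>" "\<tau> * I \<le> e / 2" using e I by (auto simp: \<tau>_def field_simps)
  obtain C where C: "0 < C" "\<And>a b. 0 \<le> a \<Longrightarrow> 0 \<le> b \<Longrightarrow> a * b \<le> \<tau> * a powr (p / (p - 1)) + C * b powr p"
    using young_scaled[OF p \<tau>(1)] by auto
  have "eventually (\<lambda>n. (\<integral>x. norm (E n x) powr p \<partial>M) < e / (2 * C)) sequentially"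
    using lim by (rule order_tendstoD(2)) (use e C in simp)
  then obtain N where N: "\<And>n. n \<ge> N \<Longrightarrow> (\<integral>x. norm (E n x) powr p \<partial>M) < e / (2 * C)"
    by (auto simp: eventually_sequentially)
  show "\<exists>no. \<forall>n\<ge>no. norm ((\<integral>x. norm (F x) * norm (E n x) \<partial>M) - 0) < e"
  proof (intro exI allI impI)
    fix n assume n: "N \<le> n"
    have "(\<integral>x. norm (F x) * norm (E n x) \<partial>M) \<le> (\<integral>x. \<tau> * norm (F x) powr (p / (p - 1)) + C * norm (E n x) powr p \<partial>M)"
      by (rule integral_mono[OF integrable_norm_mult[OF p m i]]) (use i C(2) in auto)
    also have "\<dots> = \<tau> * I + C * (\<integral>x. norm (E n x) powr p \<partial>M)" using i by (simp add: I_def)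
    also have "\<dots> < e / 2 + C * (e / (2 * C))"
      using \<tau> C N[OF n] by (intro add_le_less_mono mult_strict_left_mono) auto
    also have "\<dots> = e" using C by simp
    finally have "(\<integral>x. norm (F x) * norm (E n x) \<partial>M) < e" .
    moreover have "0 \<le> (\<integral>x. norm (F x) * norm (E n x) \<partial>M)" by (intro integral_nonneg_AE) auto
    ultimately show "norm ((\<integral>x. norm (F x) * norm (E n x) \<partial>M) - 0) < e" by simp
  qed
qed

text \<open>If \<open>E = {\<phi> \<noteq> 0}\<close> fills at most half of a ball of radius \<open>\<rho>\<close>, then for every \<open>x\<close> at least
  half of the translations \<open>z\<close> in that ball satisfy \<open>\<phi> (x + z) = 0\<close>; averaging over \<open>z\<close> turns the
  bound on differences into a bound on \<open>\<phi>\<close> itself.\<close>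

lemma faber_krahn_translation:
  fixes \<phi> :: "'a::euclidean_space \<Rightarrow> real"
  assumes p: "0 < p" and [measurable]: "\<phi> \<in> borel_measurable borel" and \<rho>: "0 < \<rho>" and D: "0 \<le> D"
    and E: "2 * emeasure lborel {x. \<phi> x \<noteq> 0} \<le> emeasure lborel (ball (0::'a) \<rho>)"
    and le: "\<And>z. (\<integral>\<^sup>+x. ennreal (\<bar>\<phi> (x + z) - \<phi> x\<bar> powr p) \<partial>lborel) \<le> ennreal (norm z powr p * D)"
  shows "(\<integral>\<^sup>+x. ennreal (\<bar>\<phi> x\<bar> powr p) \<partial>lborel) \<le> ennreal (2 * \<rho> powr p * D)"
proof -
  let ?B = "ball (0::'a) \<rho>"
  let ?d = "\<lambda>x z. ennreal (\<bar>\<phi> (x + z) - \<phi> x\<bar> powr p)"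
  let ?m = "\<lambda>x. emeasure lborel {z \<in> ?B. \<phi> (x + z) = 0}"
  let ?e = "emeasure lborel {x. \<phi> x \<noteq> 0}"
  let ?N = "\<integral>\<^sup>+x. ennreal (\<bar>\<phi> x\<bar> powr p) \<partial>lborel"
  define b where "b = measure lborel ?B"
  have b: "emeasure lborel ?B = ennreal b" "0 < b"
    using content_ball_pos[OF \<rho>, of "0::'a"] emeasure_lborel_ball_finite[of "0::'a" \<rho>]
    by (auto simp: b_def emeasure_eq_ennreal_measure)
  have M: "(\<lambda>(z, x). indicator ?B z * ?d x z) \<in> borel_measurable (lborel \<Otimes>\<^sub>M lborel)"
  proof -
    have [measurable]: "?B \<in> sets borel" by simp
    have "(\<lambda>x::'a \<times> 'a. \<phi> (snd x + fst x)) \<in> borel_measurable (lborel \<Otimes>\<^sub>M lborel)"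
      "(\<lambda>x::'a \<times> 'a. \<phi> (snd x)) \<in> borel_measurable (lborel \<Otimes>\<^sub>M lborel)"
      by measurable
    then show ?thesis unfolding split_beta' by measurable
  qed
  \<comment> \<open>For fixed \<open>x\<close> the translations with
    \<open>\<phi> (x + z) \<noteq> 0\<close> form a shifted copy of the set where
    \<open>\<phi>\<close> does not vanish, hence fill at most half of the ball. Both measures are
    finite, which justifies the subtraction in real numbers.\<close>
  have half: "ennreal (b / 2) \<le> ?m x" for x
  proof -
    have sh: "emeasure lborel {z. \<phi> (x + z) \<noteq> 0} = ?e"
      using nn_integral_lborel_translation[of "indicator {x. \<phi> x \<noteq> 0}" x]
      by (simp add: indicator_def[abs_def] flip: nn_integral_indicator)
    have "ennreal b \<le> emeasure lborel ({z \<in> ?B. \<phi> (x + z) = 0} \<union> {z. \<phi> (x + z) \<noteq> 0})"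
      unfolding b(1)[symmetric] by (intro emeasure_mono) auto
    also have "\<dots> \<le> ?m x + ?e"
      unfolding sh[symmetric] by (intro emeasure_subadditive) measurable
    finally have *: "ennreal b \<le> ?m x + ?e" .
    have fin: "?m x \<le> ennreal b"
      unfolding b(1)[symmetric] by (intro emeasure_mono) auto
    obtain a where a: "?m x = ennreal a" "0 \<le> a"
      using fin by (cases "?m x") (auto simp: top_unique)
    obtain c where c: "?e = ennreal c" "0 \<le> c" "2 * c \<le> b"
    proof (cases "?e")
      case (real c)
      have "ennreal (2 * c) \<le> ennreal b" using E real b by (simp add: ennreal_mult)
      then show ?thesis using that[of c] real b by (simp add: ennreal_le_iff)
    qed (use E b in \<open>auto simp: ennreal_mult_top top_unique\<close>)
    have "ennreal b \<le> ennreal (a + c)" using * a c by simp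
    then have "b \<le> a + c" using a c by (subst (asm) ennreal_le_iff) auto
    then have "b / 2 \<le> a" using c by simp
    then show ?thesis unfolding a(1) by (rule ennreal_leI)
  qed
  have "?N * ennreal (b / 2) = (\<integral>\<^sup>+x. ennreal (\<bar>\<phi> x\<bar> powr p) * ennreal (b / 2) \<partial>lborel)"
    by (rule nn_integral_multc[symmetric]) measurable
  also have "\<dots> \<le> (\<integral>\<^sup>+x. \<integral>\<^sup>+z. indicator ?B z * ?d x z \<partial>lborel \<partial>lborel)"
  proof (rule nn_integral_mono)
    fix x
    have "ennreal (\<bar>\<phi> x\<bar> powr p) * ennreal (b / 2) \<le> ennreal (\<bar>\<phi> x\<bar> powr p) * ?m x"
      by (intro mult_left_mono half) auto
    also have "\<dots> = (\<integral>\<^sup>+z. ennreal (\<bar>\<phi> x\<bar> powr p) * indicator {z \<in> ?B. \<phi> (x + z) = 0} z \<partial>lborel)"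
      by (rule nn_integral_cmult_indicator[symmetric]) measurable
    \<comment> \<open>Where \<open>\<phi> (x + z) = 0\<close>, the difference has the absolute value
      \<open>\<bar>\<phi> x\<bar>\<close>.\<close>
    also have "\<dots> \<le> (\<integral>\<^sup>+z. indicator ?B z * ?d x z \<partial>lborel)"
      by (intro nn_integral_mono) (auto simp: indicator_def)
    finally show "ennreal (\<bar>\<phi> x\<bar> powr p) * ennreal (b / 2) \<le> (\<integral>\<^sup>+z. indicator ?B z * ?d x z \<partial>lborel)" .
  qed
  also have "\<dots> = (\<integral>\<^sup>+z. \<integral>\<^sup>+x. indicator ?B z * ?d x z \<partial>lborel \<partial>lborel)"
    using lborel_pair.Fubini[OF M] by simp
  also have "\<dots> \<le> (\<integral>\<^sup>+z. indicator ?B z * ennreal (\<rho> powr p * D) \<partial>lborel)"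
  proof (rule nn_integral_mono)
    fix z :: 'a
    have "(\<integral>\<^sup>+x. indicator ?B z * ?d x z \<partial>lborel)
        = indicator ?B z * (\<integral>\<^sup>+x. ?d x z \<partial>lborel)"
      by (rule nn_integral_cmult) measurable
    also have "\<dots> \<le> indicator ?B z * ennreal (norm z powr p * D)"
      by (intro mult_left_mono le) auto
    also have "\<dots> \<le> indicator ?B z * ennreal (\<rho> powr p * D)"
      using p D by (auto simp: indicator_def intro!: ennreal_leI mult_right_mono powr_mono2)
    finally show "(\<integral>\<^sup>+x. indicator ?B z * ?d x z \<partial>lborel) \<le> indicator ?B z * ennreal (\<rho> powr p * D)" .
  qed
  also have "\<dots> = ennreal b * ennreal (\<rho> powr p * D)"
    by (subst nn_integral_multc) (auto simp: b intro!: borel_measurable_indicator)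
  also have "\<dots> = ennreal (2 * \<rho> powr p * D) * ennreal (b / 2)"
    using b D by (simp add: ennreal_mult[symmetric])
  finally have "?N * ennreal (b / 2) \<le> ennreal (2 * \<rho> powr p * D) * ennreal (b / 2)" .
  then show ?thesis
    using b by (subst (asm) ennreal_mult_le_mult_iff[of "ennreal (b/2)", unfolded mult.commute[of "ennreal (b/2)"]]) (auto simp: ennreal_eq_0_iff)
qed

section \<open>Testing with functions of a Sobolev function\<close>

text \<open>Estimates live on the ball of radius \<open>R\<close>; the margin up to
  \<open>R'\<close> leaves room for mollification. The upper bound \<open>L\<close> is a parameter,
  to be instantiated by the scale that should appear in the estimate.\<close>

locale sobolev_ball =
  fixes \<Omega> :: "'a::euclidean_space set" and p :: real and w G x0 and R R' L :: real
  assumes open_\<Omega>: "open \<Omega>" and p: "1 < p" and R: "0 < R" "R < R'" and ball_\<Omega>: "cball x0 R' \<subseteq> \<Omega>"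
    and w_cont: "continuous_on \<Omega> w" and w_W1p: "W1p_loc p \<Omega> w G"
    and w_nonneg: "\<And>x. x \<in> \<Omega> \<Longrightarrow> 0 \<le> w x" and w_le: "\<And>x. x \<in> cball x0 R' \<Longrightarrow> w x \<le> L"
begin

abbreviation B where "B \<equiv> lebesgue_on (cball x0 R)"

lemma cball_subset: "cball x0 R \<subseteq> cball x0 R'" "cball x0 R \<subseteq> \<Omega>" "x0 \<in> \<Omega>"
  using R ball_\<Omega> by auto

lemma L_nonneg: "0 \<le> L"
  using w_nonneg[of x0] w_le[of x0] cball_subset R by auto

lemma w_range: "x \<in> cball x0 R \<Longrightarrow> 0 \<le> w x \<and> w x \<le> L"
  using w_nonneg w_le cball_subset by blast

lemma Lp_loc_ball:
  fixes f :: "'a \<Rightarrow> 'b::euclidean_space"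
  assumes "Lp_loc q \<Omega> f" "0 < r" "r \<le> R'"
  shows "f \<in> borel_measurable (lebesgue_on (cball x0 r))" "integrable (lebesgue_on (cball x0 r)) (\<lambda>x. norm (f x) powr q)"
proof -
  have "cball x0 r \<subseteq> \<Omega>" using assms(3) ball_\<Omega> by auto
  then show "f \<in> borel_measurable (lebesgue_on (cball x0 r))" "integrable (lebesgue_on (cball x0 r)) (\<lambda>x. norm (f x) powr q)"
    using assms unfolding Lp_loc_def by (auto intro: measurable_restrict_mono)
qed

lemma G_ball:
  shows "G \<in> borel_measurable B" "integrable B (\<lambda>x. norm (G x) powr p)"
  using Lp_loc_ball[of p G R] w_W1p R by (auto simp: W1p_loc_def)

lemma w_measurable: "w \<in> borel_measurable B"
  using Lp_loc_ball[of p w R] w_W1p R by (auto simp: W1p_loc_def)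

text \<open>The approximations are mollifications. As means they keep the range from 0 to
  \<open>L\<close>, so a profile applied to them has to be controlled on that interval only.\<close>

lemma smooth_approximation:
  obtains v V where "\<And>n x. GDERIV (v n) x :> V n x" "\<And>n::nat. continuous_on UNIV (V n)"
    "\<And>n x. 0 \<le> v n x" "\<And>n x. v n x \<le> L" "\<And>x. x \<in> cball x0 R \<Longrightarrow> (\<lambda>n. v n x) \<longlonglongrightarrow> w x"
    "\<And>n. integrable B (\<lambda>x. norm (V n x - G x) powr p)"
    "(\<lambda>n. \<integral>x. norm (V n x - G x) powr p \<partial>B) \<longlonglongrightarrow> 0"
proof -
  let ?K = "cball x0 R'"
  have Km: "?K \<in> sets lebesgue" and \<Omega>m: "\<Omega> \<in> sets lebesgue" using open_\<Omega> by auto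
  have wg: "has_weak_gradient \<Omega> w G" and GL: "Lp_loc p \<Omega> G" using w_W1p by (auto simp: W1p_loc_def)
  then have GL1: "Lp_loc 1 \<Omega> G" by (auto simp: has_weak_gradient_def)
  \<comment> \<open>Extension by zero produces functions integrable over the whole space. With
    mollification radii of at most \<open>R' - R\<close>, points of the inner ball see only original
    values.\<close>
  define wt where "wt x = indicator ?K x * w x" for x
  define Gt where "Gt x = indicator ?K x *\<^sub>R G x" for x
  have wt_b: "0 \<le> wt x" "wt x \<le> L" for x
    using w_nonneg[of x] w_le[of x] ball_\<Omega> L_nonneg by (auto simp: wt_def indicator_def)
  have wt_i: "integrable lebesgue wt"
    using integrable_continuous_compact[OF compact_cball continuous_on_subset[OF w_cont ball_\<Omega>]]
    by (subst (asm) integrable_restrict_space) (auto simp: wt_def[abs_def])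
  have GR': "G \<in> borel_measurable (lebesgue_on ?K)" "integrable (lebesgue_on ?K) (\<lambda>x. norm (G x) powr p)"
    "integrable (lebesgue_on ?K) (\<lambda>x. norm (G x))"
    using Lp_loc_ball[OF GL, of R'] Lp_loc_ball[OF GL1, of R'] R by auto
  have "integrable (lebesgue_on ?K) G"
    using GR'(1,3) by (subst (asm) integrable_norm_iff) auto
  then have Gt_i: "integrable lebesgue Gt"
    by (subst (asm) integrable_restrict_space) (auto simp: Gt_def[abs_def])
  have "norm (Gt x) powr p = indicator ?K x *\<^sub>R norm (G x) powr p" for x
    using p by (auto simp: Gt_def indicator_def)
  then have Gt_p: "integrable lebesgue (\<lambda>x. norm (Gt x) powr p)"
    using GR'(2) by (subst (asm) integrable_restrict_space) auto
  have Gt_0: "Gt x = 0" if "x \<notin> ?K" for x using that by (simp add: Gt_def)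
  define r where "r n = (R' - R) / real (Suc n)" for n
  have r: "0 < r n" "r n \<le> R' - R" for n
    using R divide_left_mono[of 1 "real (Suc n)" "R' - R"] by (auto simp: r_def)
  have "(\<lambda>n. (R' - R) * (1 / real (Suc n))) \<longlonglongrightarrow> (R' - R) * 0"
    by (intro tendsto_intros LIMSEQ_Suc[OF lim_1_over_n])
  then have r0: "r \<longlonglongrightarrow> 0" by (simp add: r_def[abs_def])
  \<comment> \<open>Mollification commutes with the weak gradient: the kernel centred at
    \<open>x\<close> is itself an admissible test function, because its support stays inside
    \<open>\<Omega>\<close>.\<close>
  have eq: "mollify_grad (r n) wt x = mollify (r n) Gt x" if x: "x \<in> cball x0 R" for n x
  proof -
    have sub: "ball x (r n) \<subseteq> ?K" "cball x (r n) \<subseteq> ?K"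
    proof -
      show "cball x (r n) \<subseteq> ?K"
      proof
        fix y assume "y \<in> cball x (r n)"
        then show "y \<in> ?K" using x r(2)[of n] dist_triangle[of x0 y x] by (simp add: dist_commute)
      qed
      then show "ball x (r n) \<subseteq> ?K" using ball_subset_cball by blast
    qed
    have "compactly_supported_in \<Omega> (mollifier (r n) x)"
      unfolding compactly_supported_in_def
      by (rule exI[of _ "cball x (r n)"]) (use sub ball_\<Omega> in \<open>auto intro!: mollifier_eq_0[OF r(1)]\<close>)
    then have *: "(LINT y|lebesgue_on \<Omega>. w y *\<^sub>R mollifier_grad (r n) x y) = - (LINT y|lebesgue_on \<Omega>. mollifier (r n) x y *\<^sub>R G y)"
      using wg GDERIV_mollifier[of "r n" x] continuous_mollifier_grad[of UNIV "r n" x] unfolding has_weak_gradient_def by blast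
    have out: "mollifier (r n) x y = 0" "mollifier_grad (r n) x y = 0" if "y \<notin> ?K" for y
    proof -
      have "y \<notin> ball x (r n)" using that sub by blast
      then show "mollifier (r n) x y = 0" "mollifier_grad (r n) x y = 0"
        using mollifier_eq_0[OF r(1)] mollifier_grad_eq_0[OF r(1)] by blast+
    qed
    have "(LINT y|lebesgue_on \<Omega>. w y *\<^sub>R mollifier_grad (r n) x y) = (LINT y|lebesgue_on \<Omega>. wt y *\<^sub>R mollifier_grad (r n) x y)"
      by (rule Bochner_Integration.integral_cong) (use out in \<open>auto simp: wt_def indicator_def\<close>)
    also have "\<dots> = (LINT y|lebesgue. wt y *\<^sub>R mollifier_grad (r n) x y)"
      by (rule integral_lebesgue_on_vanishing[OF \<Omega>m]) (use ball_\<Omega> in \<open>auto simp: wt_def indicator_def\<close>)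
    also have "\<dots> = - mollify_grad (r n) wt x" by (simp add: mollify_grad_def)
    finally have l: "(LINT y|lebesgue_on \<Omega>. w y *\<^sub>R mollifier_grad (r n) x y) = - mollify_grad (r n) wt x" .
    have "(LINT y|lebesgue_on \<Omega>. mollifier (r n) x y *\<^sub>R G y) = (LINT y|lebesgue_on \<Omega>. mollifier (r n) x y *\<^sub>R Gt y)"
      by (rule Bochner_Integration.integral_cong) (use out in \<open>auto simp: Gt_def indicator_def\<close>)
    also have "\<dots> = mollify (r n) Gt x"
      unfolding mollify_def by (rule integral_lebesgue_on_vanishing[OF \<Omega>m]) (use ball_\<Omega> in \<open>auto simp: Gt_def indicator_def\<close>)
    finally show ?thesis using * l by simp
  qed
  have eqG: "norm (mollify_grad (r n) wt x - G x) = norm (mollify (r n) Gt x - Gt x)" if "x \<in> cball x0 R" for n x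
    using eq[OF that] that cball_subset by (simp add: Gt_def indicator_def subset_iff)
  note conv = mollify_Lp_tendsto[OF p R r(1) r0 Gt_i Gt_p Gt_0]
  show ?thesis
  proof (rule that[of "\<lambda>n. mollify (r n) wt" "\<lambda>n. mollify_grad (r n) wt"])
    show "GDERIV (mollify (r n) wt) x :> mollify_grad (r n) wt x" for n x
      by (rule GDERIV_mollify[OF r(1) wt_i])
    show "continuous_on UNIV (mollify_grad (r n) wt)" for n
      by (rule continuous_mollify_grad[OF r(1) wt_i])
    show "0 \<le> mollify (r n) wt x" for n x
      by (rule mollify_nonneg[OF r(1) wt_b(1)])
    show "mollify (r n) wt x \<le> L" for n x
    proof -
      \<comment> \<open>Measured from the midpoint, the range from 0 to \<open>L\<close> becomes a
        single distance bound, which means inherit.\<close>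
      have "norm (mollify (r n) wt x - L / 2) \<le> L / 2"
      proof (rule norm_mollify_diff_le[OF r(1) wt_i])
        fix y
        have "- (L / 2) \<le> wt y - L / 2" "wt y - L / 2 \<le> L / 2" using wt_b[of y] by auto
        then show "norm (wt y - L / 2) \<le> L / 2" unfolding real_norm_def abs_le_iff by linarith
      qed
      then show ?thesis unfolding real_norm_def abs_le_iff by linarith
    qed
    show "(\<lambda>n. mollify (r n) wt x) \<longlonglongrightarrow> w x" if "x \<in> cball x0 R" for x
    proof -
      have x: "x \<in> ball x0 R'" using that R by auto
      then have "x \<in> \<Omega>" using ball_\<Omega> by auto
      then have "isCont w x" using w_cont open_\<Omega> by (simp add: continuous_on_eq_continuous_at)
      then have "isCont wt x"
        using eventually_nhds_in_open[OF open_ball x]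
        by (subst isCont_cong[where g=w]) (auto elim!: eventually_mono simp: wt_def indicator_def)
      then have "(\<lambda>n. mollify (r n) wt x) \<longlonglongrightarrow> wt x" by (rule mollify_tendsto[OF r(1) r0 wt_i])
      then show ?thesis using x by (simp add: wt_def)
    qed
    show "integrable B (\<lambda>x. norm (mollify_grad (r n) wt x - G x) powr p)" for n
      using conv(1)[where n=n] by (rule iffD1[OF Bochner_Integration.integrable_cong, rotated -1]) (auto simp: eqG)
    have "(\<integral>x. norm (mollify_grad (r n) wt x - G x) powr p \<partial>B) = (\<integral>x. norm (mollify (r n) Gt x - Gt x) powr p \<partial>B)" for n
      by (rule Bochner_Integration.integral_cong) (auto simp: eqG)
    then show "(\<lambda>n. \<integral>x. norm (mollify_grad (r n) wt x - G x) powr p \<partial>B) \<longlonglongrightarrow> 0"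
      using conv(2) by simp
  qed
qed

end

context sobolev_ball begin

lemma integrable_B_continuous: "continuous_on UNIV (f::'a \<Rightarrow> 'b::euclidean_space) \<Longrightarrow> integrable B f"
  by (rule integrable_continuous_compact) (auto intro: continuous_on_subset)

lemma measurable_B_continuous: "continuous_on UNIV (f::'a \<Rightarrow> 'b::euclidean_space) \<Longrightarrow> f \<in> borel_measurable B"
  by (rule borel_measurable_integrable[OF integrable_B_continuous])

lemma measurable_B_compose:
  fixes g :: "real \<Rightarrow> real"
  shows "continuous_on UNIV g \<Longrightarrow> (\<lambda>x. g (w x)) \<in> borel_measurable B"
  using w_measurable borel_measurable_continuous_onI by (rule measurable_compose)

end

section \<open>Test functions formed from a cutoff and a profile\<close>

locale test_profile = sobolev_ball \<Omega> p w G x0 R R' L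
  for \<Omega> :: "'a::euclidean_space set" and p w G x0 R R' L +
  fixes \<zeta> \<zeta>' and g g' :: "real \<Rightarrow> real"
  assumes \<zeta>: "\<And>x. GDERIV \<zeta> x :> \<zeta>' x" and \<zeta>'_cont: "continuous_on UNIV \<zeta>'"
    and \<zeta>_nonneg: "\<And>x. 0 \<le> \<zeta> x" and \<zeta>_0: "\<And>x. x \<notin> cball x0 R \<Longrightarrow> \<zeta> x = 0"
    and g: "\<And>s. DERIV g s :> g' s" and g'_cont: "continuous_on UNIV g'"
    and g_nonneg: "\<And>s. 0 \<le> s \<Longrightarrow> 0 \<le> g s"
begin

lemma \<zeta>_cont: "continuous_on A \<zeta>"
  by (rule GDERIV_imp_continuous_on[OF \<zeta>])

lemma g_cont: "continuous_on A g"
  using g DERIV_isCont by (auto intro!: continuous_at_imp_continuous_on)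

lemma \<zeta>'_0: "x \<notin> cball x0 R \<Longrightarrow> \<zeta>' x = 0"
  by (rule GDERIV_vanishing_outside_eq_0[OF \<zeta> compact_cball \<zeta>_0])

lemma uniform_bounds:
  obtains C where "0 < C" "\<And>x. \<bar>\<zeta> x\<bar> \<le> C" "\<And>x. norm (\<zeta>' x) \<le> C"
    "\<And>s. 0 \<le> s \<Longrightarrow> s \<le> L \<Longrightarrow> \<bar>g s\<bar> \<le> C" "\<And>s. 0 \<le> s \<Longrightarrow> s \<le> L \<Longrightarrow> \<bar>g' s\<bar> \<le> C"
proof -
  have "\<exists>C. \<forall>x. norm (\<zeta> x) \<le> C"
    using continuous_compact_support_bounded[OF \<zeta>_cont compact_cball \<zeta>_0] by blast
  then obtain C1 where 1: "\<And>x. \<bar>\<zeta> x\<bar> \<le> C1" by auto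
  have "\<exists>C. \<forall>x. norm (\<zeta>' x) \<le> C"
    using continuous_compact_support_bounded[OF \<zeta>'_cont compact_cball \<zeta>'_0] by blast
  then obtain C2 where 2: "\<And>x. norm (\<zeta>' x) \<le> C2" by auto
  have "bounded (g ` {0..L})" "bounded (g' ` {0..L})"
    using g_cont continuous_on_subset[OF g'_cont] by (auto intro!: compact_imp_bounded compact_continuous_image)
  then obtain C3 C4 where 3: "\<And>s. 0 \<le> s \<Longrightarrow> s \<le> L \<Longrightarrow> \<bar>g s\<bar> \<le> C3" and 4: "\<And>s. 0 \<le> s \<Longrightarrow> s \<le> L \<Longrightarrow> \<bar>g' s\<bar> \<le> C4"
    unfolding bounded_iff by (metis atLeastAtMost_iff imageI real_norm_def)
  show ?thesis
  proof (rule that[of "\<bar>C1\<bar> + \<bar>C2\<bar> + \<bar>C3\<bar> + \<bar>C4\<bar> + 1"])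
    let ?C = "\<bar>C1\<bar> + \<bar>C2\<bar> + \<bar>C3\<bar> + \<bar>C4\<bar> + 1"
    show "0 < ?C" by linarith
    show "\<bar>\<zeta> x\<bar> \<le> ?C" for x using 1[of x] by linarith
    show "norm (\<zeta>' x) \<le> ?C" for x using 2[of x] by linarith
    show "\<bar>g s\<bar> \<le> ?C" if "0 \<le> s" "s \<le> L" for s using 3[OF that] by linarith
    show "\<bar>g' s\<bar> \<le> ?C" if "0 \<le> s" "s \<le> L" for s using 4[OF that] by linarith
  qed
qed

definition \<phi> :: "'a \<Rightarrow> real" where "\<phi> x = \<zeta> x * g (w x)"

text \<open>What product and chain rule would give as the gradient of \<open>\<phi>\<close>. It is
  never shown to be a weak gradient; it is used only as the L^p limit of gradients of C1
  functions.\<close>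

definition H :: "'a \<Rightarrow> 'a" where "H x = (\<zeta> x * g' (w x)) *\<^sub>R G x + g (w x) *\<^sub>R \<zeta>' x"

lemma C1_approximation:
  obtains \<phi>n Hn C where
    "\<And>n x. GDERIV (\<phi>n n) x :> Hn n x" "\<And>n::nat. continuous_on UNIV (Hn n)"
    "\<And>n x. 0 \<le> \<phi>n n x" "\<And>n x. x \<notin> cball x0 R \<Longrightarrow> \<phi>n n x = 0" "\<And>n x. \<phi>n n x \<le> C"
    "\<And>x. (\<lambda>n. \<phi>n n x) \<longlonglongrightarrow> \<phi> x"
    "integrable B (\<lambda>x. norm (H x) powr p)"
    "\<And>n. integrable B (\<lambda>x. norm (Hn n x - H x) powr p)"
    "(\<lambda>n. \<integral>x. norm (Hn n x - H x) powr p \<partial>B) \<longlonglongrightarrow> 0"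
proof (rule smooth_approximation)
  fix v :: "nat \<Rightarrow> 'a \<Rightarrow> real" and V
  assume v: "\<And>n x. GDERIV (v n) x :> V n x" "\<And>n. continuous_on UNIV (V n)"
    "\<And>n x. 0 \<le> v n x" "\<And>n x. v n x \<le> L" "\<And>x. x \<in> cball x0 R \<Longrightarrow> (\<lambda>n. v n x) \<longlonglongrightarrow> w x"
    and Vi: "\<And>n. integrable B (\<lambda>x. norm (V n x - G x) powr p)"
    and V0: "(\<lambda>n. \<integral>x. norm (V n x - G x) powr p \<partial>B) \<longlonglongrightarrow> 0"
  obtain C where C: "0 < C" "\<And>x. \<bar>\<zeta> x\<bar> \<le> C" "\<And>x. norm (\<zeta>' x) \<le> C"
    "\<And>s. 0 \<le> s \<Longrightarrow> s \<le> L \<Longrightarrow> \<bar>g s\<bar> \<le> C" "\<And>s. 0 \<le> s \<Longrightarrow> s \<le> L \<Longrightarrow> \<bar>g' s\<bar> \<le> C"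
    by (rule uniform_bounds) (rule that; blast)
  define \<phi>n where "\<phi>n n x = \<zeta> x * g (v n x)" for n x
  define Hn where "Hn n x = (\<zeta> x * g' (v n x)) *\<^sub>R V n x + g (v n x) *\<^sub>R \<zeta>' x" for n x
  have vc: "continuous_on A (v n)" for n A by (rule GDERIV_imp_continuous_on[OF v(1)])
  have cg: "continuous_on UNIV (\<lambda>x. g (v n x))" "continuous_on UNIV (\<lambda>x. g' (v n x))" for n
    by (auto intro: continuous_on_compose2[OF g_cont vc] continuous_on_compose2[OF g'_cont vc])
  have p0: "0 < p" using p by simp
  have Gm: "G \<in> borel_measurable B" by (rule G_ball)
  have \<zeta>m: "\<zeta> \<in> borel_measurable B" and \<zeta>'m: "\<zeta>' \<in> borel_measurable B"
    by (rule measurable_B_continuous[OF \<zeta>_cont], rule measurable_B_continuous[OF \<zeta>'_cont])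
  have gm: "(\<lambda>x. g (w x)) \<in> borel_measurable B" "(\<lambda>x. g' (w x)) \<in> borel_measurable B"
    by (rule measurable_B_compose[OF g_cont], rule measurable_B_compose[OF g'_cont])
  have gnm: "(\<lambda>x. g (v n x)) \<in> borel_measurable B" "(\<lambda>x. g' (v n x)) \<in> borel_measurable B" "V n \<in> borel_measurable B" for n
    by (rule measurable_B_continuous[OF cg(1)], rule measurable_B_continuous[OF cg(2)], rule measurable_B_continuous[OF v(2)])
  \<comment> \<open>The error splits into a bounded factor times \<open>V n - G\<close>, which is
    small in L^p, and a remainder in which only the coefficients vary. The remainder tends to zero
    pointwise and is dominated by means of \<open>norm (G x)\<close>.\<close>
  define a where "a n x = \<zeta> x * g' (v n x)" for n x
  define b where "b n x = (\<zeta> x * (g' (v n x) - g' (w x))) *\<^sub>R G x + (g (v n x) - g (w x)) *\<^sub>R \<zeta>' x" for n x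
  have split: "Hn n x - H x = a n x *\<^sub>R (V n x - G x) + b n x" for n x
    by (simp add: Hn_def H_def a_def b_def algebra_simps)
  have ab: "\<bar>a n x\<bar> \<le> C * C" for n x
    unfolding a_def abs_mult using C(2)[of x] C(5)[OF v(3,4), of n x] C(1) by (intro mult_mono) auto
  let ?W = "\<lambda>x. 2 powr p * ((C * (C + C)) powr p * norm (G x) powr p + ((C + C) * C) powr p)"
  let ?U = "\<lambda>n x. 2 powr p * ((C * C) powr p * norm (V n x - G x) powr p + norm (b n x) powr p)"
  let ?I = "\<lambda>n. 2 powr p * ((C * C) powr p * (\<integral>x. norm (V n x - G x) powr p \<partial>B) + (\<integral>x. norm (b n x) powr p \<partial>B))"
  have bb: "norm (b n x) powr p \<le> ?W x" if x: "x \<in> cball x0 R" for n x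
  proof -
    have 1: "norm ((\<zeta> x * (g' (v n x) - g' (w x))) *\<^sub>R G x) \<le> (C * (C + C)) * norm (G x)"
      unfolding norm_scaleR abs_mult
      using C(2)[of x] C(5)[OF v(3,4), of n x] C(5)[of "w x"] w_range[OF x] C(1)
      by (intro mult_right_mono mult_mono) auto
    have 2: "norm ((g (v n x) - g (w x)) *\<^sub>R \<zeta>' x) \<le> (C + C) * C"
      unfolding norm_scaleR abs_mult
      using C(3)[of x] C(4)[OF v(3,4), of n x] C(4)[of "w x"] w_range[OF x] C(1)
      by (intro mult_mono) auto
    have "norm (b n x) powr p \<le> 2 powr p * (norm ((\<zeta> x * (g' (v n x) - g' (w x))) *\<^sub>R G x) powr p + norm ((g (v n x) - g (w x)) *\<^sub>R \<zeta>' x) powr p)"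
      unfolding b_def by (rule norm_add_powr_le[OF p0])
    also have "\<dots> \<le> 2 powr p * (((C * (C + C)) * norm (G x)) powr p + ((C + C) * C) powr p)"
      by (intro mult_left_mono add_mono powr_mono2 1 2) (use p0 in auto)
    finally show ?thesis using C(1) by (simp add: powr_mult)
  qed
  have bm: "b n \<in> borel_measurable B" for n
    unfolding b_def[abs_def] using gm gnm Gm \<zeta>m \<zeta>'m by measurable
  have Wi: "integrable B ?W"
    using G_ball(2) integrable_B_continuous[of "\<lambda>x. ((C + C) * C) powr p"] by auto
  have bi: "integrable B (\<lambda>x. norm (b n x) powr p)" for n
    by (rule Bochner_Integration.integrable_bound[OF Wi])
       (use bb bm p in \<open>auto intro!: AE_I2 measurable intro: order_trans[OF _ abs_ge_self] simp: space_restrict_space\<close>)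
  have b0: "(\<lambda>n. \<integral>x. norm (b n x) powr p \<partial>B) \<longlonglongrightarrow> (\<integral>x. 0 \<partial>B)"
  proof (rule integral_dominated_convergence[OF _ _ Wi])
    show "AE x in B. (\<lambda>n. norm (b n x) powr p) \<longlonglongrightarrow> 0"
    proof (rule AE_I2)
      fix x assume "x \<in> space B"
      then have x: "x \<in> cball x0 R" by (simp add: space_restrict_space)
      have "(\<lambda>n. g (v n x)) \<longlonglongrightarrow> g (w x)" "(\<lambda>n. g' (v n x)) \<longlonglongrightarrow> g' (w x)"
        by (rule continuous_on_tendsto_compose[OF g_cont[of UNIV] v(5)[OF x]] continuous_on_tendsto_compose[OF g'_cont v(5)[OF x]]; simp)+
      then have "(\<lambda>n. norm (b n x) powr p) \<longlonglongrightarrow> norm ((\<zeta> x * (g' (w x) - g' (w x))) *\<^sub>R G x + (g (w x) - g (w x)) *\<^sub>R \<zeta>' x) powr p"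
        unfolding b_def using p by (intro tendsto_powr2 tendsto_intros) auto
      then show "(\<lambda>n. norm (b n x) powr p) \<longlonglongrightarrow> 0" using p by simp
    qed
    show "(\<lambda>x. norm (b n x) powr p) \<in> borel_measurable B" for n using bi by auto
    show "AE x in B. norm (norm (b n x) powr p) \<le> ?W x" for n
      using bb by (intro AE_I2) (auto simp: space_restrict_space)
  qed auto
  have le: "norm (Hn n x - H x) powr p \<le> ?U n x" for n x
  proof -
    have "norm (a n x *\<^sub>R (V n x - G x)) powr p \<le> ((C * C) * norm (V n x - G x)) powr p"
      unfolding norm_scaleR using ab p0 by (intro powr_mono2 mult_right_mono) auto
    also have "\<dots> = (C * C) powr p * norm (V n x - G x) powr p"
      using C(1) by (simp add: powr_mult)
    finally have *: "norm (a n x *\<^sub>R (V n x - G x)) powr p \<le> (C * C) powr p * norm (V n x - G x) powr p" .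
    have "norm (Hn n x - H x) powr p \<le> 2 powr p * (norm (a n x *\<^sub>R (V n x - G x)) powr p + norm (b n x) powr p)"
      unfolding split by (rule norm_add_powr_le[OF p0])
    also have "\<dots> \<le> ?U n x"
      using * by (intro mult_left_mono add_right_mono) auto
    finally show ?thesis .
  qed
  have Hm: "H \<in> borel_measurable B" "Hn n \<in> borel_measurable B" for n
    unfolding H_def[abs_def] Hn_def[abs_def] using gm gnm Gm \<zeta>m \<zeta>'m by measurable
  have Ui: "integrable B (?U n)" for n
    using Vi bi by auto
  have Di: "integrable B (\<lambda>x. norm (Hn n x - H x) powr p)" for n
    by (rule Bochner_Integration.integrable_bound[OF Ui])
       (use le Hm in \<open>auto intro!: AE_I2 intro: order_trans[OF _ abs_ge_self]\<close>)
  show ?thesis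
  proof (rule that[of \<phi>n Hn "C * C"])
    show "GDERIV (\<phi>n n) x :> Hn n x" for n x
      using GDERIV_mult[OF \<zeta> GDERIV_DERIV_compose[OF v(1) g]] by (simp add: \<phi>n_def[abs_def] Hn_def)
    show "continuous_on UNIV (Hn n)" for n
      unfolding Hn_def by (intro continuous_intros cg \<zeta>_cont \<zeta>'_cont v(2))
    show "0 \<le> \<phi>n n x" "\<phi>n n x \<le> C * C" for n x
    proof -
      show "0 \<le> \<phi>n n x" unfolding \<phi>n_def using \<zeta>_nonneg g_nonneg[OF v(3)] by simp
      have "\<bar>\<phi>n n x\<bar> \<le> C * C" unfolding \<phi>n_def abs_mult using C(2)[of x] C(4)[OF v(3,4), of n x] C(1) by (intro mult_mono) auto
      then show "\<phi>n n x \<le> C * C" by simp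
    qed
    show "\<phi>n n x = 0" if "x \<notin> cball x0 R" for n x using \<zeta>_0[OF that] by (simp add: \<phi>n_def)
    show "(\<lambda>n. \<phi>n n x) \<longlonglongrightarrow> \<phi> x" for x
    proof (cases "x \<in> cball x0 R")
      case True
      show ?thesis unfolding \<phi>n_def \<phi>_def
        by (intro tendsto_intros continuous_on_tendsto_compose[OF g_cont[of UNIV] v(5)[OF True]]) auto
    qed (simp add: \<phi>n_def \<phi>_def \<zeta>_0)
    show "integrable B (\<lambda>x. norm (Hn n x - H x) powr p)" for n by (rule Di)
    show "(\<lambda>n. \<integral>x. norm (Hn n x - H x) powr p \<partial>B) \<longlonglongrightarrow> 0"
    proof (rule tendsto_sandwich)
      show "\<forall>\<^sub>F n in sequentially. 0 \<le> (\<integral>x. norm (Hn n x - H x) powr p \<partial>B)"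
        by (intro always_eventually allI integral_nonneg_AE) auto
      show "\<forall>\<^sub>F n in sequentially. (\<integral>x. norm (Hn n x - H x) powr p \<partial>B)
         \<le> ?I n"
      proof (intro always_eventually allI)
        fix n
        show "(\<integral>x. norm (Hn n x - H x) powr p \<partial>B)
         \<le> ?I n"
          using integral_mono[OF Di Ui le] Vi bi by simp
      qed
      have "?I
         \<longlonglongrightarrow> 2 powr p * ((C * C) powr p * 0 + (\<integral>x. 0 \<partial>B))"
        by (intro tendsto_intros V0 b0)
      then show "?I \<longlonglongrightarrow> 0"
        by simp
    qed simp
    \<comment> \<open>\<open>H\<close> inherits p-integrability from the continuous approximation
      \<open>Hn 0\<close> and the finite error between the two.\<close>
    have "integrable B (\<lambda>x. norm (Hn 0 x) powr p)"
      by (intro integrable_B_continuous continuous_on_powr' continuous_on_norm continuous_on_const)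
         (use p in \<open>auto simp: Hn_def intro!: continuous_intros cg \<zeta>_cont \<zeta>'_cont v(2)\<close>)
    from powr_integrable_diff[OF p0 _ _ this Di[of 0]] Hm
    show "integrable B (\<lambda>x. norm (H x) powr p)" by simp
  qed
qed

text \<open>The approximations converge at every point of the space, outside the ball because the
  cutoff vanishes there; nothing about \<open>w\<close> beyond \<open>\<Omega>\<close>
  enters.\<close>

lemma \<phi>_borel: "\<phi> \<in> borel_measurable borel"
proof (rule C1_approximation)
  fix \<phi>n :: "nat \<Rightarrow> 'a \<Rightarrow> real" and Hn C
  assume \<phi>n: "\<And>n x. GDERIV (\<phi>n n) x :> Hn n x" and lim: "\<And>x. (\<lambda>n. \<phi>n n x) \<longlonglongrightarrow> \<phi> x"
  from \<phi>n have "\<phi>n n \<in> borel_measurable borel" for n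
    by (intro borel_measurable_continuous_onI GDERIV_imp_continuous_on)
  then show ?thesis by (rule borel_measurable_LIMSEQ_real[OF lim, rotated])
qed

lemma H_powr_integrable: "integrable B (\<lambda>x. norm (H x) powr p)"
  by (rule C1_approximation)

lemma H_measurable: "H \<in> borel_measurable B"
  unfolding H_def[abs_def]
  using measurable_B_compose[OF g_cont] measurable_B_compose[OF g'_cont] G_ball(1)
    measurable_B_continuous[OF \<zeta>_cont] measurable_B_continuous[OF \<zeta>'_cont] by measurable

text \<open>Fatou's lemma along the C1 approximations. The extra \<open>2 powr p\<close> is the
  price of comparing \<open>Hn\<close> with \<open>H\<close> by
  \<open>norm_add_powr_le\<close>.\<close>

lemma \<phi>_translation:
  "(\<integral>\<^sup>+x. ennreal (\<bar>\<phi> (x + z) - \<phi> x\<bar> powr p) \<partial>lborel)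
     \<le> ennreal (norm z powr p * (2 powr p * (\<integral>x. norm (H x) powr p \<partial>B)))"
proof (rule C1_approximation)
  fix \<phi>n :: "nat \<Rightarrow> 'a \<Rightarrow> real" and Hn C
  assume \<phi>n: "\<And>n x. GDERIV (\<phi>n n) x :> Hn n x" "\<And>n::nat. continuous_on UNIV (Hn n)"
    "\<And>n x. x \<notin> cball x0 R \<Longrightarrow> \<phi>n n x = 0"
    "\<And>x. (\<lambda>n. \<phi>n n x) \<longlonglongrightarrow> \<phi> x"
    and Di: "\<And>n. integrable B (\<lambda>x. norm (Hn n x - H x) powr p)"
    and D0: "(\<lambda>n. \<integral>x. norm (Hn n x - H x) powr p \<partial>B) \<longlonglongrightarrow> 0"
  let ?d = "\<lambda>n x. ennreal (\<bar>\<phi>n n (x + z) - \<phi>n n x\<bar> powr p)"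
  let ?I = "\<integral>x. norm (H x) powr p \<partial>B" and ?D = "\<lambda>n. \<integral>x. norm (Hn n x - H x) powr p \<partial>B"
  have p0: "0 < p" using p by simp
  have [measurable]: "\<phi>n n \<in> borel_measurable borel" for n
    using \<phi>n(1) by (intro borel_measurable_continuous_onI GDERIV_imp_continuous_on)
  have Hn0: "Hn n x = 0" if "x \<notin> cball x0 R" for n x
    by (rule GDERIV_vanishing_outside_eq_0[OF \<phi>n(1) compact_cball \<phi>n(3) that])
  have pt: "(\<integral>x. norm (Hn n x) powr p \<partial>lebesgue) \<le> 2 powr p * (?I + ?D n)" for n
  proof -
    have "(\<integral>x. norm (Hn n x) powr p \<partial>lebesgue) = (\<integral>x. norm (Hn n x) powr p \<partial>B)"
      by (rule integral_lebesgue_on_vanishing[symmetric]) (use Hn0 p in auto)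
    also have "\<dots> \<le> (\<integral>x. 2 powr p * (norm (H x) powr p + norm (Hn n x - H x) powr p) \<partial>B)"
    proof (rule integral_mono)
      show "integrable B (\<lambda>x. norm (Hn n x) powr p)"
        by (intro integrable_B_continuous continuous_on_powr' continuous_on_norm continuous_on_const \<phi>n(2)) (use p in auto)
      show "norm (Hn n x) powr p \<le> 2 powr p * (norm (H x) powr p + norm (Hn n x - H x) powr p)" for x
        using norm_add_powr_le[OF p0, of "H x" "Hn n x - H x"] by simp
    qed (use H_powr_integrable Di in auto)
    finally show ?thesis using H_powr_integrable Di by simp
  qed
  have "(\<integral>\<^sup>+x. ennreal (\<bar>\<phi> (x + z) - \<phi> x\<bar> powr p) \<partial>lborel) = (\<integral>\<^sup>+x. liminf (\<lambda>n. ?d n x) \<partial>lborel)"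
  proof (rule nn_integral_cong)
    fix x
    have "(\<lambda>n. ?d n x) \<longlonglongrightarrow> ennreal (\<bar>\<phi> (x + z) - \<phi> x\<bar> powr p)"
      using p0 by (intro tendsto_ennrealI tendsto_powr2 tendsto_intros \<phi>n(4)) auto
    then show "ennreal (\<bar>\<phi> (x + z) - \<phi> x\<bar> powr p) = liminf (\<lambda>n. ?d n x)"
      by (rule lim_imp_Liminf[OF sequentially_bot, symmetric])
  qed
  also have "\<dots> \<le> liminf (\<lambda>n. \<integral>\<^sup>+x. ?d n x \<partial>lborel)"
    by (rule nn_integral_liminf) measurable
  also have "\<dots> \<le> liminf (\<lambda>n. ennreal (norm z powr p * (2 powr p * (?I + ?D n))))"
  proof (intro Liminf_mono always_eventually allI)
    fix n
    have "(\<integral>\<^sup>+x. ?d n x \<partial>lborel) \<le> ennreal (norm z powr p * (\<integral>x. norm (Hn n x) powr p \<partial>lebesgue))"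
      by (rule translation_diff_powr_le[OF p \<phi>n(1,2) compact_cball \<phi>n(3)])
    also have "\<dots> \<le> ennreal (norm z powr p * (2 powr p * (?I + ?D n)))"
      using pt by (intro ennreal_leI mult_left_mono) auto
    finally show "(\<integral>\<^sup>+x. ?d n x \<partial>lborel) \<le> ennreal (norm z powr p * (2 powr p * (?I + ?D n)))" .
  qed
  also have "\<dots> = ennreal (norm z powr p * (2 powr p * (?I + 0)))"
    by (intro lim_imp_Liminf tendsto_ennrealI tendsto_intros D0) simp
  finally show ?thesis by simp
qed

lemma faber_krahn:
  assumes "0 < \<rho>" "2 * emeasure lborel {x. \<phi> x \<noteq> 0} \<le> emeasure lborel (ball (0::'a) \<rho>)"
  shows "(\<integral>\<^sup>+x. ennreal (\<bar>\<phi> x\<bar> powr p) \<partial>lborel) \<le> ennreal (2 * \<rho> powr p * (2 powr p * (\<integral>x. norm (H x) powr p \<partial>B)))"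
  by (rule faber_krahn_translation[OF _ \<phi>_borel assms(1) _ assms(2) \<phi>_translation])
     (use p in \<open>auto intro!: mult_nonneg_nonneg integral_nonneg_AE\<close>)

text \<open>Both sides pass to the limit along the C1 approximations: the left by strong convergence
  of gradients paired with \<open>F\<close> in the conjugate space, the right by domination, since
  the approximations are uniformly bounded and \<open>f\<close> is integrable on the ball.\<close>

lemma test_weak_inequality:
  assumes F: "Lp_loc (p / (p - 1)) \<Omega> F" and f: "Lp_loc 1 \<Omega> f"
    and weak: "\<And>\<psi> K. W1inf \<Omega> \<psi> K \<Longrightarrow> compactly_supported_in \<Omega> \<psi> \<Longrightarrow> (\<And>x. x \<in> \<Omega> \<Longrightarrow> 0 \<le> \<psi> x) \<Longrightarrow>
       (LINT x|lebesgue_on \<Omega>. F x \<bullet> K x) \<le> (LINT x|lebesgue_on \<Omega>. f x * \<psi> x)"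
  shows "integrable B (\<lambda>x. F x \<bullet> H x) \<and> integrable B (\<lambda>x. f x * \<phi> x) \<and>
    (\<integral>x. F x \<bullet> H x \<partial>B) \<le> (\<integral>x. f x * \<phi> x \<partial>B)"
proof (rule C1_approximation)
  fix \<phi>n :: "nat \<Rightarrow> 'a \<Rightarrow> real" and Hn C
  assume \<phi>n: "\<And>n x. GDERIV (\<phi>n n) x :> Hn n x" "\<And>n::nat. continuous_on UNIV (Hn n)"
    "\<And>n x. 0 \<le> \<phi>n n x" "\<And>n x. x \<notin> cball x0 R \<Longrightarrow> \<phi>n n x = 0" "\<And>n x. \<phi>n n x \<le> C"
    "\<And>x. (\<lambda>n. \<phi>n n x) \<longlonglongrightarrow> \<phi> x"
    and Di: "\<And>n. integrable B (\<lambda>x. norm (Hn n x - H x) powr p)"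
    and D0: "(\<lambda>n. \<integral>x. norm (Hn n x - H x) powr p \<partial>B) \<longlonglongrightarrow> 0"
  have sets: "cball x0 R \<in> sets lebesgue" "\<Omega> \<in> sets lebesgue" using open_\<Omega> by auto
  have Hn0: "Hn n x = 0" if "x \<notin> cball x0 R" for n x
    by (rule GDERIV_vanishing_outside_eq_0[OF \<phi>n(1) compact_cball \<phi>n(4) that])
  have Fb: "F \<in> borel_measurable B" "integrable B (\<lambda>x. norm (F x) powr (p / (p - 1)))"
    using Lp_loc_ball[OF F, of R] R by auto
  have "integrable B (\<lambda>x. norm (f x))" and fm: "f \<in> borel_measurable B"
    using Lp_loc_ball[OF f, of R] R by auto
  then have fb: "integrable B f" using integrable_norm_iff[OF fm] by blast
  have Hm: "H \<in> borel_measurable B" "Hn n \<in> borel_measurable B" for n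
    by (rule H_measurable, rule measurable_B_continuous[OF \<phi>n(2)])
  have inner_i: "integrable B (\<lambda>x. F x \<bullet> K x)" if "K \<in> borel_measurable B" "integrable B (\<lambda>x. norm (K x) powr p)" for K
    by (rule Bochner_Integration.integrable_bound[OF integrable_norm_mult[OF p Fb(1) that(1) Fb(2) that(2)]])
       (use Fb(1) that(1) Cauchy_Schwarz_ineq2 in \<open>auto intro!: AE_I2\<close>)
  have FH: "integrable B (\<lambda>x. F x \<bullet> H x)" by (rule inner_i[OF Hm(1) H_powr_integrable])
  have FD: "integrable B (\<lambda>x. F x \<bullet> (Hn n x - H x))" for n by (rule inner_i) (use Hm Di in auto)
  have \<phi>nm: "\<phi>n n \<in> borel_measurable B" for n by (rule measurable_B_continuous[OF GDERIV_imp_continuous_on[OF \<phi>n(1)]])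
  have \<phi>m: "\<phi> \<in> borel_measurable B" using \<phi>_borel by (intro measurable_restrict_space1 measurable_completion) simp
  have dom: "(\<lambda>x. f x * \<phi> x) \<in> borel_measurable B" "\<And>n. (\<lambda>x. f x * \<phi>n n x) \<in> borel_measurable B"
    "integrable B (\<lambda>x. norm (f x) * C)" "AE x in B. (\<lambda>n. f x * \<phi>n n x) \<longlonglongrightarrow> f x * \<phi> x"
    "\<And>n. AE x in B. norm (f x * \<phi>n n x) \<le> norm (f x) * C"
    using \<phi>m \<phi>nm fm fb \<phi>n(3,5,6)
    by (auto simp: abs_mult intro!: AE_I2 mult_left_mono tendsto_intros)
  have f\<phi>: "integrable B (\<lambda>x. f x * \<phi> x)" by (rule integrable_dominated_convergence[OF dom])
  have lim_r: "(\<lambda>n. \<integral>x. f x * \<phi>n n x \<partial>B) \<longlonglongrightarrow> (\<integral>x. f x * \<phi> x \<partial>B)"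
    by (rule integral_dominated_convergence[OF dom])
  have lim_l: "(\<lambda>n. \<integral>x. F x \<bullet> Hn n x \<partial>B) \<longlonglongrightarrow> (\<integral>x. F x \<bullet> H x \<partial>B)"
  proof -
    have "(\<lambda>n. \<integral>x. norm (F x) * norm (Hn n x - H x) \<partial>B) \<longlonglongrightarrow> 0"
      by (rule integral_norm_mult_tendsto_0[OF p Fb(1) _ Fb(2) Di D0]) (use Hm in auto)
    then have "(\<lambda>n. \<integral>x. F x \<bullet> (Hn n x - H x) \<partial>B) \<longlonglongrightarrow> 0"
    proof (rule Lim_null_comparison[rotated])
      show "\<forall>\<^sub>F n in sequentially. norm (\<integral>x. F x \<bullet> (Hn n x - H x) \<partial>B) \<le> (\<integral>x. norm (F x) * norm (Hn n x - H x) \<partial>B)"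
        by (intro always_eventually allI Bochner_Integration.integral_norm_bound_integral FD integrable_norm_mult[OF p Fb(1) _ Fb(2) Di])
           (use Hm Cauchy_Schwarz_ineq2 in auto)
    qed
    from tendsto_add[OF this tendsto_const[of "\<integral>x. F x \<bullet> H x \<partial>B"]]
    have "(\<lambda>n. (\<integral>x. F x \<bullet> (Hn n x - H x) \<partial>B) + (\<integral>x. F x \<bullet> H x \<partial>B)) \<longlonglongrightarrow> (\<integral>x. F x \<bullet> H x \<partial>B)" by simp
    moreover have "(\<integral>x. F x \<bullet> (Hn n x - H x) \<partial>B) + (\<integral>x. F x \<bullet> H x \<partial>B) = (\<integral>x. F x \<bullet> Hn n x \<partial>B)" for n
      using FD[of n] FH by (subst Bochner_Integration.integral_add[symmetric]) (auto simp: inner_diff_right)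
    ultimately show ?thesis by simp
  qed
  have "(\<integral>x. F x \<bullet> H x \<partial>B) \<le> (\<integral>x. f x * \<phi> x \<partial>B)"
  proof (rule LIMSEQ_le[OF lim_l lim_r], intro exI allI impI)
    fix n
    have "compactly_supported_in \<Omega> (\<phi>n n)"
      unfolding compactly_supported_in_def using \<phi>n(4) cball_subset by (intro exI[of _ "cball x0 R"]) auto
    then have "(LINT x|lebesgue_on \<Omega>. F x \<bullet> Hn n x) \<le> (LINT x|lebesgue_on \<Omega>. f x * \<phi>n n x)"
      using \<phi>n by (intro weak W1inf_C1_compact_support[OF open_\<Omega> \<phi>n(1,2) compact_cball cball_subset(2) \<phi>n(4)]) auto
    moreover have "(LINT x|lebesgue_on \<Omega>. F x \<bullet> Hn n x) = (\<integral>x. F x \<bullet> Hn n x \<partial>B)"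
      by (rule integral_lebesgue_on_subset[OF sets cball_subset(2)]) (simp add: Hn0)
    moreover have "(LINT x|lebesgue_on \<Omega>. f x * \<phi>n n x) = (\<integral>x. f x * \<phi>n n x \<partial>B)"
      by (rule integral_lebesgue_on_subset[OF sets cball_subset(2)]) (simp add: \<phi>n(4))
    ultimately show "(\<integral>x. F x \<bullet> Hn n x \<partial>B) \<le> (\<integral>x. f x * \<phi>n n x \<partial>B)" by simp
  qed
  with FH f\<phi> show ?thesis by blast
qed

end

section \<open>Energy inequalities for subsolutions\<close>

text \<open>Support radius \<open>r\<close> and normalising scale \<open>R\<close> are kept apart,
  so that the cutoffs of an iteration with shrinking \<open>r\<close> share one gradient bound in
  terms of \<open>R\<close>. On a smaller ball the cutoff is then bounded below by a power of the
  radius gap, not by 1.\<close>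

definition cutoff :: "nat \<Rightarrow> real \<Rightarrow> 'a::euclidean_space \<Rightarrow> real \<Rightarrow> 'a \<Rightarrow> real" where
  "cutoff m R c r x = quad_bump m c r x / R ^ (2 * m)"

definition cutoff_grad :: "nat \<Rightarrow> real \<Rightarrow> 'a::euclidean_space \<Rightarrow> real \<Rightarrow> 'a \<Rightarrow> 'a" where
  "cutoff_grad m R c r x = quad_bump_grad m c r x /\<^sub>R R ^ (2 * m)"

lemma GDERIV_cutoff:
  assumes "2 \<le> m" shows "GDERIV (cutoff m R c r) x :> cutoff_grad m R c r x"
proof -
  have "GDERIV (\<lambda>x. quad_bump m c r x * inverse (R ^ (2 * m))) x :>
        quad_bump m c r x *\<^sub>R 0 + inverse (R ^ (2 * m)) *\<^sub>R quad_bump_grad m c r x"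
    by (intro GDERIV_mult GDERIV_quad_bump GDERIV_const assms)
  then show ?thesis by (simp add: cutoff_def[abs_def] cutoff_grad_def divide_inverse)
qed

lemma continuous_cutoff_grad: "continuous_on A (cutoff_grad m R c r)"
  unfolding cutoff_grad_def by (intro continuous_intros)

context
  fixes m :: nat and r R :: real
  assumes m: "2 \<le> m" and r: "0 < r" "r \<le> R"
begin

lemma cutoff_eq: "cutoff m R c r x = (max 0 (r\<^sup>2 - (norm (x - c))\<^sup>2) / R\<^sup>2) ^ m"
  by (simp add: cutoff_def quad_bump_def power_divide power_mult)

lemma cutoff_base: "0 \<le> max 0 (r\<^sup>2 - (norm (x - c))\<^sup>2) / R\<^sup>2" "max 0 (r\<^sup>2 - (norm (x - c))\<^sup>2) / R\<^sup>2 \<le> 1"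
proof -
  have "r\<^sup>2 \<le> R\<^sup>2" using r by (intro power_mono) auto
  moreover have "r\<^sup>2 - (norm (x - c))\<^sup>2 \<le> r\<^sup>2" by simp
  ultimately have "max 0 (r\<^sup>2 - (norm (x - c))\<^sup>2) \<le> R\<^sup>2" by (metis max.bounded_iff order_trans zero_le_power2)
  then show "max 0 (r\<^sup>2 - (norm (x - c))\<^sup>2) / R\<^sup>2 \<le> 1" using r by (simp add: divide_le_eq)
qed simp

lemma cutoff_range: "0 \<le> cutoff m R c r x" "cutoff m R c r x \<le> 1"
  unfolding cutoff_eq by (intro power_le_one zero_le_power cutoff_base)+

lemma cutoff_eq_0: "x \<notin> ball c r \<Longrightarrow> cutoff m R c r x = 0"
  and cutoff_grad_eq_0: "x \<notin> ball c r \<Longrightarrow> cutoff_grad m R c r x = 0"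
  using m r by (auto simp: cutoff_def cutoff_grad_def quad_bump_eq_0 quad_bump_grad_eq_0)

lemma cutoff_pos_iff: "0 < cutoff m R c r x \<longleftrightarrow> x \<in> ball c r"
  using m r by (simp add: cutoff_def zero_less_divide_iff quad_bump_pos_iff del: mem_ball)

lemma cutoff_ge:
  assumes "x \<in> ball c r'" "r' \<le> r"
  shows "((r\<^sup>2 - r'\<^sup>2) / R\<^sup>2) ^ m \<le> cutoff m R c r x"
proof -
  have "norm (x - c) < r'" using assms(1) by (simp add: dist_norm norm_minus_commute)
  then have n: "norm (x - c) \<le> r'" "0 \<le> r'" using norm_ge_zero[of "x - c"] by linarith+
  then have "(norm (x - c))\<^sup>2 \<le> r'\<^sup>2" "r'\<^sup>2 \<le> r\<^sup>2" using assms(2) by (auto intro: power_mono)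
  then show ?thesis unfolding cutoff_eq by (intro power_mono divide_right_mono) auto
qed

text \<open>Differentiation lowers the power m of a base between 0 and 1 by one, and m - 1 is at
  least m(p - 1)/p because m is at least p. The exponent (p - 1)/p is the one that the conjugate
  power p/(p - 1) turns back into the cutoff itself, ready for absorption by Young's
  inequality.\<close>

lemma norm_cutoff_grad_le:
  assumes p: "1 < p" "p \<le> real m"
  shows "norm (cutoff_grad m R c r x) \<le> 2 * real m / R * cutoff m R c r x powr ((p - 1) / p)"
proof (cases "x \<in> ball c r")
  case True
  define t where "t = max 0 (r\<^sup>2 - (norm (x - c))\<^sup>2)"
  define s where "s = t / R\<^sup>2"
  have s: "0 \<le> s" "s \<le> 1" using cutoff_base[of x c] by (auto simp: s_def t_def)
  have \<zeta>: "cutoff m R c r x = s ^ m" by (simp add: cutoff_eq s_def t_def)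
  then have s0: "0 < s" using True cutoff_pos_iff[of c x] s m by (cases "s = 0") (auto simp: zero_power)
  have "R ^ (2 * m) = (R\<^sup>2) ^ (m - 1) * R\<^sup>2"
    using power_minus_mult[of m "R\<^sup>2"] m by (simp add: power_mult)
  then have sR: "t ^ (m - 1) / R ^ (2 * m) = s ^ (m - 1) / R\<^sup>2"
    by (simp add: s_def power_divide)
  have "norm (cutoff_grad m R c r x) = 2 * real m * (t ^ (m - 1) / R ^ (2 * m)) * norm (x - c)"
    using r by (simp add: cutoff_grad_def quad_bump_grad_def t_def[symmetric] abs_mult) (simp add: t_def divide_inverse)
  also have "\<dots> \<le> 2 * real m * (s ^ (m - 1) / R\<^sup>2) * R"
    unfolding sR using True r s by (intro mult_left_mono) (auto simp: dist_norm norm_minus_commute)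
  also have "\<dots> = 2 * real m / R * s ^ (m - 1)" using r by (simp add: power2_eq_square)
  also have "\<dots> \<le> 2 * real m / R * cutoff m R c r x powr ((p - 1) / p)"
  proof (rule mult_left_mono)
    have "s ^ (m - 1) = s powr (real m - 1)"
      using s0 m by (simp add: powr_realpow[symmetric] of_nat_diff)
    also have "\<dots> \<le> s powr (real m * ((p - 1) / p))"
      using s p by (intro powr_mono') (auto simp: field_simps)
    also have "\<dots> = (s ^ m) powr ((p - 1) / p)"
      using s0 by (simp add: powr_realpow[symmetric] powr_powr)
    finally show "s ^ (m - 1) \<le> cutoff m R c r x powr ((p - 1) / p)" by (simp add: \<zeta>)
  qed (use r in simp)
  finally show ?thesis .
qed (use r in \<open>simp add: cutoff_grad_eq_0 cutoff_eq_0 del: mem_ball\<close>)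

end

text \<open>\<open>f\<close> is the absorption term, moved to the right with a minus sign. The Young
  constant \<open>Cy\<close> is a parameter so that it can be fixed before domain and solution; its
  companion weight \<open>K2 / 2\<close> lets half of the coercive term survive.\<close>

locale subsolution_ball = sobolev_ball \<Omega> p w G x0 R R' L
  for \<Omega> :: "'a::euclidean_space set" and p w G x0 R R' L +
  fixes A :: "'a \<Rightarrow> real \<Rightarrow> 'a \<Rightarrow> 'a" and K1 K2 f m Cy
  assumes coercive: "strongly_coercive p K1 K2 \<Omega> A"
    and F_Lp: "Lp_loc (p / (p - 1)) \<Omega> (\<lambda>x. A x (w x) (G x))"
    and f_Lp: "Lp_loc 1 \<Omega> (\<lambda>x. - f x)" and f_nonneg: "\<And>x. x \<in> \<Omega> \<Longrightarrow> 0 \<le> f x"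
    and weak: "\<And>\<psi> K. W1inf \<Omega> \<psi> K \<Longrightarrow> compactly_supported_in \<Omega> \<psi> \<Longrightarrow> (\<And>x. x \<in> \<Omega> \<Longrightarrow> 0 \<le> \<psi> x) \<Longrightarrow>
       (LINT x|lebesgue_on \<Omega>. A x (w x) (G x) \<bullet> K x) \<le> (LINT x|lebesgue_on \<Omega>. - f x * \<psi> x)"
    and m: "2 \<le> m" "p \<le> real m"
    and young: "\<And>a b. 0 \<le> a \<Longrightarrow> 0 \<le> b \<Longrightarrow> a * b \<le> K2 / 2 * a powr (p / (p - 1)) + Cy * b powr p"
    and Cy: "0 < Cy"
begin

definition F :: "'a \<Rightarrow> 'a" where "F x = A x (w x) (G x)"

lemma K: "0 < K1" "0 < K2" using coercive by (auto simp: strongly_coercive_def)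

lemma FG_ge:
  assumes "x \<in> cball x0 R"
  shows "K1 * norm (G x) powr p \<le> F x \<bullet> G x" "K2 * norm (F x) powr (p / (p - 1)) \<le> F x \<bullet> G x"
proof -
  have "x \<in> \<Omega>" "0 \<le> w x" using assms w_range[OF assms] cball_subset by auto
  then have *: "K1 * norm (G x) powr p \<le> F x \<bullet> G x \<and> K2 * norm (F x) powr (p / (p - 1)) \<le> K1 * norm (G x) powr p"
    using coercive unfolding strongly_coercive_def F_def by blast
  then show "K1 * norm (G x) powr p \<le> F x \<bullet> G x" "K2 * norm (F x) powr (p / (p - 1)) \<le> F x \<bullet> G x"
    by linarith+
qed

lemma FG_nonneg: "x \<in> cball x0 R \<Longrightarrow> 0 \<le> F x \<bullet> G x"
  using FG_ge(1)[of x] K(1) by (meson mult_nonneg_nonneg order_trans powr_ge_zero less_imp_le)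

lemma F_ball: "F \<in> borel_measurable B" "integrable B (\<lambda>x. norm (F x) powr (p / (p - 1)))"
  using Lp_loc_ball[OF F_Lp, of R] R by (auto simp: F_def[abs_def])

lemma FG_integrable: "integrable B (\<lambda>x. F x \<bullet> G x)"
  by (rule Bochner_Integration.integrable_bound[OF integrable_norm_mult[OF p F_ball(1) G_ball(1) F_ball(2) G_ball(2)]])
     (use F_ball(1) G_ball(1) Cauchy_Schwarz_ineq2 in \<open>auto intro!: AE_I2\<close>)

text \<open>The gradient of the cutoff comes with the factor \<open>g (w x)\<close>, the coercive
  term with \<open>g' (w x)\<close>. The condition \<open>g s \<le> T * g' s\<close> makes the
  former comparable with the latter, so that Young's inequality can absorb it. One computation thus
  covers both profiles, with \<open>T = 2 * S\<close> and \<open>T = L / 2\<close>.\<close>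

lemma energy_inequality:
  fixes g g' :: "real \<Rightarrow> real"
  assumes r: "0 < r" "r \<le> R" and g: "\<And>s. DERIV g s :> g' s" "continuous_on UNIV g'" "\<And>s. 0 \<le> s \<Longrightarrow> 0 \<le> g s"
    and T: "0 \<le> T" "\<And>s. 0 \<le> s \<Longrightarrow> s \<le> L \<Longrightarrow> 0 \<le> g' s" "\<And>s. 0 \<le> s \<Longrightarrow> s \<le> L \<Longrightarrow> g s \<le> T * g' s"
  defines "\<zeta> \<equiv> cutoff m R x0 r"
  shows "integrable B (\<lambda>x. \<zeta> x * g' (w x) * (F x \<bullet> G x))" (is ?i1)
    "integrable B (\<lambda>x. f x * (\<zeta> x * g (w x)))" (is ?i2)
    "(\<integral>x. f x * (\<zeta> x * g (w x)) \<partial>B) + (\<integral>x. \<zeta> x * g' (w x) * (F x \<bullet> G x) \<partial>B) / 2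
      \<le> Cy * (2 * real m * T / R) powr p * (\<integral>x. indicator (ball x0 r) x * g' (w x) \<partial>B)" (is ?le)
proof -
  have sub: "ball x0 r \<subseteq> cball x0 R" using r by auto
  interpret test_profile \<Omega> p w G x0 R R' L \<zeta> "cutoff_grad m R x0 r" g g'
  proof
    show "GDERIV \<zeta> x :> cutoff_grad m R x0 r x" for x unfolding \<zeta>_def by (rule GDERIV_cutoff[OF m(1)])
    show "0 \<le> \<zeta> x" for x unfolding \<zeta>_def by (rule cutoff_range[OF m(1) r])
    show "\<zeta> x = 0" if "x \<notin> cball x0 R" for x
      unfolding \<zeta>_def using that sub by (intro cutoff_eq_0[OF m(1) r]) auto
  qed (use g continuous_cutoff_grad in auto)
  have tw: "integrable B (\<lambda>x. F x \<bullet> H x) \<and> integrable B (\<lambda>x. - f x * \<phi> x) \<and>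
    (\<integral>x. F x \<bullet> H x \<partial>B) \<le> (\<integral>x. - f x * \<phi> x \<partial>B)"
    unfolding F_def by (intro test_weak_inequality[OF F_Lp f_Lp] weak) blast+
  have \<zeta>1: "\<bar>\<zeta> x\<bar> \<le> 1" for x unfolding \<zeta>_def using cutoff_range[OF m(1) r, of x0 x] by auto
  have g'm: "(\<lambda>x. g' (w x)) \<in> borel_measurable B" by (rule measurable_B_compose[OF g'_cont])
  have \<zeta>m: "\<zeta> \<in> borel_measurable B" by (rule measurable_B_continuous[OF \<zeta>_cont])
  have "bounded (g' ` {0..L})"
    using continuous_on_subset[OF g'_cont] by (auto intro!: compact_imp_bounded compact_continuous_image)
  then obtain C where C: "\<And>s. 0 \<le> s \<Longrightarrow> s \<le> L \<Longrightarrow> \<bar>g' s\<bar> \<le> C"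
    unfolding bounded_iff by (metis atLeastAtMost_iff imageI real_norm_def)
  have g'C: "\<bar>g' (w x)\<bar> \<le> C" if "x \<in> cball x0 R" for x using C w_range[OF that] by auto
  show i1: ?i1
  proof -
    have "integrable B (\<lambda>x. (\<zeta> x * g' (w x)) *\<^sub>R (F x \<bullet> G x))"
    proof (rule integrable_lebesgue_on_bounded_mult[OF FG_integrable])
      show "\<bar>\<zeta> x * g' (w x)\<bar> \<le> 1 * C" if "x \<in> space B" for x
        unfolding abs_mult using that g'C[of x] \<zeta>1[of x] by (intro mult_mono) (auto simp: space_restrict_space)
    qed (use \<zeta>m g'm in measurable)
    then show ?thesis by simp
  qed
  have \<phi>_eq: "\<phi> = (\<lambda>x. \<zeta> x * g (w x))" by (simp add: \<phi>_def[abs_def])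
  show i2: ?i2 using tw by (auto simp: \<phi>_eq)
  have i3: "integrable B (\<lambda>x. indicator (ball x0 r) x * g' (w x))"
  proof (rule integrable_lebesgue_on_bounded[OF compact_cball])
    show "(\<lambda>x. indicator (ball x0 r) x * g' (w x)) \<in> borel_measurable B"
      by (intro borel_measurable_times g'm borel_measurable_indicator) (use sub in \<open>auto simp: sets_restrict_space_iff\<close>)
    show "norm (indicator (ball x0 r) x * g' (w x)) \<le> C" if "x \<in> cball x0 R" for x
      using g'C[OF that] by (auto simp: indicator_def)
  qed
  define c where "c = 2 * real m / R"
  have c: "0 \<le> c" using R by (simp add: c_def)
  define Y where "Y = Cy * (c * T) powr p"
  let ?e = "\<lambda>x. \<zeta> x * g' (w x) * (F x \<bullet> G x) / 2 - Y * (indicator (ball x0 r) x * g' (w x))"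
  let ?z = "cutoff_grad m R x0 r"
  have pt: "?e x \<le> F x \<bullet> H x" if x: "x \<in> cball x0 R" for x
  proof (cases "x \<in> ball x0 r")
    case True
    \<comment> \<open>The power of the cutoff is attached to the flux, so that the conjugate power
      of \<open>a\<close> contains exactly the factor \<open>\<zeta> x\<close> of the coercive
      term.\<close>
    define a where "a = norm (F x) * \<zeta> x powr ((p - 1) / p)"
    have a: "0 \<le> a" "a powr (p / (p - 1)) = \<zeta> x * norm (F x) powr (p / (p - 1))"
      using p \<zeta>_nonneg[of x] by (auto simp: a_def powr_mult powr_powr)
    have w: "0 \<le> g' (w x)" "0 \<le> g (w x)" "g (w x) \<le> T * g' (w x)" using T w_range[OF x] g_nonneg by auto
    have "norm (?z x) \<le> c * \<zeta> x powr ((p - 1) / p)"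
      unfolding c_def \<zeta>_def by (rule norm_cutoff_grad_le[OF m(1) r p m(2)])
    then have "norm (F x) * norm (?z x) \<le> norm (F x) * (c * \<zeta> x powr ((p - 1) / p))"
      by (intro mult_left_mono) auto
    then have n: "norm (F x) * norm (?z x) \<le> a * c" by (simp add: a_def mult_ac)
    have "- (F x \<bullet> ?z x) \<le> norm (F x) * norm (?z x)"
      using Cauchy_Schwarz_ineq2[of "F x" "?z x"] by linarith
    from mult_left_mono[OF this w(2)]
    have "- (g (w x) * (F x \<bullet> ?z x)) \<le> g (w x) * (norm (F x) * norm (?z x))"
      by simp
    also have "\<dots> \<le> (T * g' (w x)) * (a * c)"
      by (rule mult_mono) (use w n a c T(1) in auto)
    also have "\<dots> = g' (w x) * (a * (c * T))" by simp
    also have "\<dots> \<le> g' (w x) * (K2 / 2 * a powr (p / (p - 1)) + Cy * (c * T) powr p)"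
      using w(1) a(1) c T(1) by (intro mult_left_mono young) auto
    also have "\<dots> = g' (w x) * \<zeta> x * (K2 * norm (F x) powr (p / (p - 1))) / 2 + Y * g' (w x)"
      unfolding a(2) Y_def by (simp add: algebra_simps)
    also have "\<dots> \<le> g' (w x) * \<zeta> x * (F x \<bullet> G x) / 2 + Y * g' (w x)"
      using w(1) \<zeta>_nonneg[of x] FG_ge(2)[OF x] by (intro add_right_mono divide_right_mono mult_left_mono) auto
    finally have "- (g (w x) * (F x \<bullet> ?z x)) \<le> g' (w x) * \<zeta> x * (F x \<bullet> G x) / 2 + Y * g' (w x)" .
    moreover have "F x \<bullet> H x = g' (w x) * \<zeta> x * (F x \<bullet> G x) + g (w x) * (F x \<bullet> ?z x)"
      by (simp add: H_def inner_add_right)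
    ultimately show ?thesis using True by (simp add: mult_ac)
  next
    case False
    then have "\<zeta> x = 0" "?z x = 0"
      using cutoff_eq_0[OF m(1) r False] cutoff_grad_eq_0[OF m(1) r False] by (simp_all add: \<zeta>_def)
    then show ?thesis using False by (simp add: H_def del: mem_ball)
  qed
  have "integral\<^sup>L B ?e \<le> (\<integral>x. F x \<bullet> H x \<partial>B)"
    by (rule integral_mono) (use i1 i3 tw pt in \<open>auto simp: space_restrict_space\<close>)
  also have "\<dots> \<le> (\<integral>x. - f x * \<phi> x \<partial>B)" using tw by blast
  also have "\<dots> = - (\<integral>x. f x * (\<zeta> x * g (w x)) \<partial>B)" by (simp add: \<phi>_eq)
  finally have "integral\<^sup>L B ?e \<le> - (\<integral>x. f x * (\<zeta> x * g (w x)) \<partial>B)" .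
  moreover have "integral\<^sup>L B ?e
    = (\<integral>x. \<zeta> x * g' (w x) * (F x \<bullet> G x) \<partial>B) / 2 - Y * (\<integral>x. indicator (ball x0 r) x * g' (w x) \<partial>B)"
    using i1 i3 by (subst Bochner_Integration.integral_diff) auto
  ultimately show ?le by (simp add: Y_def c_def mult_ac)
qed

text \<open>The profile s + S lies between S and 2S on the range of \<open>w\<close>: the right side
  scales like the p-th power of S, the left like S, whence the net power p - 1. The energy term on
  the left is nonnegative and is dropped.\<close>

lemma f_average_le:
  assumes S: "0 < S" "L \<le> S" and E: "E \<in> sets lebesgue" "E \<subseteq> ball x0 (R / 2)" and c: "0 \<le> c" "\<And>x. x \<in> E \<Longrightarrow> c \<le> f x"
  shows "S * (c * (3 / 4) ^ m * measure lebesgue E) \<le> Cy * (4 * real m * S / R) powr p * measure lebesgue (ball x0 R)"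
proof -
  let ?\<zeta> = "cutoff m R x0 R"
  note en = energy_inequality[of R "\<lambda>s. s + S" "\<lambda>_. 1" "2 * S"]
  have en2: "integrable B (\<lambda>x. f x * (?\<zeta> x * (w x + S)))"
    and en1: "integrable B (\<lambda>x. ?\<zeta> x * 1 * (F x \<bullet> G x))"
    and en3: "(\<integral>x. f x * (?\<zeta> x * (w x + S)) \<partial>B) + (\<integral>x. ?\<zeta> x * 1 * (F x \<bullet> G x) \<partial>B) / 2
      \<le> Cy * (2 * real m * (2 * S) / R) powr p * (\<integral>x. indicator (ball x0 R) x * 1 \<partial>B)"
    using S R by (intro en; auto intro!: derivative_eq_intros continuous_intros)+
  have r: "0 < R" "R \<le> R" using R by auto
  have sub: "ball x0 (R/2) \<subseteq> cball x0 R" using R by auto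
  then have EK: "E \<subseteq> cball x0 R" using E by auto
  have fin: "emeasure lebesgue E < \<infinity>"
    using emeasure_mono[of E "ball x0 (R/2)" lebesgue] E emeasure_lborel_ball_finite[of x0 "R/2"] by (auto simp: top.not_eq_extremum)
  have mE: "measure B E = measure lebesgue E" using E EK by (simp add: measure_restrict_space)
  have iE: "integrable B (\<lambda>x. indicator E x * (S * (c * (3/4) ^ m)))"
    by (rule integrable_mult_left[OF integrable_real_indicator])
       (use E EK fin in \<open>auto simp: sets_restrict_space_iff emeasure_restrict_space\<close>)
  have "S * (c * (3 / 4) ^ m * measure lebesgue E) = (\<integral>x. indicator E x * (S * (c * (3/4) ^ m)) \<partial>B)"
    using EK by (simp add: mE Int_absorb2 space_restrict_space)
  also have "\<dots> \<le> (\<integral>x. f x * (?\<zeta> x * (w x + S)) \<partial>B)"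
  proof (rule integral_mono[OF iE en2])
    fix x assume "x \<in> space B"
    then have x: "x \<in> cball x0 R" by (simp add: space_restrict_space)
    have w: "0 \<le> w x" "0 \<le> f x" using w_range[OF x] f_nonneg[of x] cball_subset x by auto
    have \<zeta>: "0 \<le> ?\<zeta> x" by (rule cutoff_range[OF m(1) r])
    show "indicator E x * (S * (c * (3/4) ^ m)) \<le> f x * (?\<zeta> x * (w x + S))"
    proof (cases "x \<in> E")
      case True
      \<comment> \<open>On the concentric half ball the base of the cutoff is at least 3/4, the
        origin of that constant.\<close>
      have "((R\<^sup>2 - (R / 2)\<^sup>2) / R\<^sup>2) ^ m \<le> ?\<zeta> x"
        by (rule cutoff_ge[OF m(1) r]) (use True E r in auto)
      moreover have "(R\<^sup>2 - (R / 2)\<^sup>2) / R\<^sup>2 = 3 / 4" using r by (simp add: power_divide field_simps)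
      ultimately have "(3 / 4) ^ m \<le> ?\<zeta> x" by simp
      then have "c * ((3 / 4) ^ m * S) \<le> f x * (?\<zeta> x * (w x + S))"
        using c(2)[OF True] c(1) S(1) w \<zeta> by (intro mult_mono) auto
      then show ?thesis using True by (simp add: mult_ac)
    qed (use w \<zeta> S in auto)
  qed
  also have "\<dots> \<le> (\<integral>x. f x * (?\<zeta> x * (w x + S)) \<partial>B) + (\<integral>x. ?\<zeta> x * 1 * (F x \<bullet> G x) \<partial>B) / 2"
    by (auto intro!: integral_nonneg_AE AE_I2 mult_nonneg_nonneg FG_nonneg cutoff_range(1)[OF m(1) r] simp: space_restrict_space)
  also note en3
  also have "(\<integral>x. indicator (ball x0 R) x * 1 \<partial>B) = measure lebesgue (ball x0 R)"
    by (simp add: measure_restrict_space space_restrict_space Int_absorb2[OF ball_subset_cball])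
  finally show ?thesis by (simp add: mult_ac)
qed

section \<open>Superlevel sets and the De Giorgi iteration\<close>

definition level_set :: "real \<Rightarrow> real \<Rightarrow> 'a set" where
  "level_set k r = {x \<in> ball x0 r. k < w x}"

lemma level_set:
  assumes "r \<le> R"
  shows "open (level_set k r)" "level_set k r \<subseteq> cball x0 R" "emeasure lborel (level_set k r) = ennreal (measure lborel (level_set k r))"
proof -
  have sub: "ball x0 r \<subseteq> cball x0 R" using assms by auto
  have "continuous_on (ball x0 r) w" using w_cont cball_subset sub by (meson continuous_on_subset order_trans)
  from continuous_open_preimage[OF this open_ball, of "{k<..}"]
  show "open (level_set k r)" by (simp add: level_set_def Int_def vimage_def)
  show "level_set k r \<subseteq> cball x0 R" using sub by (auto simp: level_set_def)
  have "emeasure lborel (level_set k r) \<le> emeasure lborel (cball x0 R)"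
    using \<open>level_set k r \<subseteq> cball x0 R\<close> by (intro emeasure_mono) auto
  also have "\<dots> < \<infinity>" by (rule emeasure_lborel_cball_finite)
  finally show "emeasure lborel (level_set k r) = ennreal (measure lborel (level_set k r))"
    by (simp add: emeasure_eq_ennreal_measure)
qed

text \<open>The energy inequality bounds the gradient of \<open>\<phi>\<close> by the measure of the
  larger level set; the Faber-Krahn inequality, available by \<open>small\<close>, converts this
  into a bound on \<open>\<phi>\<close>, which has a positive lower bound on the smaller level set
  when both gaps are positive. The positive part is squared to make the profile C1 at the level
  \<open>k\<close>.\<close>

lemma level_set_step:
  assumes r: "0 < r'" "r' \<le> r" "r \<le> R" and k: "0 \<le> k" "k \<le> k'" and \<rho>: "0 < \<rho>"
    and small: "2 * measure lborel (level_set k r) \<le> measure lborel (ball (0::'a) \<rho>)"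
  shows "(((r\<^sup>2 - r'\<^sup>2) / R\<^sup>2) ^ m * (k' - k)\<^sup>2) powr p * measure lborel (level_set k' r')
     \<le> 2 * \<rho> powr p * 4 powr p * (2 * real m * L\<^sup>2 / R) powr p * (2 * Cy / K1 + 1) * measure lborel (level_set k r)"
proof -
  let ?E = "level_set k r" and ?E' = "level_set k' r'"
  define e where "e = measure lborel ?E"
  have e0: "0 \<le> e" by (simp add: e_def)
  have r0: "0 < r" "r \<le> R" "r' \<le> R" using r by auto
  note lE = level_set[OF r0(2), of k] and lE' = level_set[OF r0(3), of k']
  have Em: "?E \<in> sets lborel" "?E' \<in> sets lborel" using lE(1) lE'(1) by auto
  define g where "g s = (max 0 (s - k))\<^sup>2" for s :: real
  define g' where "g' s = 2 * max 0 (s - k)" for s :: real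
  define \<zeta> where "\<zeta> = cutoff m R x0 r"
  have g: "DERIV g s :> g' s" for s
  proof -
    have "DERIV (\<lambda>s. s - k) s :> 1" by (auto intro!: derivative_eq_intros)
    from DERIV_chain2[where f="\<lambda>s. (max 0 s)\<^sup>2" and g="\<lambda>s. s - k", OF DERIV_pos_part_power this]
    show ?thesis by (simp add: g_def[abs_def] g'_def)
  qed
  have g'c: "continuous_on UNIV g'" unfolding g'_def by (intro continuous_intros)
  have g0: "0 \<le> g s" "0 \<le> g' s" for s by (auto simp: g_def g'_def)
  have sL: "max 0 (s - k) \<le> L" if "s \<le> L" for s using that k L_nonneg by auto
  have gT: "g s \<le> L / 2 * g' s" "g s \<le> L\<^sup>2" "g' s \<le> 2 * L" if "s \<le> L" for s
    using sL[OF that] unfolding g_def g'_def power2_eq_square by (auto intro: mult_right_mono mult_mono)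
  interpret test_profile \<Omega> p w G x0 R R' L \<zeta> "cutoff_grad m R x0 r" g g'
  proof
    show "GDERIV \<zeta> x :> cutoff_grad m R x0 r x" for x unfolding \<zeta>_def by (rule GDERIV_cutoff[OF m(1)])
    show "0 \<le> \<zeta> x" for x unfolding \<zeta>_def by (rule cutoff_range[OF m(1) r0(1,2)])
    show "\<zeta> x = 0" if "x \<notin> cball x0 R" for x
      unfolding \<zeta>_def using that r by (intro cutoff_eq_0[OF m(1) r0(1,2)]) auto
  qed (use g g'c g0 continuous_cutoff_grad in auto)
  have en1: "integrable B (\<lambda>x. \<zeta> x * g' (w x) * (F x \<bullet> G x))"
    and en2: "integrable B (\<lambda>x. f x * (\<zeta> x * g (w x)))"
    and en3: "(\<integral>x. f x * (\<zeta> x * g (w x)) \<partial>B) + (\<integral>x. \<zeta> x * g' (w x) * (F x \<bullet> G x) \<partial>B) / 2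
      \<le> Cy * (2 * real m * (L / 2) / R) powr p * (\<integral>x. indicator (ball x0 r) x * g' (w x) \<partial>B)"
    unfolding \<zeta>_def
    by (rule energy_inequality[OF r0(1,2), of g g' "L / 2"]; use g g'c g0 gT L_nonneg in auto)+
  have iE: "integrable B (indicator ?E :: 'a \<Rightarrow> real)" "(\<integral>x. indicator ?E x \<partial>B) = e"
  proof -
    have "emeasure B ?E = ennreal e" using lE Em by (simp add: emeasure_restrict_space e_def)
    then show "integrable B (indicator ?E :: 'a \<Rightarrow> real)"
      using lE Em by (intro integrable_real_indicator) (auto simp: sets_restrict_space_iff)
    show "(\<integral>x. indicator ?E x \<partial>B) = e"
      using lE Em by (simp add: measure_restrict_space e_def Int_absorb2 space_restrict_space)
  qed
  define J where "J = (\<integral>x. \<zeta> x * g' (w x) * (F x \<bullet> G x) \<partial>B)"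
  have J: "J \<le> 2 * Cy * (real m * L / R) powr p * (2 * L * e)"
  proof -
    have "0 \<le> (\<integral>x. f x * (\<zeta> x * g (w x)) \<partial>B)"
      using f_nonneg cball_subset \<zeta>_nonneg g0 by (intro integral_nonneg_AE AE_I2) (auto simp: space_restrict_space)
    then have "J / 2 \<le> Cy * (real m * L / R) powr p * (\<integral>x. indicator (ball x0 r) x * g' (w x) \<partial>B)"
      using en3 by (simp add: J_def)
    also have "(\<integral>x. indicator (ball x0 r) x * g' (w x) \<partial>B) \<le> (\<integral>x. indicator ?E x * (2 * L) \<partial>B)"
    proof (rule integral_mono')
      show "indicator (ball x0 r) x * g' (w x) \<le> indicator ?E x * (2 * L)" if "x \<in> space B" for x
        using that gT(3)[of "w x"] w_range[of x] by (auto simp: indicator_def level_set_def g'_def space_restrict_space)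
    qed (use iE L_nonneg in auto)
    also have "(\<integral>x. indicator ?E x * (2 * L) \<partial>B) = 2 * L * e" using iE by simp
    finally have "J / 2 \<le> Cy * (real m * L / R) powr p * (2 * L * e)"
      using Cy by (simp add: mult_left_mono)
    then show ?thesis by simp
  qed
  define b where "b = 2 * real m * L\<^sup>2 / R"
  have b: "0 \<le> b" using R by (simp add: b_def)
  \<comment> \<open>The factor \<open>\<zeta> x * g' (w x)\<close> is at most \<open>2 * L\<close>,
    so its p-th power is at most \<open>(2 * L) powr (p - 1)\<close> times its first power, the one
    that the energy controls; dividing by \<open>K1\<close> accounts for coercivity.\<close>
  define c where "c = (2 * L) powr (p - 1) / K1"
  have c: "0 \<le> c" using K by (simp add: c_def)
  have cJ: "c * J \<le> 2 * Cy / K1 * b powr p * e"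
  proof -
    have "c * J \<le> c * (2 * Cy * (real m * L / R) powr p * (2 * L * e))" using J c by (rule mult_left_mono)
    also have "\<dots> = 2 * Cy / K1 * (((2 * L) powr (p - 1) * (2 * L)) * (real m * L / R) powr p) * e"
      by (simp add: c_def)
    \<comment> \<open>For \<open>L = 0\<close> both sides vanish, a power with base 0 being
      0.\<close>
    also have "(2 * L) powr (p - 1) * (2 * L) = (2 * L) powr p"
      using L_nonneg p by (cases "L = 0") (auto simp: powr_mult_base mult.commute[of "_ powr _"])
    also have "(2 * L) powr p * (real m * L / R) powr p = b powr p"
      using L_nonneg R by (simp add: powr_mult[symmetric] b_def power2_eq_square mult_ac)
    finally show ?thesis .
  qed
  have Hpt: "norm (H x) powr p \<le> 2 powr p * (c * (\<zeta> x * g' (w x) * (F x \<bullet> G x)) + indicator ?E x * b powr p)" if x: "x \<in> cball x0 R" for x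
  proof -
    have w: "0 \<le> w x" "w x \<le> L" using w_range[OF x] by auto
    have \<zeta>: "0 \<le> \<zeta> x" "\<zeta> x \<le> 1" unfolding \<zeta>_def using cutoff_range[OF m(1) r0(1,2)] by auto
    have 1: "norm ((\<zeta> x * g' (w x)) *\<^sub>R G x) powr p \<le> c * (\<zeta> x * g' (w x) * (F x \<bullet> G x))"
    proof -
      let ?y = "\<zeta> x * g' (w x)"
      have y: "0 \<le> ?y" "?y \<le> 1 * (2 * L)" using mult_mono[OF \<zeta>(2) gT(3)[OF w(2)]] g0 \<zeta> by simp_all
      have "norm (?y *\<^sub>R G x) powr p = ?y powr p * norm (G x) powr p"
        using y by (simp add: powr_mult)
      also have "?y powr p = ?y * ?y powr (p - 1)" using y p by (cases "?y = 0") (auto simp: powr_mult_base)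
      also have "?y * ?y powr (p - 1) * norm (G x) powr p \<le> ?y * (2 * L) powr (p - 1) * norm (G x) powr p"
        using y p by (intro mult_right_mono mult_left_mono powr_mono2) auto
      also have "\<dots> = ?y * (2 * L) powr (p - 1) * (K1 * norm (G x) powr p) / K1" using K by simp
      also have "\<dots> \<le> ?y * (2 * L) powr (p - 1) * (F x \<bullet> G x) / K1"
        using y K FG_ge(1)[OF x] by (intro divide_right_mono mult_left_mono) auto
      finally show ?thesis by (simp add: c_def mult_ac)
    qed
    have 2: "norm (g (w x) *\<^sub>R cutoff_grad m R x0 r x) powr p \<le> indicator ?E x * b powr p"
    proof (cases "x \<in> ?E")
      case True
      have "norm (cutoff_grad m R x0 r x) \<le> 2 * real m / R * \<zeta> x powr ((p - 1) / p)"
        unfolding \<zeta>_def by (rule norm_cutoff_grad_le[OF m(1) r0(1,2) p m(2)])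
      also have "\<dots> \<le> 2 * real m / R * 1"
        using R \<zeta> p by (intro mult_left_mono powr_le1) auto
      finally have "norm (cutoff_grad m R x0 r x) \<le> 2 * real m / R" by simp
      from mult_mono[OF gT(2)[OF w(2)] this]
      have "norm (g (w x) *\<^sub>R cutoff_grad m R x0 r x) \<le> L\<^sup>2 * (2 * real m / R)"
        using g0(1)[of "w x"] by simp
      then have "norm (g (w x) *\<^sub>R cutoff_grad m R x0 r x) \<le> b" by (simp add: b_def mult_ac)
      then show ?thesis using True p by (auto intro!: powr_mono2)
    next
      case False
      then have "x \<notin> ball x0 r \<or> w x \<le> k" by (auto simp: level_set_def)
      then have "g (w x) *\<^sub>R cutoff_grad m R x0 r x = 0"
        using cutoff_grad_eq_0[OF m(1) r0(1,2), of x x0] by (auto simp: g_def simp del: mem_ball)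
      then show ?thesis using p False by (simp del: scaleR_eq_0_iff norm_scaleR)
    qed
    have "norm (H x) powr p \<le> 2 powr p * (norm ((\<zeta> x * g' (w x)) *\<^sub>R G x) powr p + norm (g (w x) *\<^sub>R cutoff_grad m R x0 r x) powr p)"
      unfolding H_def by (rule norm_add_powr_le) (use p in simp)
    also have "\<dots> \<le> 2 powr p * (c * (\<zeta> x * g' (w x) * (F x \<bullet> G x)) + indicator ?E x * b powr p)"
      using 1 2 by (intro mult_left_mono add_mono) auto
    finally show ?thesis .
  qed
  have "(\<integral>x. norm (H x) powr p \<partial>B) \<le> (\<integral>x. 2 powr p * (c * (\<zeta> x * g' (w x) * (F x \<bullet> G x)) + indicator ?E x * b powr p) \<partial>B)"
    by (rule integral_mono[OF H_powr_integrable]) (use en1 iE Hpt in \<open>auto simp: space_restrict_space\<close>)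
  also have "\<dots> = 2 powr p * (c * J + e * b powr p)"
    using en1 iE by (simp add: J_def)
  also have "\<dots> \<le> 2 powr p * (2 * Cy / K1 * b powr p * e + e * b powr p)"
    using cJ by (intro mult_left_mono add_right_mono) auto
  finally have HE: "(\<integral>x. norm (H x) powr p \<partial>B) \<le> 2 powr p * (b powr p * (2 * Cy / K1 + 1) * e)"
    by (simp add: algebra_simps)
  have nz: "{x. \<phi> x \<noteq> 0} \<subseteq> ?E"
  proof
    fix x assume "x \<in> {x. \<phi> x \<noteq> 0}"
    then have "\<zeta> x \<noteq> 0" "g (w x) \<noteq> 0" by (auto simp: \<phi>_def)
    then show "x \<in> ?E"
      using cutoff_eq_0[OF m(1) r0(1,2), of x x0] by (auto simp: \<zeta>_def level_set_def g_def max_def split: if_splits)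
  qed
  have fk: "(\<integral>\<^sup>+x. ennreal (\<bar>\<phi> x\<bar> powr p) \<partial>lborel) \<le> ennreal (2 * \<rho> powr p * (2 powr p * (\<integral>x. norm (H x) powr p \<partial>B)))"
  proof (rule faber_krahn[OF \<rho>])
    have "2 * emeasure lborel {x. \<phi> x \<noteq> 0} \<le> 2 * emeasure lborel ?E"
      by (intro mult_left_mono emeasure_mono nz Em) auto
    also have "\<dots> = ennreal (2 * measure lborel ?E)" using lE(3) by (simp add: ennreal_mult)
    also have "\<dots> \<le> ennreal (measure lborel (ball (0::'a) \<rho>))" using small by (rule ennreal_leI)
    also have "\<dots> = emeasure lborel (ball (0::'a) \<rho>)"
      using emeasure_lborel_ball_finite[of "0::'a" \<rho>] by (simp add: emeasure_eq_ennreal_measure)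
    finally show "2 * emeasure lborel {x. \<phi> x \<noteq> 0} \<le> emeasure lborel (ball (0::'a) \<rho>)" .
  qed
  \<comment> \<open>Lower bound of \<open>\<phi>\<close> on the smaller level set: the cutoff
    contributes the radius gap, the profile the square of the level gap.\<close>
  define l where "l = ((r\<^sup>2 - r'\<^sup>2) / R\<^sup>2) ^ m * (k' - k)\<^sup>2"
  have rr: "r'\<^sup>2 \<le> r\<^sup>2" using r by (intro power_mono) auto
  have l0: "0 \<le> l" unfolding l_def using rr by simp
  have "ennreal (l powr p * measure lborel ?E') = (\<integral>\<^sup>+x. ennreal (l powr p) * indicator ?E' x \<partial>lborel)"
    using Em lE'(3) by (simp add: nn_integral_cmult_indicator ennreal_mult)
  also have "\<dots> \<le> (\<integral>\<^sup>+x. ennreal (\<bar>\<phi> x\<bar> powr p) \<partial>lborel)"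
  proof (rule nn_integral_mono)
    fix x
    show "ennreal (l powr p) * indicator ?E' x \<le> ennreal (\<bar>\<phi> x\<bar> powr p)"
    proof (cases "x \<in> ?E'")
      case True
      then have x: "x \<in> ball x0 r'" "k' < w x" by (auto simp: level_set_def)
      have "((r\<^sup>2 - r'\<^sup>2) / R\<^sup>2) ^ m \<le> \<zeta> x"
        unfolding \<zeta>_def by (rule cutoff_ge[OF m(1) r0(1,2) x(1) r(2)])
      moreover have "(k' - k)\<^sup>2 \<le> g (w x)" unfolding g_def using x(2) k by (intro power_mono) auto
      ultimately have "l \<le> \<phi> x" unfolding l_def \<phi>_def using \<zeta>_nonneg by (intro mult_mono) auto
      then have "l powr p \<le> \<bar>\<phi> x\<bar> powr p" using l0 p by (intro powr_mono2) auto
      then show ?thesis using True by (simp add: ennreal_leI)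
    qed simp
  qed
  also note fk
  also have "ennreal (2 * \<rho> powr p * (2 powr p * (\<integral>x. norm (H x) powr p \<partial>B))) \<le> ennreal (2 * \<rho> powr p * (2 powr p * (2 powr p * (b powr p * (2 * Cy / K1 + 1) * e))))"
    using HE by (intro ennreal_leI mult_left_mono) auto
  finally have "l powr p * measure lborel ?E' \<le> 2 * \<rho> powr p * (2 powr p * (2 powr p * (b powr p * (2 * Cy / K1 + 1) * e)))"
    using e0 K Cy by (subst (asm) ennreal_le_iff) auto
  \<comment> \<open>One factor \<open>2 powr p\<close> stems from the translation estimate, the
    other from splitting \<open>H\<close> into its two summands.\<close>
  also have "2 powr p * (2 powr p * (b powr p * (2 * Cy / K1 + 1) * e)) = 4 powr p * (b powr p * (2 * Cy / K1 + 1) * e)"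
    using powr_mult[of 2 2 p] by (simp add: mult.assoc[symmetric])
  finally show ?thesis by (simp add: l_def b_def e_def mult.assoc)
qed

end

context subsolution_ball
begin

text \<open>De Giorgi iteration over the levels \<open>k j = M/2 - M/2^(j+2)\<close> and the radii \<open>r j = R/2 + R/2^(j+1)\<close>.
  The invariant compares the level sets with balls of geometrically decreasing radius \<open>\<theta> R \<sigma>^j\<close>,
  so that no recursion with a superlinear power has to be solved.\<close>

lemma level_set_density:
  fixes M \<Lambda> \<theta> :: real
  defines "\<sigma> \<equiv> (1 / 2) ^ (m + 2)"
  assumes M: "0 < M" "M \<le> w x0" and L: "L \<le> \<Lambda> * M" and \<theta>: "0 < \<theta>"
    "2 * (\<theta> * (8 * real m * \<Lambda>\<^sup>2)) powr p * (2 * Cy / K1 + 1) \<le> \<sigma> ^ DIM('a) * (\<sigma> ^ 3) powr p"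
  shows "measure lborel (ball (0::'a) (\<theta> * R)) < 2 * measure lborel (level_set (M / 4) R)"
proof (rule ccontr)
  assume "\<not> ?thesis"
  then have small: "2 * measure lborel (level_set (M / 4) R) \<le> measure lborel (ball (0::'a) (\<theta> * R))" by simp
  have "(1 / 2 :: real) ^ (m + 2) < (1 / 2) ^ 0" by (rule power_strict_decreasing) auto
  then have \<sigma>: "0 < \<sigma>" "\<sigma> < 1" by (simp_all only: \<sigma>_def power_0) simp
  define C1 where "C1 = 2 * Cy / K1 + 1"
  have C1: "0 \<le> C1" using K Cy by (simp add: C1_def)
  define r where "r j = R / 2 + R / 2 ^ (j + 1)" for j :: nat
  define k where "k j = M / 2 - M / 2 ^ (j + 2)" for j :: nat
  define \<rho> where "\<rho> j = \<theta> * R * \<sigma> ^ j" for j :: nat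
  have r: "0 < r j" "r (Suc j) \<le> r j" "r j \<le> R" "R / 2 \<le> r j" for j
  proof -
    show "0 < r j" "R / 2 \<le> r j" "r (Suc j) \<le> r j" using R by (auto simp: r_def add_pos_pos field_simps)
    have "R / 2 ^ (j + 1) \<le> R / 2" using R by (intro divide_left_mono) auto
    then show "r j \<le> R" by (simp add: r_def)
  qed
  have k: "0 \<le> k j" "k j \<le> k (Suc j)" "k j \<le> M / 2" for j
  proof -
    have "(2::real) ^ 1 \<le> 2 ^ (j + 2)" by (rule power_increasing) auto
    then have "M / 2 ^ (j + 2) \<le> M / 2" using M by (intro divide_left_mono) auto
    then show "0 \<le> k j" by (simp add: k_def)
    show "k j \<le> k (Suc j)" "k j \<le> M / 2" using M by (auto simp: k_def field_simps)
  qed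
  have \<rho>: "0 < \<rho> j" for j using \<theta> R \<sigma> by (simp add: \<rho>_def)
  have ball_measure: "measure lborel (ball (0::'a) s) = s ^ DIM('a) * measure lborel (ball (0::'a) 1)" if "0 < s" for s
    by (rule content_ball_conv_unit_ball) (use that in simp)
  have inv: "2 * measure lborel (level_set (k j) (r j)) \<le> measure lborel (ball (0::'a) (\<rho> j))" for j
  proof (induction j)
    case 0
    have "k 0 = M / 4" "r 0 = R" "\<rho> 0 = \<theta> * R" by (auto simp: k_def r_def \<rho>_def)
    then show ?case using small by (simp only:)
  next
    case (Suc j)
    define e where "e = measure lborel (level_set (k j) (r j))"
    define e' where "e' = measure lborel (level_set (k (Suc j)) (r (Suc j)))"
    have e: "0 \<le> e" "0 \<le> e'" by (auto simp: e_def e'_def)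
    \<comment> \<open>Common scale of both gaps: the levels differ by \<open>M * h\<close>, and the
      relative gap of the squared radii is at least \<open>h\<close>. The test function is therefore
      at least of order \<open>h ^ (m + 2)\<close>, which is \<open>\<sigma> ^ (j + 3)\<close>; this
      dictates the choice of \<open>\<sigma>\<close>, and the offset 3 reappears in the condition on
      \<open>\<theta>\<close>.\<close>
    define h :: real where "h = (1 / 2) ^ (j + 3)"
    have h: "0 < h" by (simp add: h_def)
    define l where "l = (((r j)\<^sup>2 - (r (Suc j))\<^sup>2) / R\<^sup>2) ^ m * (k (Suc j) - k j)\<^sup>2"
    have "h \<le> ((r j)\<^sup>2 - (r (Suc j))\<^sup>2) / R\<^sup>2"
    proof -
      have "r j - r (Suc j) = 2 * (h * R)" by (simp add: r_def h_def power_divide power_add field_simps)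
      moreover have "R \<le> r j + r (Suc j)" using r(4)[of j] r(4)[of "Suc j"] by simp
      ultimately have "(h * R) * R \<le> (r j - r (Suc j)) * (r j + r (Suc j))"
        using h R by (intro mult_mono) auto
      also have "\<dots> = (r j)\<^sup>2 - (r (Suc j))\<^sup>2" by (simp add: power2_eq_square algebra_simps)
      finally show ?thesis using R by (simp add: le_divide_eq power2_eq_square)
    qed
    then have "h ^ m \<le> (((r j)\<^sup>2 - (r (Suc j))\<^sup>2) / R\<^sup>2) ^ m" using h by (intro power_mono) auto
    moreover have "k (Suc j) - k j = M * h" by (simp add: k_def h_def power_divide power_add field_simps)
    ultimately have l1: "h ^ m * (M * h)\<^sup>2 \<le> l" unfolding l_def by (simp add: mult_right_mono)
    have h\<sigma>: "h ^ (m + 2) = \<sigma> ^ (j + 3)" unfolding h_def \<sigma>_def by (simp only: power_mult[symmetric] mult.commute)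
    have "M\<^sup>2 * \<sigma> ^ j * \<sigma> ^ 3 = M\<^sup>2 * h ^ (m + 2)" unfolding h\<sigma> by (simp only: power_add mult.assoc)
    also have "\<dots> = h ^ m * (M * h)\<^sup>2" by (simp add: power_mult_distrib power_add power2_eq_square mult_ac)
    finally have l: "M\<^sup>2 * \<sigma> ^ j * \<sigma> ^ 3 \<le> l" using l1 by (simp only:)
    \<comment> \<open>\<open>z\<close> occurs on both sides: on the left through the shrinking gaps,
      on the right through the shrinking radius \<open>\<rho> j\<close> and the bound of
      \<open>L\<close> by \<open>\<Lambda> * M\<close>. It cancels, so a single smallness condition
      on \<open>\<theta>\<close> serves every step.\<close>
    define z where "z = M\<^sup>2 * \<sigma> ^ j"
    have z: "0 < z" using M \<sigma> by (simp add: z_def)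
    have "z powr p * ((\<sigma> ^ 3) powr p * e') = (z * \<sigma> ^ 3) powr p * e'"
      using z \<sigma> by (simp add: powr_mult)
    also have "\<dots> \<le> l powr p * e'"
      using l z \<sigma> p e by (intro mult_right_mono powr_mono2) (auto simp: z_def)
    also have "\<dots> \<le> 2 * \<rho> j powr p * 4 powr p * (2 * real m * L\<^sup>2 / R) powr p * C1 * e"
      unfolding l_def e'_def e_def C1_def
      by (rule level_set_step) (use r k \<rho> Suc.IH in auto)
    also have "\<dots> = 2 * (\<rho> j * 4 * (2 * real m * L\<^sup>2 / R)) powr p * C1 * e"
      unfolding powr_mult[of "\<rho> j * 4"] powr_mult[of "\<rho> j"] by (simp only: mult.assoc)
    also have "\<dots> \<le> 2 * ((\<theta> * (8 * real m * \<Lambda>\<^sup>2)) * z) powr p * C1 * e"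
    proof (intro mult_right_mono mult_left_mono powr_mono2)
      have "L\<^sup>2 \<le> (\<Lambda> * M)\<^sup>2" using L L_nonneg by (intro power_mono) auto
      then have "\<theta> * \<sigma> ^ j * 8 * real m * L\<^sup>2 \<le> \<theta> * \<sigma> ^ j * 8 * real m * (\<Lambda> * M)\<^sup>2"
        using \<theta> \<sigma> by (intro mult_left_mono) auto
      then show "\<rho> j * 4 * (2 * real m * L\<^sup>2 / R) \<le> \<theta> * (8 * real m * \<Lambda>\<^sup>2) * z"
        using R by (simp add: \<rho>_def z_def power_mult_distrib mult_ac)
      show "0 \<le> \<rho> j * 4 * (2 * real m * L\<^sup>2 / R)" using \<rho>[of j] R by simp
    qed (use p C1 e in auto)
    also have "\<dots> = z powr p * ((2 * (\<theta> * (8 * real m * \<Lambda>\<^sup>2)) powr p * C1) * e)"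
      unfolding powr_mult[of _ z] by (simp only: mult_ac)
    also have "\<dots> \<le> z powr p * ((\<sigma> ^ DIM('a) * (\<sigma> ^ 3) powr p) * e)"
      using \<theta>(2) e by (intro mult_left_mono mult_right_mono) (auto simp: C1_def)
    finally have "(z powr p * (\<sigma> ^ 3) powr p) * e' \<le> (z powr p * (\<sigma> ^ 3) powr p) * (\<sigma> ^ DIM('a) * e)"
      by (simp only: mult_ac)
    then have "e' \<le> \<sigma> ^ DIM('a) * e"
      by (rule mult_left_le_imp_le) (use z \<sigma> in simp)
    then have "2 * e' \<le> \<sigma> ^ DIM('a) * (2 * e)" by simp
    also have "\<dots> \<le> \<sigma> ^ DIM('a) * measure lborel (ball (0::'a) (\<rho> j))"
      using Suc.IH \<sigma> by (intro mult_left_mono) (auto simp: e_def)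
    also have "\<dots> = measure lborel (ball (0::'a) (\<rho> (Suc j)))"
      unfolding ball_measure[OF \<rho>] by (simp add: \<rho>_def power_mult_distrib mult_ac)
    finally show ?case by (simp add: e'_def)
  qed
  let ?E = "level_set (M / 2) (R / 2)"
  have R2: "R / 2 \<le> R" using R by simp
  note lE = level_set[OF R2, of "M / 2"]
  have le: "2 * measure lborel ?E \<le> (\<theta> * R * \<sigma> ^ j) ^ DIM('a) * measure lborel (ball (0::'a) 1)" for j
  proof -
    have "?E \<subseteq> level_set (k j) (r j)" using r(4)[of j] k(3)[of j] by (auto simp: level_set_def)
    then have "emeasure lborel ?E \<le> emeasure lborel (level_set (k j) (r j))"
      using level_set(1)[OF r(3)] by (intro emeasure_mono) auto
    then have "measure lborel ?E \<le> measure lborel (level_set (k j) (r j))"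
      unfolding lE(3) level_set(3)[OF r(3)] by (simp add: ennreal_le_iff)
    then show ?thesis using inv[of j] ball_measure[OF \<rho>[of j]] by (simp add: \<rho>_def)
  qed
  have "(\<lambda>j. (\<theta> * R * \<sigma> ^ j) ^ DIM('a) * measure lborel (ball (0::'a) 1)) \<longlonglongrightarrow> (\<theta> * R * 0) ^ DIM('a) * measure lborel (ball (0::'a) 1)"
    using \<sigma> by (intro tendsto_intros LIMSEQ_power_zero) auto
  then have "2 * measure lborel ?E \<le> (\<theta> * R * 0) ^ DIM('a) * measure lborel (ball (0::'a) 1)"
    by (rule LIMSEQ_le_const) (use le in auto)
  then have "measure lborel ?E \<le> 0" by (simp add: zero_power)
  moreover have "0 < measure lborel ?E"
  proof -
    \<comment> \<open>The limiting set is open by continuity and contains the centre, because M/2 is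
      less than \<open>w x0\<close>; it cannot be null.\<close>
    have "x0 \<in> ?E" using M R by (auto simp: level_set_def)
    then obtain e where e: "0 < e" "ball x0 e \<subseteq> ?E" using lE(1) by (auto simp: open_contains_ball)
    have "emeasure lborel (ball x0 e) \<le> emeasure lborel ?E" using e lE(1) by (intro emeasure_mono) auto
    then have "ennreal (measure lborel (ball x0 e)) \<le> ennreal (measure lborel ?E)"
      using emeasure_lborel_ball_finite[of x0 e] lE(3) by (simp add: emeasure_eq_ennreal_measure)
    then have "measure lborel (ball x0 e) \<le> measure lborel ?E" by (simp add: ennreal_le_iff)
    then show ?thesis using content_ball_pos[OF e(1), of x0] by (rule less_le_trans[rotated])
  qed
  ultimately show False by simp
qed

end

section \<open>One unknown controls the other\<close>

lemma subsolution_ballI: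
  assumes "open \<Omega>" "1 < p" "0 < R" "R < R'" "cball x0 R' \<subseteq> \<Omega>" "continuous_on \<Omega> w"
    and "strongly_coercive p K1 K2 \<Omega> A" "weak_le p \<Omega> A w (\<lambda>x. - f x)" "\<And>x. x \<in> \<Omega> \<Longrightarrow> 0 \<le> f x"
    and "\<And>x. x \<in> cball x0 R' \<Longrightarrow> w x \<le> L" "2 \<le> m" "p \<le> real m" "0 < Cy"
    and "\<And>a b. 0 \<le> a \<Longrightarrow> 0 \<le> b \<Longrightarrow> a * b \<le> K2 / 2 * a powr (p / (p - 1)) + Cy * b powr p"
  obtains G where "subsolution_ball \<Omega> p w G x0 R R' L A K1 K2 f m Cy"
proof -
  obtain G where G: "W1p_loc p \<Omega> w G" "Lp_loc (p / (p - 1)) \<Omega> (\<lambda>x. A x (w x) (G x))"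
    "\<And>\<psi> K. W1inf \<Omega> \<psi> K \<Longrightarrow> compactly_supported_in \<Omega> \<psi> \<Longrightarrow> (\<And>x. x \<in> \<Omega> \<Longrightarrow> 0 \<le> \<psi> x) \<Longrightarrow>
       (LINT x|lebesgue_on \<Omega>. A x (w x) (G x) \<bullet> K x) \<le> (LINT x|lebesgue_on \<Omega>. - f x * \<psi> x)"
    using assms(8) unfolding weak_le_def by blast
  have "Lp_loc 1 \<Omega> (\<lambda>x. - f x)" "\<And>x. x \<in> \<Omega> \<Longrightarrow> 0 \<le> w x" using assms(8) by (auto simp: weak_le_def)
  then have "subsolution_ball \<Omega> p w G x0 R R' L A K1 K2 f m Cy"
    using assms G by unfold_locales blast+
  then show ?thesis by (rule that)
qed

lemma exponent_bound:
  obtains m :: nat where "2 \<le> m" "p \<le> real m"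
  using that[of "max 2 (nat \<lceil>p\<rceil>)"] by (auto simp: le_max_iff_disj real_nat_ceiling_ge of_nat_max max.coboundedI2)

text \<open>By De Giorgi, \<open>v\<close> exceeds a quarter of \<open>v x0\<close> on a fixed
  fraction of a ball, so the averaged bound on \<open>v powr \<delta>\<close> becomes a bound at the
  centre. The absorption term for \<open>v\<close> is a general nonnegative \<open>h\<close>, since
  the density result asks for its sign alone. \<open>C\<close> is fixed before domain, operators and
  solutions, as the dependence of the final constant demands.\<close>

lemma cross_estimate:
  fixes p q \<delta> \<Lambda> K1p K2p K1q K2q :: real
  assumes p: "1 < p" and q: "1 < q" and K: "0 < K1p" "0 < K2p" "0 < K1q" "0 < K2q" and \<Lambda>: "0 < \<Lambda>"
  obtains C where "0 < C"
    "\<And>(\<Omega>::'a::euclidean_space set) Ap Aq u v h x0 R S. open \<Omega> \<Longrightarrow> 0 < R \<Longrightarrow> cball x0 R \<subseteq> \<Omega> \<Longrightarrow>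
      strongly_coercive p K1p K2p \<Omega> Ap \<Longrightarrow> strongly_coercive q K1q K2q \<Omega> Aq \<Longrightarrow>
      continuous_on \<Omega> u \<Longrightarrow> continuous_on \<Omega> v \<Longrightarrow>
      weak_le p \<Omega> Ap u (\<lambda>x. - (v x powr \<delta>)) \<Longrightarrow> weak_le q \<Omega> Aq v (\<lambda>x. - h x) \<Longrightarrow>
      (\<And>x. x \<in> \<Omega> \<Longrightarrow> 0 \<le> h x) \<Longrightarrow> 0 \<le> \<delta> \<Longrightarrow> 0 < v x0 \<Longrightarrow> (\<And>x. x \<in> cball x0 R \<Longrightarrow> v x \<le> \<Lambda> * v x0) \<Longrightarrow>
      0 < S \<Longrightarrow> (\<And>x. x \<in> cball x0 R \<Longrightarrow> u x \<le> S) \<Longrightarrow>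
      v x0 powr \<delta> \<le> C * S powr (p - 1) * R powr (- p)"
proof -
  obtain Cp where Cp: "0 < Cp" "\<And>a b. 0 \<le> a \<Longrightarrow> 0 \<le> b \<Longrightarrow> a * b \<le> K2p / 2 * a powr (p / (p - 1)) + Cp * b powr p"
    using young_scaled[OF p, of "K2p / 2"] K by auto
  obtain Cq where Cq: "0 < Cq" "\<And>a b. 0 \<le> a \<Longrightarrow> 0 \<le> b \<Longrightarrow> a * b \<le> K2q / 2 * a powr (q / (q - 1)) + Cq * b powr q"
    using young_scaled[OF q, of "K2q / 2"] K by auto
  obtain m :: nat where m: "2 \<le> m" "p \<le> real m" by (rule exponent_bound)
  obtain n :: nat where n: "2 \<le> n" "q \<le> real n" by (rule exponent_bound)
  define \<sigma> :: real where "\<sigma> = (1 / 2) ^ (n + 2)"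
  define C1 where "C1 = 2 * Cq / K1q + 1"
  define X where "X = \<sigma> ^ DIM('a) * (\<sigma> ^ 3) powr q / (2 * C1)"
  \<comment> \<open>\<open>\<theta>\<close> solves the smallness condition of
    \<open>level_set_density\<close> with equality; \<open>X\<close> is the value which that
    condition permits for the q-th power.\<close>
  define \<theta> where "\<theta> = X powr (1 / q) / (8 * real n * \<Lambda>\<^sup>2)"
  have C1: "0 < C1" using K Cq by (simp add: C1_def add_pos_pos)
  have \<sigma>: "0 < \<sigma>" by (simp add: \<sigma>_def)
  have X: "0 < X" using C1 \<sigma> by (simp add: X_def)
  have \<theta>: "0 < \<theta>" using X n \<Lambda> by (simp add: \<theta>_def)
  have "\<theta> * (8 * real n * \<Lambda>\<^sup>2) = X powr (1 / q)" using n \<Lambda> by (simp add: \<theta>_def)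
  then have "(\<theta> * (8 * real n * \<Lambda>\<^sup>2)) powr q = X" using X q by (simp add: powr_powr)
  then have \<theta>X: "2 * (\<theta> * (8 * real n * \<Lambda>\<^sup>2)) powr q * (2 * Cq / K1q + 1) \<le> \<sigma> ^ DIM('a) * (\<sigma> ^ 3) powr q"
    using C1 by (simp add: X_def C1_def[symmetric])
  \<comment> \<open>(3/4)^m is the cutoff on the half ball; the rest is the guaranteed fraction of
    the ball of radius R/2 that the level set fills.\<close>
  define a where "a = (3 / 4) ^ m * (\<theta> / 2) ^ DIM('a) / 2"
  have a: "0 < a" using \<theta> by (simp add: a_def)
  define C where "C = 4 powr \<delta> * Cp * (8 * real m) powr p / a"
  have C: "0 < C" using Cp a m by (simp add: C_def)
  show ?thesis
  proof (rule that[OF C])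
    fix \<Omega> :: "'a set" and Ap Aq u v h x0 R S
    assume op: "open \<Omega>" and R: "0 < R" "cball x0 R \<subseteq> \<Omega>"
      and co: "strongly_coercive p K1p K2p \<Omega> Ap" "strongly_coercive q K1q K2q \<Omega> Aq"
      and cont: "continuous_on \<Omega> u" "continuous_on \<Omega> v"
      and we: "weak_le p \<Omega> Ap u (\<lambda>x. - (v x powr \<delta>))" "weak_le q \<Omega> Aq v (\<lambda>x. - h x)"
      and h: "\<And>x. x \<in> \<Omega> \<Longrightarrow> 0 \<le> h x" and \<delta>: "0 \<le> \<delta>" and v0: "0 < v x0"
      and vL: "\<And>x. x \<in> cball x0 R \<Longrightarrow> v x \<le> \<Lambda> * v x0"
      and S: "0 < S" and uS: "\<And>x. x \<in> cball x0 R \<Longrightarrow> u x \<le> S"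
    \<comment> \<open>\<open>v\<close> gets the radius R/4 because the averaged bound on the ball of
      radius R/2 sees only subsets of its concentric half.\<close>
    have R': "0 < R / 2" "R / 2 < R" "0 < R / 4" "R / 4 < R" using R by auto
    obtain Gu where "subsolution_ball \<Omega> p u Gu x0 (R / 2) R S Ap K1p K2p (\<lambda>x. v x powr \<delta>) m Cp"
      by (rule subsolution_ballI[OF op p R'(1,2) R(2) cont(1) co(1) we(1) _ uS m Cp]) auto
    then interpret U: subsolution_ball \<Omega> p u Gu x0 "R / 2" R S Ap K1p K2p "\<lambda>x. v x powr \<delta>" m Cp .
    obtain Gv where "subsolution_ball \<Omega> q v Gv x0 (R / 4) R (\<Lambda> * v x0) Aq K1q K2q h n Cq"
      by (rule subsolution_ballI[OF op q R'(3,4) R(2) cont(2) co(2) we(2) h vL n Cq]) auto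
    then interpret V: subsolution_ball \<Omega> q v Gv x0 "R / 4" R "\<Lambda> * v x0" Aq K1q K2q h n Cq .
    define E where "E = V.level_set (v x0 / 4) (R / 4)"
    define b where "b = measure lborel (ball (0::'a) 1)"
    have b: "0 < b" unfolding b_def by (rule content_ball_pos) simp
    have E: "open E" "E \<subseteq> ball x0 (R / 2 / 2)"
      unfolding E_def by (rule V.level_set) (auto simp: V.level_set_def)
    have "measure lborel (ball (0::'a) (\<theta> * (R / 4))) < 2 * measure lborel E"
      unfolding E_def by (rule V.level_set_density[OF v0 order_refl order_refl \<theta>]) (use \<theta>X in \<open>simp add: \<sigma>_def\<close>)
    then have "(\<theta> / 2 * (R / 2)) ^ DIM('a) * b \<le> 2 * measure lborel E"
      using \<theta> R content_ball_conv_unit_ball[of "\<theta> * (R / 4)" "0::'a"] by (simp add: b_def)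
    then have "(\<theta> / 2) ^ DIM('a) * ((R / 2) ^ DIM('a) * b) \<le> 2 * measure lborel E"
      by (simp only: power_mult_distrib mult.assoc)
    moreover have "measure lebesgue E = measure lborel E" using E(1) by (simp add: measure_completion)
    ultimately have Em: "(\<theta> / 2) ^ DIM('a) / 2 * ((R / 2) ^ DIM('a) * b) \<le> measure lebesgue E"
      by linarith
    define c where "c = (v x0 / 4) powr \<delta>"
    have cv: "c \<le> v x powr \<delta>" if "x \<in> E" for x
      using that v0 \<delta> by (auto simp: c_def E_def V.level_set_def intro!: powr_mono2)
    have c0: "0 \<le> c" by (simp add: c_def)
    define y where "y = (R / 2) ^ DIM('a) * b"
    have y: "0 < y" using R b by (simp add: y_def)
    have "S * (c * (3 / 4) ^ m * ((\<theta> / 2) ^ DIM('a) / 2 * y)) \<le> S * (c * (3 / 4) ^ m * measure lebesgue E)"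
      using Em S c0 by (intro mult_left_mono) (auto simp: y_def)
    also have "\<dots> \<le> Cp * (4 * real m * S / (R / 2)) powr p * measure lebesgue (ball x0 (R / 2))"
      by (rule U.f_average_le[OF S order_refl _ E(2) c0 cv]) (use E in auto)
    also have "measure lebesgue (ball x0 (R / 2)) = y"
      using R content_ball_conv_unit_ball[of "R / 2" x0] by (simp add: y_def b_def)
    finally have "(S * (c * a)) * y \<le> (Cp * (8 * real m * S / R) powr p) * y"
      by (simp add: a_def mult_ac)
    then have "S * (c * a) \<le> Cp * (8 * real m * S / R) powr p" using y by simp
    also have "(8 * real m * S / R) powr p = (8 * real m) powr p * (S powr (p - 1) * S) * R powr (- p)"
      using S R m by (simp add: powr_mult powr_divide powr_minus_divide powr_mult_base mult.commute[of _ S])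
    finally have "S * (c * a) \<le> S * (Cp * (8 * real m) powr p * S powr (p - 1) * R powr (- p))"
      by (simp add: mult_ac)
    then have "c * a \<le> Cp * (8 * real m) powr p * S powr (p - 1) * R powr (- p)" using S by simp
    then have "4 powr \<delta> * c \<le> C * S powr (p - 1) * R powr (- p)"
      using a by (simp add: C_def field_simps)
    moreover have "4 powr \<delta> * c = v x0 powr \<delta>"
      using v0 by (simp add: c_def powr_mult[symmetric])
    ultimately show "v x0 powr \<delta> \<le> C * S powr (p - 1) * R powr (- p)" by simp
  qed
qed

section \<open>The coupled estimate\<close>

lemma weighted_maximum:
  fixes u :: "'a::euclidean_space \<Rightarrow> real"
  assumes "0 < R" "continuous_on (cball x0 R) u" "\<And>x. x \<in> cball x0 R \<Longrightarrow> 0 \<le> u x" "0 < \<gamma>"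
  obtains x1 where "x1 \<in> cball x0 R"
    "\<And>x. x \<in> cball x0 R \<Longrightarrow> u x * (R - dist x0 x) powr \<gamma> \<le> u x1 * (R - dist x0 x1) powr \<gamma>"
proof -
  have "continuous_on (cball x0 R) (\<lambda>x. u x * (R - dist x0 x) powr \<gamma>)"
    by (intro continuous_on_mult assms continuous_on_powr' continuous_intros) (use assms in auto)
  then show ?thesis
    using continuous_attains_sup[of "cball x0 R" "\<lambda>x. u x * (R - dist x0 x) powr \<gamma>"] assms(1) that by auto
qed

text \<open>On the ball of radius \<open>d / 2\<close> about the maximum point the weight keeps at
  least half of its central base, so \<open>v\<close> is at most \<open>2 powr \<xi>\<close> times
  its central value and \<open>u\<close> is bounded through \<open>t\<close>. Hence
  \<open>cross\<close> applies there, and \<open>exps\<close> cancels all powers of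
  \<open>d\<close>. The bound is stated for any positive \<open>t\<close> above the maximum for
  \<open>u\<close>, because that maximum may be zero.\<close>

lemma weighted_max_estimate:
  fixes u v :: "'a::euclidean_space \<Rightarrow> real"
  assumes R: "0 < R" and pos: "0 < \<gamma>" "0 < \<xi>" "0 < \<delta>" "0 \<le> C"
    and exps: "\<xi> * \<delta> = \<gamma> * (p - 1) + p" and p: "1 < p"
    and nn: "\<And>x. x \<in> cball x0 R \<Longrightarrow> 0 \<le> u x" "\<And>x. x \<in> cball x0 R \<Longrightarrow> 0 \<le> v x"
    and cross: "\<And>x r S. 0 < r \<Longrightarrow> cball x r \<subseteq> cball x0 R \<Longrightarrow> 0 < v x \<Longrightarrow> (\<And>y. y \<in> cball x r \<Longrightarrow> v y \<le> 2 powr \<xi> * v x) \<Longrightarrow>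
      0 < S \<Longrightarrow> (\<And>y. y \<in> cball x r \<Longrightarrow> u y \<le> S) \<Longrightarrow> v x powr \<delta> \<le> C * S powr (p - 1) * r powr (- p)"
    and x1: "x1 \<in> cball x0 R" and max_v: "\<And>x. x \<in> cball x0 R \<Longrightarrow> v x * (R - dist x0 x) powr \<xi> \<le> v x1 * (R - dist x0 x1) powr \<xi>"
    and t: "0 < t" "\<And>x. x \<in> cball x0 R \<Longrightarrow> u x * (R - dist x0 x) powr \<gamma> \<le> t"
  shows "(v x1 * (R - dist x0 x1) powr \<xi>) powr \<delta> \<le> C * 2 powr (\<xi> * \<delta>) * t powr (p - 1)"
\<comment> \<open>A zero maximum makes the left side vanish; a nonzero one forces \<open>x1\<close>
  into the open ball, so that \<open>d\<close> is positive.\<close>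
proof (cases "v x1 * (R - dist x0 x1) powr \<xi> = 0")
  case True
  show ?thesis unfolding True using pos by simp
next
  case False
  define d where "d = R - dist x0 x1"
  have d: "0 < d" and v1: "0 < v x1"
    using False x1 nn(2)[OF x1] by (auto simp: d_def less_le)
  have far: "d / 2 \<le> R - dist x0 y" "y \<in> cball x0 R" if "y \<in> cball x1 (d / 2)" for y
  proof -
    show "d / 2 \<le> R - dist x0 y" using that dist_triangle[of x0 y x1] by (simp add: d_def field_simps)
    then show "y \<in> cball x0 R" using d by simp
  qed
  have weight: "f y \<le> s * (d / 2) powr (- \<beta>)"
    if y: "y \<in> cball x1 (d / 2)" and f: "f y * (R - dist x0 y) powr \<beta> \<le> s" "0 \<le> f y" and \<beta>: "0 < \<beta>" for f y s \<beta>
  proof -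
    have "f y * (d / 2) powr \<beta> \<le> f y * (R - dist x0 y) powr \<beta>"
      using far(1)[OF y] d f \<beta> by (intro mult_left_mono powr_mono2) auto
    then have "f y * (d / 2) powr \<beta> \<le> s" using f by simp
    then show ?thesis using d by (simp add: powr_minus field_simps)
  qed
  define S where "S = t * (d / 2) powr (- \<gamma>)"
  have "v x1 powr \<delta> \<le> C * S powr (p - 1) * (d / 2) powr (- p)"
  proof (rule cross)
    show "0 < d / 2" "0 < v x1" "0 < S" using d v1 t by (auto simp: S_def)
    show "cball x1 (d / 2) \<subseteq> cball x0 R" using far(2) by blast
    fix y assume y: "y \<in> cball x1 (d / 2)"
    show "u y \<le> S" unfolding S_def by (rule weight[where f=u, OF y]) (use far(2)[OF y] t(2) nn(1) pos in auto)
    have "v y \<le> (v x1 * d powr \<xi>) * (d / 2) powr (- \<xi>)"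
      unfolding d_def[symmetric] by (rule weight[where f=v, OF y]) (use far(2)[OF y] max_v nn(2) pos in \<open>auto simp: d_def\<close>)
    also have "\<dots> = 2 powr \<xi> * v x1" using d by (simp add: powr_divide powr_minus field_simps)
    finally show "v y \<le> 2 powr \<xi> * v x1" .
  qed
  also have "\<dots> = C * t powr (p - 1) * (d / 2) powr (- (\<xi> * \<delta>))"
  proof -
    have e: "- \<gamma> * (p - 1) + - p = - (\<xi> * \<delta>)" by (simp add: exps)
    have "S powr (p - 1) = t powr (p - 1) * (d / 2) powr (- \<gamma> * (p - 1))"
      using t d by (simp add: S_def powr_mult powr_powr)
    then show ?thesis unfolding e[symmetric] powr_add by (simp only: mult.assoc)
  qed
  also have "\<dots> = C * 2 powr (\<xi> * \<delta>) * t powr (p - 1) * d powr (- (\<xi> * \<delta>))"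
    using d by (simp add: powr_divide powr_minus field_simps)
  finally have "v x1 powr \<delta> * d powr (\<xi> * \<delta>) \<le> C * 2 powr (\<xi> * \<delta>) * t powr (p - 1)"
    using d by (simp add: powr_minus field_simps)
  then show ?thesis using d v1 by (simp add: d_def[symmetric] powr_mult powr_powr)
qed

text \<open>Inserting the first bound into the second eliminates \<open>b\<close> and leaves
  \<open>a\<close> to the power \<open>\<delta> * \<mu>\<close> against \<open>a\<close> to the
  power \<open>(p - 1) * (q - 1)\<close>; the surplus of exponents is positive, so a root can be
  taken.\<close>

lemma coupled_power_bound:
  fixes a b :: real
  assumes ab: "0 \<le> a" "0 \<le> b" and A: "0 < A1" "0 < A2" and exps: "1 < p" "1 < q" "0 < \<delta>" "0 < \<mu>"
    and D: "0 < \<delta> * \<mu> - (p - 1) * (q - 1)"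
    and 1: "\<And>t. 0 < t \<Longrightarrow> a \<le> t \<Longrightarrow> b powr \<delta> \<le> A1 * t powr (p - 1)"
    and 2: "\<And>t. 0 < t \<Longrightarrow> b \<le> t \<Longrightarrow> a powr \<mu> \<le> A2 * t powr (q - 1)"
  shows "a \<le> (A2 powr \<delta> * A1 powr (q - 1)) powr (1 / (\<delta> * \<mu> - (p - 1) * (q - 1)))"
proof (cases "a = 0")
  case False
  let ?D = "\<delta> * \<mu> - (p - 1) * (q - 1)"
  have a: "0 < a" using False ab by simp
  \<comment> \<open>The bound on \<open>b\<close> is used in place of \<open>b\<close> itself: it is
    positive even if \<open>b = 0\<close>, as the second hypothesis requires.\<close>
  define t where "t = (A1 * a powr (p - 1)) powr (1 / \<delta>)"
  have t: "0 < t" using A a by (simp add: t_def)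
  have "b = (b powr \<delta>) powr (1 / \<delta>)" using ab exps by (simp add: powr_powr)
  also have "\<dots> \<le> t" unfolding t_def using 1[OF a order_refl] exps by (intro powr_mono2) auto
  finally have "a powr \<mu> \<le> A2 * t powr (q - 1)" using 2 t by blast
  then have "(a powr \<mu>) powr \<delta> \<le> (A2 * t powr (q - 1)) powr \<delta>" using exps by (intro powr_mono2) auto
  also have "\<dots> = A2 powr \<delta> * (A1 powr (q - 1) * a powr ((p - 1) * (q - 1)))"
    using A a exps by (simp add: t_def powr_mult powr_powr)
  finally have "a powr (\<delta> * \<mu>) \<le> A2 powr \<delta> * A1 powr (q - 1) * a powr ((p - 1) * (q - 1))"
    by (simp add: powr_powr mult_ac)
  then have "a powr ?D \<le> A2 powr \<delta> * A1 powr (q - 1)"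
    using a by (simp add: powr_diff divide_le_eq)
  then have "(a powr ?D) powr (1 / ?D) \<le> (A2 powr \<delta> * A1 powr (q - 1)) powr (1 / ?D)"
    using D by (intro powr_mono2) auto
  then show ?thesis using a D by (simp add: powr_powr)
qed simp

section \<open>From balls inside the domain to the distance from its boundary\<close>

lemma cball_subset_if_less_infdist:
  fixes \<Omega> :: "'a::euclidean_space set"
  assumes x: "x \<in> \<Omega>" and R: "frontier \<Omega> = {} \<or> R < infdist x (frontier \<Omega>)"
  shows "cball x R \<subseteq> \<Omega>"
proof (rule ccontr)
  assume "\<not> ?thesis"
  then obtain y where y: "y \<in> cball x R" "y \<notin> \<Omega>" by blast
  have "0 \<le> R" by (rule order_trans[OF zero_le_dist]) (use y in simp)
  then have "x \<in> cball x R \<inter> \<Omega>" using x by simp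
  \<comment> \<open>A connected set that meets both \<open>\<Omega>\<close> and its complement meets
    the frontier.\<close>
  then have "cball x R \<inter> frontier \<Omega> \<noteq> {}"
    using y by (intro connected_Int_frontier) (blast intro: connected_cball)+
  then obtain z where z: "z \<in> cball x R" "z \<in> frontier \<Omega>" by blast
  then show False using R infdist_le[OF z(2), of x] by (auto simp: dist_commute)
qed

text \<open>In the whole space the radius is arbitrary and the bound forces \<open>s = 0\<close>, a
  Liouville property. Otherwise every radius below the distance is admissible, and the bound passes
  to the limit.\<close>

lemma bound_bdist_npow:
  fixes \<Omega> :: "'a::euclidean_space set"
  assumes \<Omega>: "open \<Omega>" and x: "x \<in> \<Omega>" and \<gamma>: "0 < \<gamma>" and s: "0 \<le> s" and C: "0 < C"
    and le: "\<And>R. 0 < R \<Longrightarrow> cball x R \<subseteq> \<Omega> \<Longrightarrow> s * R powr \<gamma> \<le> C"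
  shows "s \<le> C * bdist_npow \<Omega> x \<gamma>"
proof (cases "frontier \<Omega> = {}")
  case True
  have "s = 0"
  proof (rule ccontr)
    assume "s \<noteq> 0"
    then have s: "0 < s" using s by simp
    \<comment> \<open>Chosen so that \<open>s * R powr \<gamma>\<close> equals \<open>2 * C\<close>,
      contradicting the bound by \<open>C\<close>.\<close>
    define R where "R = (2 * C / s) powr (1 / \<gamma>)"
    have "0 < R" using s C by (simp add: R_def)
    then have "s * R powr \<gamma> \<le> C"
      using cball_subset_if_less_infdist[OF x, of R] True by (intro le) auto
    then show False using s C \<gamma> by (simp add: R_def powr_powr)
  qed
  then show ?thesis using True by (simp add: bdist_npow_def)
next
  case False
  define d where "d = infdist x (frontier \<Omega>)"
  have "x \<notin> frontier \<Omega>" using \<Omega> x by (simp add: frontier_def interior_open)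
  then have d: "0 < d"
    using False infdist_pos_not_in_closed[of "frontier \<Omega>" x] by (simp add: d_def)
  have "s * d powr \<gamma> \<le> C"
  proof (rule field_le_mult_one_interval)
    fix z :: real assume z: "0 < z" "z < 1"
    \<comment> \<open>A radius strictly below the distance, parametrised so that
      \<open>R powr \<gamma>\<close> is \<open>z * d powr \<gamma>\<close>; letting z tend to 1
      reaches the distance itself.\<close>
    define R where "R = z powr (1 / \<gamma>) * d"
    have R: "0 < R" using z d by (simp add: R_def)
    have "z powr (1 / \<gamma>) < 1" using z \<gamma> powr_less_mono2[of "1 / \<gamma>" z 1] by simp
    then have "R < d" using d by (simp add: R_def)
    then have "s * R powr \<gamma> \<le> C"
      using cball_subset_if_less_infdist[OF x, of R] R by (intro le) (auto simp: d_def)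
    then show "z * (s * d powr \<gamma>) \<le> C"
      using z d \<gamma> by (simp add: R_def powr_mult powr_powr mult_ac)
  qed
  then show ?thesis using False d by (simp add: bdist_npow_def d_def powr_minus field_simps)
qed

theorem theorem1p1:
  fixes p q \<delta> \<mu> K1p K2p K1q K2q D \<gamma> \<xi> :: real
  assumes p: "1 < p" "p < real CARD('n::finite)"
    and q: "1 < q" "q < real CARD('n)"
    and exponents: "0 < \<delta>" "0 < \<mu>"
    and D_def: "D = \<delta> * \<mu> - (p - 1) * (q - 1)"
    and D_pos: "D > 0"
    and gamma_def: "\<gamma> = (p * (q - 1) + q * \<delta>) / D"
    and xi_def: "\<xi> = (q * (p - 1) + p * \<mu>) / D"
  shows "\<exists>C>0. \<forall>(\<Omega> :: (real^'n) set) Ap Aq u v.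
    open \<Omega> \<and> connected \<Omega> \<and> \<Omega> \<noteq> {} \<and>
    caratheodory \<Omega> Ap \<and> caratheodory \<Omega> Aq \<and>
    strongly_coercive p K1p K2p \<Omega> Ap \<and> strongly_coercive q K1q K2q \<Omega> Aq \<and>
    continuous_on \<Omega> u \<and> continuous_on \<Omega> v \<and>
    weak_le p \<Omega> Ap u (\<lambda>x. - (v x powr \<delta>)) \<and>
    weak_le q \<Omega> Aq v (\<lambda>x. - (u x powr \<mu>)) \<longrightarrow>
    (\<forall>x\<in>\<Omega>. u x \<le> C * bdist_npow \<Omega> x \<gamma> \<and> v x \<le> C * bdist_npow \<Omega> x \<xi>)"
proof (cases "0 < K1p \<and> 0 < K2p \<and> 0 < K1q \<and> 0 < K2q")
  \<comment> \<open>Strong coercivity includes positivity of its constants, so no admissible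
    operators exist in this case.\<close>
  case False
  then show ?thesis by (intro exI[of _ 1]) (auto simp: strongly_coercive_def)
next
  case True
  then have K: "0 < K1p" "0 < K2p" "0 < K1q" "0 < K2q" by auto
  have pos: "0 < \<gamma>" "0 < \<xi>"
    unfolding gamma_def xi_def using p q exponents D_pos by (auto intro!: divide_pos_pos add_pos_pos)
  have \<gamma>D: "\<gamma> * D = p * (q - 1) + q * \<delta>" and \<xi>D: "\<xi> * D = q * (p - 1) + p * \<mu>"
    using D_pos by (auto simp: gamma_def xi_def)
  \<comment> \<open>\<open>\<gamma>\<close> and \<open>\<xi>\<close> solve the two linear equations
    that express scale invariance of the cross estimates, and \<open>D\<close> is, up to sign, their
    determinant. Multiplying by \<open>D\<close> avoids fractions in the verification.\<close>
  have "(\<xi> * \<delta>) * D = (\<xi> * D) * \<delta>" by simp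
  also have "\<dots> = (p * (q - 1) + q * \<delta>) * (p - 1) + p * (\<delta> * \<mu> - (p - 1) * (q - 1))"
    unfolding \<xi>D by (simp add: algebra_simps)
  also have "\<dots> = (\<gamma> * (p - 1) + p) * D"
    unfolding \<gamma>D[symmetric] D_def[symmetric] by (simp add: algebra_simps)
  finally have "(\<xi> * \<delta>) * D = (\<gamma> * (p - 1) + p) * D" .
  then have exps1: "\<xi> * \<delta> = \<gamma> * (p - 1) + p" using D_pos by simp
  have "(\<gamma> * \<mu>) * D = (\<gamma> * D) * \<mu>" by simp
  also have "\<dots> = (q * (p - 1) + p * \<mu>) * (q - 1) + q * (\<delta> * \<mu> - (p - 1) * (q - 1))"
    unfolding \<gamma>D by (simp add: algebra_simps)
  also have "\<dots> = (\<xi> * (q - 1) + q) * D"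
    unfolding \<xi>D[symmetric] D_def[symmetric] by (simp add: algebra_simps)
  finally have "(\<gamma> * \<mu>) * D = (\<xi> * (q - 1) + q) * D" .
  then have exps2: "\<gamma> * \<mu> = \<xi> * (q - 1) + q" using D_pos by simp
  obtain C1 where C1: "0 < C1" and
    cross1: "\<And>(\<Omega>::(real^'n) set) Ap Aq u v h x0 R S. open \<Omega> \<Longrightarrow> 0 < R \<Longrightarrow> cball x0 R \<subseteq> \<Omega> \<Longrightarrow>
      strongly_coercive p K1p K2p \<Omega> Ap \<Longrightarrow> strongly_coercive q K1q K2q \<Omega> Aq \<Longrightarrow>
      continuous_on \<Omega> u \<Longrightarrow> continuous_on \<Omega> v \<Longrightarrow>
      weak_le p \<Omega> Ap u (\<lambda>x. - (v x powr \<delta>)) \<Longrightarrow> weak_le q \<Omega> Aq v (\<lambda>x. - h x) \<Longrightarrow>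
      (\<And>x. x \<in> \<Omega> \<Longrightarrow> 0 \<le> h x) \<Longrightarrow> 0 \<le> \<delta> \<Longrightarrow> 0 < v x0 \<Longrightarrow> (\<And>x. x \<in> cball x0 R \<Longrightarrow> v x \<le> 2 powr \<xi> * v x0) \<Longrightarrow>
      0 < S \<Longrightarrow> (\<And>x. x \<in> cball x0 R \<Longrightarrow> u x \<le> S) \<Longrightarrow>
      v x0 powr \<delta> \<le> C1 * S powr (p - 1) * R powr (- p)"
    by (rule cross_estimate[OF p(1) q(1) K, of "2 powr \<xi>" \<delta>]) auto
  \<comment> \<open>The same estimate with the two inequalities, their exponents and their
    coercivity constants exchanged.\<close>
  obtain C2 where C2: "0 < C2" and
    cross2: "\<And>(\<Omega>::(real^'n) set) Ap Aq u v h x0 R S. open \<Omega> \<Longrightarrow> 0 < R \<Longrightarrow> cball x0 R \<subseteq> \<Omega> \<Longrightarrow>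
      strongly_coercive q K1q K2q \<Omega> Ap \<Longrightarrow> strongly_coercive p K1p K2p \<Omega> Aq \<Longrightarrow>
      continuous_on \<Omega> u \<Longrightarrow> continuous_on \<Omega> v \<Longrightarrow>
      weak_le q \<Omega> Ap u (\<lambda>x. - (v x powr \<mu>)) \<Longrightarrow> weak_le p \<Omega> Aq v (\<lambda>x. - h x) \<Longrightarrow>
      (\<And>x. x \<in> \<Omega> \<Longrightarrow> 0 \<le> h x) \<Longrightarrow> 0 \<le> \<mu> \<Longrightarrow> 0 < v x0 \<Longrightarrow> (\<And>x. x \<in> cball x0 R \<Longrightarrow> v x \<le> 2 powr \<gamma> * v x0) \<Longrightarrow>
      0 < S \<Longrightarrow> (\<And>x. x \<in> cball x0 R \<Longrightarrow> u x \<le> S) \<Longrightarrow>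
      v x0 powr \<mu> \<le> C2 * S powr (q - 1) * R powr (- q)"
    by (rule cross_estimate[OF q(1) p(1) K(3,4,1,2), of "2 powr \<gamma>" \<mu>]) auto
  define A1 where "A1 = C1 * 2 powr (\<xi> * \<delta>)"
  define A2 where "A2 = C2 * 2 powr (\<gamma> * \<mu>)"
  have A: "0 < A1" "0 < A2" using C1 C2 by (auto simp: A1_def A2_def)
  \<comment> \<open>The constants returned by \<open>coupled_power_bound\<close> for the two orders
    of elimination.\<close>
  define Cu where "Cu = (A2 powr \<delta> * A1 powr (q - 1)) powr (1 / D)"
  define Cv where "Cv = (A1 powr \<mu> * A2 powr (p - 1)) powr (1 / D)"
  define C where "C = max Cu Cv"
  have C: "0 < C" using A by (auto simp: C_def Cu_def less_max_iff_disj)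
  show ?thesis
  proof (intro exI[of _ C] conjI C allI impI ballI; elim conjE)
    fix \<Omega> :: "(real^'n) set" and Ap Aq u v x
    assume op: "open \<Omega>" and co: "strongly_coercive p K1p K2p \<Omega> Ap" "strongly_coercive q K1q K2q \<Omega> Aq"
      and cont: "continuous_on \<Omega> u" "continuous_on \<Omega> v"
      and we: "weak_le p \<Omega> Ap u (\<lambda>x. - (v x powr \<delta>))" "weak_le q \<Omega> Aq v (\<lambda>x. - (u x powr \<mu>))"
      and x: "x \<in> \<Omega>"
    have nn: "0 \<le> u y" "0 \<le> v y" if "y \<in> \<Omega>" for y
      using we that by (auto simp: weak_le_def)
    have main: "u x * R powr \<gamma> \<le> Cu \<and> v x * R powr \<xi> \<le> Cv" if R: "0 < R" "cball x R \<subseteq> \<Omega>" for R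
    proof -
      note nnR = nn[OF subsetD[OF R(2)]]
      obtain y where y: "y \<in> cball x R"
        and ymax: "\<And>z. z \<in> cball x R \<Longrightarrow> u z * (R - dist x z) powr \<gamma> \<le> u y * (R - dist x y) powr \<gamma>"
        using weighted_maximum[OF R(1) continuous_on_subset[OF cont(1) R(2)] nnR(1) pos(1)] by metis
      obtain y' where y': "y' \<in> cball x R"
        and y'max: "\<And>z. z \<in> cball x R \<Longrightarrow> v z * (R - dist x z) powr \<xi> \<le> v y' * (R - dist x y') powr \<xi>"
        using weighted_maximum[OF R(1) continuous_on_subset[OF cont(2) R(2)] nnR(2) pos(2)] by metis
      define a where "a = u y * (R - dist x y) powr \<gamma>"
      define b where "b = v y' * (R - dist x y') powr \<xi>"
      have ab: "0 \<le> a" "0 \<le> b" using nnR(1)[OF y] nnR(2)[OF y'] by (auto simp: a_def b_def)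
      have 1: "b powr \<delta> \<le> A1 * t powr (p - 1)" if t: "0 < t" "a \<le> t" for t
        unfolding b_def A1_def
      proof (rule weighted_max_estimate[OF R(1) pos exponents(1) _ exps1 p(1) nnR _ y' y'max t(1)])
        show "u z * (R - dist x z) powr \<gamma> \<le> t" if "z \<in> cball x R" for z
          using ymax[OF that] t(2) by (simp add: a_def)
        show "v z powr \<delta> \<le> C1 * S powr (p - 1) * r powr - p"
          if "0 < r" "cball z r \<subseteq> cball x R" "0 < v z" "\<And>y. y \<in> cball z r \<Longrightarrow> v y \<le> 2 powr \<xi> * v z" "0 < S"
            "\<And>y. y \<in> cball z r \<Longrightarrow> u y \<le> S" for z r S
          by (rule cross1[OF op that(1) _ co cont we]) (use that R exponents in auto)
      qed (use C1 in auto)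
      have 2: "a powr \<mu> \<le> A2 * t powr (q - 1)" if t: "0 < t" "b \<le> t" for t
        unfolding a_def A2_def
      proof (rule weighted_max_estimate[OF R(1) pos(2,1) exponents(2) _ exps2 q(1) nnR(2,1) _ y ymax t(1)])
        show "v z * (R - dist x z) powr \<xi> \<le> t" if "z \<in> cball x R" for z
          using y'max[OF that] t(2) by (simp add: b_def)
        show "u z powr \<mu> \<le> C2 * S powr (q - 1) * r powr - q"
          if "0 < r" "cball z r \<subseteq> cball x R" "0 < u z" "\<And>y. y \<in> cball z r \<Longrightarrow> u y \<le> 2 powr \<gamma> * u z" "0 < S"
            "\<And>y. y \<in> cball z r \<Longrightarrow> v y \<le> S" for z r S
          by (rule cross2[OF op that(1) _ co(2,1) cont(2,1) we(2,1)]) (use that R exponents in auto)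
      qed (use C2 in auto)
      have D': "0 < \<delta> * \<mu> - (p - 1) * (q - 1)" "0 < \<mu> * \<delta> - (q - 1) * (p - 1)"
        "\<mu> * \<delta> - (q - 1) * (p - 1) = D" using D_pos by (simp_all add: D_def mult.commute)
      have "a \<le> Cu"
        unfolding Cu_def D_def by (rule coupled_power_bound[OF ab A p(1) q(1) exponents D'(1) 1 2])
      moreover have "b \<le> Cv"
        unfolding Cv_def D'(3)[symmetric]
        by (rule coupled_power_bound[OF ab(2,1) A(2,1) q(1) p(1) exponents(2,1) D'(2) 2 1])
      \<comment> \<open>At the centre of the ball the weight has the full radius as its
        base.\<close>
      moreover have "u x * R powr \<gamma> \<le> a" "v x * R powr \<xi> \<le> b"
        using ymax[of x] y'max[of x] R(1) by (auto simp: a_def b_def)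
      ultimately show ?thesis by linarith
    qed
    show "u x \<le> C * bdist_npow \<Omega> x \<gamma>" "v x \<le> C * bdist_npow \<Omega> x \<xi>"
    proof -
      have "u x * R powr \<gamma> \<le> C" "v x * R powr \<xi> \<le> C" if "0 < R" "cball x R \<subseteq> \<Omega>" for R
        using main[OF that] by (auto simp: C_def)
      then show "u x \<le> C * bdist_npow \<Omega> x \<gamma>" "v x \<le> C * bdist_npow \<Omega> x \<xi>"
        by (intro bound_bdist_npow[OF op x] pos nn[OF x] C; blast)+
    qed
  qed
qed

end
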